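(* Consider the smoothed problem $\min_{\beta\in\Omega}F_\sigma(\beta)$ with minimizer $\beta^*$ and the PS-BCD algorithm described in the context. Suppose the stochastic gradient used in PS-BCD is an unbiased estimator of $\nabla_\beta F_\sigma(\beta)$ and satisfies $\mathbb{E}[\|G(\beta^k,w^k)-\nabla_\beta F_\sigma(\beta^k)\|_{\nu,*}^2\mid\beta^k]\le\chi^2$ for all $k$, and that $\beta^1=0$. Then for any $\epsilon>0$, PS-BCD achieves $\mathbb{E}[F_\sigma(\bar\beta^K)]-F_\sigma(\beta^* )\le\epsilon$ in $$\tilde{\mathcal{O}}\Big(\frac{1}{\epsilon^2}\Big(\sum_{t=0}^{T-1}\nu_t\Big)^2\Big)$$ iterations. This is bounded above by $\tilde{\mathcal{O}}\big(1/(\sigma(1-\gamma)\epsilon)^2\big)$ for WTCA and by $\tilde{\mathcal{O}}\big(|\mathcal{A}|^2T^2/(\sigma(1-\gamma)\epsilon)^2\big)$ for PO, where $\chi^2$ is a constant independent of $T$ for both formulations.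
   Context: General smoothed problem. $\beta=(\beta_0,\ldots,\beta_{T-1})\in\mathbb{R}^{BT}$ with stage blocks $\beta_t\in\mathbb{R}^B$; $\Omega\subseteq\mathbb{R}^{BT}$ is a sufficiently large compact convex set whose interior contains the optimal solutions, $\Omega_t$ its projection onto block $t$; $w=(w_0,\ldots,w_{T-1})$ is a random trajectory with law $\xi$. Components $f_j(\beta,w)=c_j\max_{u\in\mathcal{U}_j}\{a_{j,w}(u)^\top\beta+b_{j,w}(u)\}$, $j=1,\ldots,m$ ($c_j>0$, $\mathcal{U}_j$ finite); $f_{j,\sigma}(\beta,w)=\sigma c_j\log\sum_{u\in\mathcal{U}_j}\exp((a_{j,w}(u)^\top\beta+b_{j,w}(u))/\sigma)$; $F_\sigma(\beta)=\mathbb{E}_\xi[\sum_jf_{j,\sigma}(\beta,w)]$. $C_j$ is the set of stages whose blocks appear in $f_j$, $\kappa_j=|C_j|$. $L_{jt}$ is the Lipschitz constant of the block-$t$ partial gradient of $\mathbb{E}_\xi[f_{j,\sigma}]$; the constant used is $L_{jt}=\frac{c_j}{\sigma}\mathbb{E}_\xi\|A_{j,w}^{(t)}\|^2$, with $A_{j,w}^{(t)}$ the matrix whose rows are the block-$t$ parts of $a_{j,w}(u)^\top$, $u\in\mathcal{U}_j$ (spectral norm). $\nu_t=\sum_{j:t\in C_j}\kappa_jL_{jt}$, $\|\beta\|_{\nu,*}^2=\sum_t\nu_t^{-1}\|\beta_t\|_2^2$. $G(\beta,w)=\sum_j\nabla_\beta f_{j,\sigma}(\beta,w)$ with block-$t$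 part $G_t$. PS-BCD. Stepsizes $\alpha_k=1/(2\sqrt{k+1})$. For $k=1,\ldots,K$: draw $w^k$ independently from $\xi$; for all $t$ in parallel set $\beta_t^{k+1}=\mathrm{proj}_{\Omega_t}(\beta_t^k-\frac{\alpha_k}{\nu_t}G_t(\beta^k,w^k))$. Output $\bar\beta^K=(\sum_{k=2}^K\alpha_{k-1}\beta^k)/(\sum_{k=1}^{K-1}\alpha_k)$. $\tilde{\mathcal{O}}$ suppresses logarithmic factors. MDP and the two formulations. Stages $\{0,\ldots,T-1\}$, discount $\gamma\in(0,1)$, states $s_t=(x_t,w_t)$ with $x_t$ in a finite set $\mathcal{X}_t$ and $w_t$ exogenous (Markov process with law $\mu$ independent of actions), finite action sets $\mathcal{A}_t$, $x_{t+1}=h(x_t,a_t)$, rewards $r_t(s_t,a_t)$, fixed $s_0=(x_0,w_0)$. Basis vectors $\phi_t(s_t)\in\mathbb{R}^B$, with value approximation $\phi_t(s_t)^\top\beta_t$ at stage $t\le T-1$ and $0$ at stage $T$ (so any "block $T$" below is absent). In both formulations $\xi=\mu$. WTCA: $m=T$, components indexed by $t=0,\ldots,T-1$, $c_t=\gamma^t$, $\mathcal{U}_0=\mathcal{A}_0$, $\mathcal{U}_t=\mathcal{X}_t\times\mathcal{A}_t$ for $t\ge1$. For $t\ge1$ the vector $a_{t,w_t}(x_t,a_t)$ has block $t$ equal to $-\phi_t(x_t,w_t)$, block $t+1$ equal to $\gamma\mathbb{E}[\phi_{t+1}(h(x_t,a_t),w_{t+1})\mid w_t]$ and all other blocks zero,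 with $b_{t,w_t}(x_t,a_t)=r_t((x_t,w_t),a_t)$; for $t=0$ the only nonzero block is block $1$, equal to $\gamma\mathbb{E}[\phi_1(s_1)\mid s_0,a_0]$, and $b=r_0(s_0,a_0)$. Here $C_t=\{t,t+1\}$, $\kappa_t=2$. PO: $m=1$, $c_1=1$, $\mathcal{U}_1=\mathcal{A}=\mathcal{A}_0\times\cdots\times\mathcal{A}_{T-1}$; for $u=(a_0,\ldots,a_{T-1})$ with induced $x_{t+1}=h(x_t,a_t)$, $b_w(u)=\sum_{t}\gamma^tr_t((x_t,w_t),a_t)$, and $a_w(u)$ has zero block $0$ and block $t+1$ equal to $\gamma^{t+1}(-\phi_{t+1}(x_{t+1},w_{t+1})+\mathbb{E}[\phi_{t+1}(x_{t+1},w_{t+1})\mid w_t])$. Here $C_1=\{0,\ldots,T-1\}$, $\kappa_1=T$. Standing assumptions: $\|\phi_t(s_t)\|_2\le1$ for all $t,s_t$; $|\mathcal{X}_t||\mathcal{A}_t|$ is bounded uniformly in $t$ (treated as $\mathcal{O}(1)$); the block norms $\|\beta_t^*\|_2$ are bounded by constants independent of $T$ and $\sigma$; $\sigma\in(0,1)$, and leading-order terms are retained.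
   Formalization: In the general bound the sum of the ν_t is assumed bounded below by a positive constant on which the hidden constant may depend; with constants depending only on χ² and the bound on the blocks of β*, the claim fails as the sum of the ν_t tends to 0. *)

theory Defs
  imports "HOL-Probability.Probability"
begin

section \<open>The smoothed problem\<close>

text \<open>
  A vector of \<open>\<real>\<^sup>B\<^sup>T\<close> is a function in \<open>{..<T} \<rightarrow>\<^sub>E UNIV\<close> with values in \<open>real ^ 'b\<close>, so that
  the number of stages is a term while \<open>B = CARD('b)\<close>. Stages and components are numbered from 0.

  The set \<open>appearing j\<close> only has to contain the stages whose block occurs in component \<open>j\<close>;
  both concrete formulations below use a set that may have an element without influence.
\<close>

record ('w, 'u, 'b) smoothed_problem =
  stages    :: nat
  comps     :: nat
  weight    :: "nat \<Rightarrow> real"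
  choices   :: "nat \<Rightarrow> 'u set"
  slope     :: "nat \<Rightarrow> 'w \<Rightarrow> 'u \<Rightarrow> nat \<Rightarrow> real ^ 'b"
  offset    :: "nat \<Rightarrow> 'w \<Rightarrow> 'u \<Rightarrow> real"
  appearing :: "nat \<Rightarrow> nat set"
  law       :: "'w measure"
  smoothing :: real

type_synonym 'b blocks = "nat \<Rightarrow> real ^ 'b"

definition block_vectors :: "('w, 'u, 'b::finite) smoothed_problem \<Rightarrow> 'b blocks set" where
  "block_vectors Q = ({..<stages Q} \<rightarrow>\<^sub>E UNIV)"

definition block_topology :: "('w, 'u, 'b::finite) smoothed_problem \<Rightarrow> 'b blocks topology" where
  "block_topology Q = product_topology (\<lambda>_. euclidean) {..<stages Q}"

definition block_borel :: "('w, 'u, 'b::finite) smoothed_problem \<Rightarrow> 'b blocks measure" where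
  "block_borel Q = (\<Pi>\<^sub>M t\<in>{..<stages Q}. borel)"

definition affine_piece ::
  "('w, 'u, 'b::finite) smoothed_problem \<Rightarrow> nat \<Rightarrow> 'b blocks \<Rightarrow> 'w \<Rightarrow> 'u \<Rightarrow> real" where
  "affine_piece Q j \<beta> w u = (\<Sum>t<stages Q. slope Q j w u t \<bullet> \<beta> t) + offset Q j w u"

definition smoothed_comp ::
  "('w, 'u, 'b::finite) smoothed_problem \<Rightarrow> nat \<Rightarrow> 'b blocks \<Rightarrow> 'w \<Rightarrow> real" where
  "smoothed_comp Q j \<beta> w =
     smoothing Q * weight Q j *
     ln (\<Sum>u\<in>choices Q j. exp (affine_piece Q j \<beta> w u / smoothing Q))"

definition objective :: "('w, 'u, 'b::finite) smoothed_problem \<Rightarrow> 'b blocks \<Rightarrow> real" where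
  "objective Q \<beta> = (\<integral>w. (\<Sum>j<comps Q. smoothed_comp Q j \<beta> w) \<partial>law Q)"

definition block_grad :: "('b::finite blocks \<Rightarrow> real) \<Rightarrow> nat \<Rightarrow> 'b blocks \<Rightarrow> real ^ 'b" where
  "block_grad f t \<beta> = (THE D. GDERIV (\<lambda>y. f (\<beta>(t := y))) (\<beta> t) :> D)"

definition stoch_grad ::
  "('w, 'u, 'b::finite) smoothed_problem \<Rightarrow> nat \<Rightarrow> 'b blocks \<Rightarrow> 'w \<Rightarrow> real ^ 'b" where
  "stoch_grad Q t \<beta> w = (\<Sum>j<comps Q. block_grad (\<lambda>\<beta>'. smoothed_comp Q j \<beta>' w) t \<beta>)"

text \<open>Spectral norm of the matrix whose rows are \<open>v u\<close> for \<open>u \<in> U\<close>.\<close>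

definition spectral_norm :: "'u set \<Rightarrow> ('u \<Rightarrow> real ^ 'b::finite) \<Rightarrow> real" where
  "spectral_norm U v = (SUP x\<in>{x. norm x \<le> 1}. L2_set (\<lambda>u. v u \<bullet> x) U)"

definition comp_lipschitz :: "('w, 'u, 'b::finite) smoothed_problem \<Rightarrow> nat \<Rightarrow> nat \<Rightarrow> real" where
  "comp_lipschitz Q j t =
     weight Q j / smoothing Q *
     (\<integral>w. (spectral_norm (choices Q j) (\<lambda>u. slope Q j w u t))\<^sup>2 \<partial>law Q)"

definition block_weight :: "('w, 'u, 'b::finite) smoothed_problem \<Rightarrow> nat \<Rightarrow> real" where
  "block_weight Q t =
     (\<Sum>j | j < comps Q \<and> t \<in> appearing Q j. real (card (appearing Q j)) * comp_lipschitz Q j t)"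

definition total_weight :: "('w, 'u, 'b::finite) smoothed_problem \<Rightarrow> real" where
  "total_weight Q = (\<Sum>t<stages Q. block_weight Q t)"

text \<open>
  The division convention \<open>x / 0 = 0\<close> is harmless here and in the iteration below: if
  \<open>block_weight Q t = 0\<close>, then block \<open>t\<close> almost surely has no influence and the
  block-\<open>t\<close> part of every gradient vanishes.
\<close>

definition dual_norm_sq :: "('w, 'u, 'b::finite) smoothed_problem \<Rightarrow> 'b blocks \<Rightarrow> real" where
  "dual_norm_sq Q \<beta> = (\<Sum>t<stages Q. (norm (\<beta> t))\<^sup>2 / block_weight Q t)"

text \<open>
  The integrability conditions say that the expectations defining the objective and
  the Lipschitz constants exist.
\<close>

definition well_posed :: "('w, 'u, 'b::finite) smoothed_problem \<Rightarrow> bool" where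
  "well_posed Q \<longleftrightarrow>
     prob_space (law Q) \<and> 0 < smoothing Q \<and> smoothing Q < 1 \<and>
     (\<forall>j<comps Q.
        0 < weight Q j \<and> finite (choices Q j) \<and> choices Q j \<noteq> {} \<and> finite (appearing Q j) \<and>
        (\<forall>u\<in>choices Q j.
           (\<lambda>w. offset Q j w u) \<in> borel_measurable (law Q) \<and>
           (\<forall>t<stages Q. (\<lambda>w. slope Q j w u t) \<in> borel_measurable (law Q)) \<and>
           (\<forall>t<stages Q. t \<notin> appearing Q j \<longrightarrow> (\<forall>w\<in>space (law Q). slope Q j w u t = 0))) \<and>
        (\<forall>t<stages Q.
           integrable (law Q) (\<lambda>w. (spectral_norm (choices Q j) (\<lambda>u. slope Q j w u t))\<^sup>2)) \<and>
        (\<forall>\<beta>\<in>block_vectors Q. integrable (law Q) (smoothed_comp Q j \<beta>)))"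

definition feasible_region :: "('w, 'u, 'b::finite) smoothed_problem \<Rightarrow> 'b blocks set \<Rightarrow> bool" where
  "feasible_region Q \<Omega> \<longleftrightarrow>
     compactin (block_topology Q) \<Omega> \<and>
     (\<forall>\<beta>\<in>\<Omega>. \<forall>\<beta>'\<in>\<Omega>. \<forall>l\<in>{0..1}. (\<lambda>t\<in>{..<stages Q}. (1 - l) *\<^sub>R \<beta> t + l *\<^sub>R \<beta>' t) \<in> \<Omega>)"

definition interior_minimizer ::
  "('w, 'u, 'b::finite) smoothed_problem \<Rightarrow> 'b blocks set \<Rightarrow> 'b blocks \<Rightarrow> bool" where
  "interior_minimizer Q \<Omega> \<beta>opt \<longleftrightarrow>
     \<beta>opt \<in> (block_topology Q) interior_of \<Omega> \<and> (\<forall>\<beta>\<in>\<Omega>. objective Q \<beta>opt \<le> objective Q \<beta>)"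

section \<open>The algorithm PS-BCD\<close>

definition stepsize :: "nat \<Rightarrow> real" where
  "stepsize k = 1 / (2 * sqrt (real k + 1))"

text \<open>
  \<open>psbcd Q \<Omega> ws k\<close> is the iterate \<open>\<beta>\<^sup>k\<close> for the drawn sequence \<open>ws 1, ws 2, \<dots>\<close>. The iteration
  starts at \<open>k = 1\<close> with 0; the value at \<open>k = 0\<close> is never used.
\<close>

primrec psbcd ::
  "('w, 'u, 'b::finite) smoothed_problem \<Rightarrow> 'b blocks set \<Rightarrow> (nat \<Rightarrow> 'w) \<Rightarrow> nat \<Rightarrow> 'b blocks" where
  "psbcd Q \<Omega> ws 0 = (\<lambda>t\<in>{..<stages Q}. 0)"
| "psbcd Q \<Omega> ws (Suc k) =
     (if k = 0 then (\<lambda>t\<in>{..<stages Q}. 0)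
      else (\<lambda>t\<in>{..<stages Q}.
        closest_point ((\<lambda>\<beta>. \<beta> t) ` \<Omega>)
          (psbcd Q \<Omega> ws k t -
           (stepsize k / block_weight Q t) *\<^sub>R stoch_grad Q t (psbcd Q \<Omega> ws k) (ws k))))"

definition psbcd_output ::
  "('w, 'u, 'b::finite) smoothed_problem \<Rightarrow> 'b blocks set \<Rightarrow> (nat \<Rightarrow> 'w) \<Rightarrow> nat \<Rightarrow> 'b blocks" where
  "psbcd_output Q \<Omega> ws K =
     (\<lambda>t\<in>{..<stages Q}.
        (\<Sum>k=2..K. stepsize (k - 1) *\<^sub>R psbcd Q \<Omega> ws k t) /\<^sub>R (\<Sum>k=1..K-1. stepsize k))"

definition iid_draws ::
  "('w, 'u, 'b::finite) smoothed_problem \<Rightarrow> 'p measure \<Rightarrow> (nat \<Rightarrow> 'p \<Rightarrow> 'w) \<Rightarrow> bool" where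
  "iid_draws Q P W \<longleftrightarrow>
     prob_space P \<and> prob_space.indep_vars P (\<lambda>_. law Q) W {1..} \<and>
     (\<forall>k\<ge>1. distr P (law Q) (W k) = law Q)"

definition unbiased :: "('w, 'u, 'b::finite) smoothed_problem \<Rightarrow> bool" where
  "unbiased Q \<longleftrightarrow>
     (\<forall>\<beta>\<in>block_vectors Q. \<forall>t<stages Q.
        integrable (law Q) (stoch_grad Q t \<beta>) \<and>
        (\<integral>w. stoch_grad Q t \<beta> w \<partial>law Q) = block_grad (objective Q) t \<beta>)"

text \<open>
  The conditional expectation given \<open>\<beta>\<^sup>k\<close> is taken in its nonnegative version, which also
  has its intended meaning when the integrand is not integrable.
\<close>

definition variance_bound ::
  "('w, 'u, 'b::finite) smoothed_problem \<Rightarrow> 'b blocks set \<Rightarrow> 'p measure \<Rightarrow> (nat \<Rightarrow> 'p \<Rightarrow> 'w) \<Rightarrow>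
     real \<Rightarrow> bool" where
  "variance_bound Q \<Omega> P W \<chi>2 \<longleftrightarrow>
     (\<forall>k\<ge>1. let \<beta> = (\<lambda>\<omega>. psbcd Q \<Omega> (\<lambda>i. W i \<omega>) k) in
        AE \<omega> in P.
          nn_cond_exp P (vimage_algebra (space P) \<beta> (block_borel Q))
            (\<lambda>\<omega>. ennreal (dual_norm_sq Q
               (\<lambda>t. stoch_grad Q t (\<beta> \<omega>) (W k \<omega>) - block_grad (objective Q) t (\<beta> \<omega>)))) \<omega>
          \<le> ennreal \<chi>2)"

text \<open>What is assumed of a run of the algorithm, apart from the variance bound.\<close>

definition psbcd_run ::
  "('w, 'u, 'b::finite) smoothed_problem \<Rightarrow> 'b blocks set \<Rightarrow> 'b blocks \<Rightarrow> real \<Rightarrow> 'p measure \<Rightarrow>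
     (nat \<Rightarrow> 'p \<Rightarrow> 'w) \<Rightarrow> bool" where
  "psbcd_run Q \<Omega> \<beta>opt M P W \<longleftrightarrow>
     feasible_region Q \<Omega> \<and> interior_minimizer Q \<Omega> \<beta>opt \<and> (\<forall>t<stages Q. norm (\<beta>opt t) \<le> M) \<and>
     iid_draws Q P W \<and> unbiased Q"

text \<open>
  Precision \<open>\<epsilon>\<close> is reached within \<open>N\<close> iterations, and kept from then on. The output is an empty
  average for \<open>K < 2\<close>.
\<close>

definition achieves_within ::
  "('w, 'u, 'b::finite) smoothed_problem \<Rightarrow> 'b blocks set \<Rightarrow> 'b blocks \<Rightarrow> 'p measure \<Rightarrow>
     (nat \<Rightarrow> 'p \<Rightarrow> 'w) \<Rightarrow> real \<Rightarrow> real \<Rightarrow> bool" where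
  "achieves_within Q \<Omega> \<beta>opt P W \<epsilon> N \<longleftrightarrow>
     (\<forall>K\<ge>2. N \<le> real K \<longrightarrow>
        (\<integral>\<omega>. objective Q (psbcd_output Q \<Omega> (\<lambda>i. W i \<omega>) K) \<partial>P) - objective Q \<beta>opt \<le> \<epsilon>)"

text \<open>A quantity is in \<open>O(g)\<close> up to logarithmic factors if it is at most \<open>soft_bound C p g\<close>
  for constants \<open>C\<close> and \<open>p\<close>.\<close>

definition soft_bound :: "real \<Rightarrow> nat \<Rightarrow> real \<Rightarrow> real" where
  "soft_bound C p g = C * g * (ln (exp 1 + g)) ^ p"

section \<open>The Markov decision process and its two formulations\<close>

record ('x, 'a, 'v, 'b) mdp =
  horizon  :: nat
  discount :: real
  endo     :: "nat \<Rightarrow> 'x set"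
  actions  :: "nat \<Rightarrow> 'a set"
  exo      :: "nat \<Rightarrow> 'v measure"
  trans    :: "'x \<Rightarrow> 'a \<Rightarrow> 'x"
  reward   :: "nat \<Rightarrow> 'x \<times> 'v \<Rightarrow> 'a \<Rightarrow> real"
  endo0    :: 'x
  exo0     :: 'v
  kernel   :: "nat \<Rightarrow> 'v \<Rightarrow> 'v measure"
  exo_law  :: "(nat \<Rightarrow> 'v) measure"
  basis    :: "nat \<Rightarrow> 'x \<times> 'v \<Rightarrow> real ^ 'b"

text \<open>
  \<open>exo_law D\<close> is the law of a Markov process \<open>w\<^sub>0, \<dots>, w\<^sub>T\<^sub>-\<^sub>1\<close> started at \<open>exo0 D\<close>:
  given the history up to stage \<open>t\<close>, the next state has law \<open>kernel D t (w t)\<close>.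
\<close>

definition markov_exo_law :: "('x, 'a, 'v, 'b::finite) mdp \<Rightarrow> bool" where
  "markov_exo_law D \<longleftrightarrow>
     prob_space (exo_law D) \<and> sets (exo_law D) = sets (\<Pi>\<^sub>M t\<in>{..<horizon D}. exo D t) \<and>
     exo0 D \<in> space (exo D 0) \<and> (AE w in exo_law D. w 0 = exo0 D) \<and>
     (\<forall>t. Suc t < horizon D \<longrightarrow>
        kernel D t \<in> exo D t \<rightarrow>\<^sub>M prob_algebra (exo D (Suc t)) \<and>
        (\<forall>H\<in>sets (\<Pi>\<^sub>M i\<in>{..t}. exo D i). \<forall>E\<in>sets (exo D (Suc t)).
           emeasure (exo_law D) {w \<in> space (exo_law D). restrict w {..t} \<in> H \<and> w (Suc t) \<in> E} =
           (\<integral>\<^sup>+w. indicator H (restrict w {..t}) * emeasure (kernel D t (w t)) E \<partial>exo_law D)))"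

definition valid_mdp :: "nat \<Rightarrow> ('x, 'a, 'v, 'b::finite) mdp \<Rightarrow> bool" where
  "valid_mdp S D \<longleftrightarrow>
     1 \<le> horizon D \<and> 0 < discount D \<and> discount D < 1 \<and> endo0 D \<in> endo D 0 \<and> markov_exo_law D \<and>
     (\<forall>t<horizon D.
        finite (endo D t) \<and> finite (actions D t) \<and> actions D t \<noteq> {} \<and>
        card (endo D t) * card (actions D t) \<le> S \<and>
        (\<forall>x\<in>endo D t.
           (\<lambda>v. basis D t (x, v)) \<in> borel_measurable (exo D t) \<and>
           (\<forall>v\<in>space (exo D t). norm (basis D t (x, v)) \<le> 1) \<and>
           (\<forall>a\<in>actions D t.
              integrable (exo_law D) (\<lambda>w. reward D t (x, w t) a) \<and>
              (Suc t < horizon D \<longrightarrow> trans D x a \<in> endo D (Suc t)))))"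

text \<open>\<open>next_basis D t x v\<close> is the conditional expectation of the stage-\<open>t + 1\<close> basis vector at
  endogenous state \<open>x\<close> given that \<open>w t = v\<close>.\<close>

definition next_basis :: "('x, 'a, 'v, 'b::finite) mdp \<Rightarrow> nat \<Rightarrow> 'x \<Rightarrow> 'v \<Rightarrow> real ^ 'b" where
  "next_basis D t x v = (\<integral>v'. basis D (Suc t) (x, v') \<partial>kernel D t v)"

text \<open>
  In stage 0 the state is fixed, so the choices are pairs \<open>(endo0 D, a)\<close> with an action \<open>a\<close>.
  The slope block with index \<open>horizon D\<close> is never used.
\<close>

definition wtca ::
  "('x, 'a, 'v, 'b::finite) mdp \<Rightarrow> real \<Rightarrow> (nat \<Rightarrow> 'v, 'x \<times> 'a, 'b) smoothed_problem" where
  "wtca D \<sigma> =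
     \<lparr> stages = horizon D,
       comps = horizon D,
       weight = (\<lambda>t. discount D ^ t),
       choices = (\<lambda>t. (if t = 0 then {endo0 D} else endo D t) \<times> actions D t),
       slope = (\<lambda>t w (x, a) s.
         if s = Suc t
           then discount D *\<^sub>R next_basis D t (trans D x a) (if t = 0 then exo0 D else w t)
         else if s = t \<and> t \<noteq> 0 then - basis D t (x, w t)
         else 0),
       offset = (\<lambda>t w (x, a). reward D t (x, if t = 0 then exo0 D else w t) a),
       appearing = (\<lambda>t. {t, Suc t}),
       law = exo_law D,
       smoothing = \<sigma> \<rparr>"

primrec induced_state :: "('x, 'a, 'v, 'b::finite) mdp \<Rightarrow> (nat \<Rightarrow> 'a) \<Rightarrow> nat \<Rightarrow> 'x" where
  "induced_state D u 0 = endo0 D"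
| "induced_state D u (Suc t) = trans D (induced_state D u t) (u t)"

definition policies :: "('x, 'a, 'v, 'b::finite) mdp \<Rightarrow> (nat \<Rightarrow> 'a) set" where
  "policies D = (\<Pi>\<^sub>E t\<in>{..<horizon D}. actions D t)"

definition po ::
  "('x, 'a, 'v, 'b::finite) mdp \<Rightarrow> real \<Rightarrow> (nat \<Rightarrow> 'v, nat \<Rightarrow> 'a, 'b) smoothed_problem" where
  "po D \<sigma> =
     \<lparr> stages = horizon D,
       comps = 1,
       weight = (\<lambda>_. 1),
       choices = (\<lambda>_. policies D),
       slope = (\<lambda>_ w u s. case s of
         0 \<Rightarrow> 0
       | Suc t \<Rightarrow> discount D ^ Suc t *\<^sub>R
           (- basis D (Suc t) (induced_state D u (Suc t), w (Suc t)) +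
            next_basis D t (induced_state D u (Suc t)) (w t))),
       offset = (\<lambda>_ w u.
         \<Sum>t<horizon D. discount D ^ t * reward D t (induced_state D u t, w t) (u t)),
       appearing = (\<lambda>_. {..<horizon D}),
       law = exo_law D,
       smoothing = \<sigma> \<rparr>"

end

theory Submission
  imports Defs
begin

text \<open>
  For a fixed scenario each component is a rescaled log-sum-exp function of affine pieces. It is
  convex, and Hoeffding's lemma bounds the gap between it and its tangent by half the squared
  oscillation of the pieces; the Cauchy--Schwarz inequality over the at most \<open>\<kappa>\<^sub>j\<close> appearing
  blocks turns this into smoothness of \<open>F\<^sub>\<sigma>\<close> with constant 1 in the norm weighted by \<open>\<nu>\<close>. Both
  inequalities hold for the expected stochastic gradient, so differentiability of \<open>F\<^sub>\<sigma>\<close> is never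
  needed. As \<open>\<beta>\<^sup>k\<close> is a function of the draws before \<open>k\<close>, the noise is centred given \<open>\<beta>\<^sup>k\<close>, and the
  usual telescoping of projected stochastic gradient steps gives
  \<open>(\<Sum>\<alpha>\<^sub>k) (E F(output) - F(\<beta>\<^sup>*)) \<le> M\<^sup>2/2 \<Sum>\<nu>\<^sub>t + \<chi>\<^sup>2 \<Sum>\<alpha>\<^sub>k\<^sup>2\<close>. For both formulations a weighted
  Cauchy--Schwarz inequality shows \<open>\<chi>\<^sup>2 \<le> \<sigma> \<Sum>c\<^sub>j\<close>, which does not grow with the horizon.
\<close>

section \<open>Log-sum-exp and the spectral norm\<close>

text \<open>Blockwise projection keeps the iterates only in the product of the projections of
  \<open>\<Omega>\<close>, which can be larger than \<open>\<Omega>\<close>. The comparison with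
  \<open>\<beta>opt\<close> is therefore made block by block, from the fact that each of its blocks
  lies in the corresponding projection. A block of weight 0 cannot be handled by dividing by its
  weight. Its gradients vanish outside a null set that does not depend on the point, and this
  uniformity matters because the point is the random iterate. The descent argument leaves a gap of
  order \<open>(total_weight Q + \<chi>2) * (1 + ln K) / sqrt K\<close>, and two conversions remain.
  The additive \<open>\<chi>2\<close> must be absorbed into the scale that the bound squares:
  \<open>\<nu>min\<close> does this in the general claim, while for the formulations
  \<open>1 / (\<sigma> * (1 - \<gamma>))\<close>, times the number of policies and the horizon for
  PO, is already at least \<open>\<chi>2\<close>. The factor \<open>ln K\<close> must be traded for
  a logarithm of the bound itself; it multiplies \<open>1 / sqrt K\<close>, so it comes out squared,
  and the exponent in \<open>soft_bound\<close> is 2.\<close>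

definition softmax :: "'u set \<Rightarrow> ('u \<Rightarrow> real) \<Rightarrow> 'u \<Rightarrow> real" where
  "softmax U v u = exp (v u) / (\<Sum>u'\<in>U. exp (v u'))"

definition log_sum_exp :: "'u set \<Rightarrow> ('u \<Rightarrow> real) \<Rightarrow> real" where
  "log_sum_exp U v = ln (\<Sum>u\<in>U. exp (v u))"

lemma sum_exp_pos: "finite U \<Longrightarrow> U \<noteq> {} \<Longrightarrow> 0 < (\<Sum>u\<in>U. exp (v u :: real))"
  by (simp add: sum_pos)

lemma softmax_nonneg: "0 \<le> softmax U v u"
  by (simp add: softmax_def sum_nonneg)

lemma sum_softmax:
  assumes "finite U" "U \<noteq> {}"
  shows "(\<Sum>u\<in>U. softmax U v u) = 1"
  using sum_exp_pos[OF assms, of v] by (simp add: softmax_def flip: sum_divide_distrib)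

text \<open>The ratio of the two exponential sums is the average of \<open>exp (v' u - v u)\<close>
  under the softmax law of \<open>v\<close>. An increment of log-sum-exp is thus a cumulant
  generating function; the bounds below are Jensen's inequality and Hoeffding's lemma for
  it.\<close>

lemma log_sum_exp_diff:
  assumes "finite U" "U \<noteq> {}"
  shows "log_sum_exp U v' - log_sum_exp U v = ln (\<Sum>u\<in>U. softmax U v u * exp (v' u - v u))"
    and "0 < (\<Sum>u\<in>U. softmax U v u * exp (v' u - v u))"
proof -
  have "(\<Sum>u\<in>U. softmax U v u * exp (v' u - v u)) = (\<Sum>u\<in>U. exp (v' u)) / (\<Sum>u\<in>U. exp (v u))"
    by (simp add: softmax_def exp_diff sum_divide_distrib)
  then show "log_sum_exp U v' - log_sum_exp U v = ln (\<Sum>u\<in>U. softmax U v u * exp (v' u - v u))"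
    "0 < (\<Sum>u\<in>U. softmax U v u * exp (v' u - v u))"
    using sum_exp_pos[OF assms, of v] sum_exp_pos[OF assms, of v']
    by (simp_all add: log_sum_exp_def ln_div)
qed

lemma log_sum_exp_lower:
  assumes "finite U" "U \<noteq> {}"
  shows "(\<Sum>u\<in>U. softmax U v u * (v' u - v u)) \<le> log_sum_exp U v' - log_sum_exp U v"
proof -
  define d where "d = (\<lambda>u. v' u - v u)"
  define \<mu> where "\<mu> = (\<Sum>u\<in>U. softmax U v u * d u)"
  \<comment> \<open>The exponential is expanded at the mean \<open>\<mu>\<close>, where the linear
    term averages to 0; what is left of \<open>1 + x \<le> exp x\<close> is Jensen's
    inequality.\<close>
  have "(\<Sum>u\<in>U. softmax U v u * (1 + (d u - \<mu>)))
      = (\<Sum>u\<in>U. softmax U v u) + (\<mu> - (\<Sum>u\<in>U. softmax U v u) * \<mu>)"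
    unfolding sum_distrib_right
    by (simp add: distrib_left right_diff_distrib sum.distrib sum_subtractf flip: \<mu>_def)
  then have "exp \<mu> = exp \<mu> * (\<Sum>u\<in>U. softmax U v u * (1 + (d u - \<mu>)))"
    using sum_softmax[OF assms, of v] by simp
  also have "\<dots> \<le> exp \<mu> * (\<Sum>u\<in>U. softmax U v u * exp (d u - \<mu>))"
    by (intro mult_left_mono sum_mono softmax_nonneg exp_ge_add_one_self) auto
  also have "\<dots> = (\<Sum>u\<in>U. softmax U v u * exp (d u))"
    by (simp add: exp_diff sum_distrib_left)
  finally have "\<mu> \<le> ln (\<Sum>u\<in>U. softmax U v u * exp (d u))"
    using log_sum_exp_diff(2)[OF assms, of v v'] by (simp add: ln_ge_iff d_def)
  then show ?thesis
    using log_sum_exp_diff(1)[OF assms, of v' v] by (simp add: \<mu>_def d_def)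
qed

text \<open>By convexity \<open>exp\<close> lies below its chord over \<open>[- m, m]\<close>.
  Factoring out \<open>exp (- m)\<close> gives the chord the shape that Hoeffding's estimate for a
  two-point law expects.\<close>

lemma exp_chord:
  fixes m d :: real
  assumes "0 < m" "\<bar>d\<bar> \<le> m"
  shows "exp d \<le> exp (- m) * (1 + (m + d) / (2 * m) * (exp (2 * m) - 1))"
proof -
  define q where "q = (m + d) / (2 * m)"
  have q: "0 \<le> q" "q \<le> 1" using assms by (auto simp: q_def field_simps)
  have d: "d = (1 - q) * (- m) + q * m" using assms by (simp add: q_def field_simps)
  have "exp (1 * ((1 - q) *\<^sub>R (- m) + q *\<^sub>R m)) \<le> (1 - q) * exp (1 * - m) + q * exp (1 * m)"
    using convex_onD[OF convex_on_exp[of 1], of q "- m" m] q by simp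
  then have "exp d \<le> (1 - q) * exp (- m) + q * exp m"
    using d by simp
  also have "exp m = exp (- m) * exp (2 * m)" by (simp flip: exp_add)
  finally show ?thesis unfolding q_def[symmetric] by (simp add: algebra_simps)
qed

text \<open>The increments lie in an interval of length \<open>2 * sqrt B\<close>, so Hoeffding's
  lemma for the softmax law applies with the constant
  \<open>(2 * sqrt B)^2 / 8 = B / 2\<close>.\<close>

lemma log_sum_exp_upper:
  assumes "finite U" "U \<noteq> {}" and bound: "\<And>u. u \<in> U \<Longrightarrow> (v' u - v u)\<^sup>2 \<le> B"
  shows "log_sum_exp U v' - log_sum_exp U v \<le> (\<Sum>u\<in>U. softmax U v u * (v' u - v u)) + B / 2"
\<comment> \<open>The chord divides by its length \<open>2 * m\<close>, so the case of half-width 0,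
  where all increments vanish, is split off.\<close>
proof (cases "B = 0")
  case True
  then have "\<forall>u\<in>U. v' u = v u" using bound by fastforce
  then show ?thesis using True by (simp add: log_sum_exp_def)
next
  case False
  moreover have "0 \<le> B" using assms(2) bound by (meson all_not_in_conv order_trans zero_le_power2)
  ultimately have B: "0 < B" by simp
  define m where "m = sqrt B"
  have m: "0 < m" "m\<^sup>2 = B" using B by (auto simp: m_def)
  define \<mu> where "\<mu> = (\<Sum>u\<in>U. softmax U v u * (v' u - v u))"
  \<comment> \<open>\<open>q\<close> is the mass at \<open>m\<close> of the law on
    \<open>{- m, m}\<close> with mean \<open>\<mu>\<close>, the extremal law in Hoeffding's
    lemma.\<close>
  define q where "q = (m + \<mu>) / (2 * m)"
  have dm: "\<bar>v' u - v u\<bar> \<le> m" if "u \<in> U" for u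
    using bound[OF that] unfolding m_def by (simp add: real_le_rsqrt)
  have "- m = (\<Sum>u\<in>U. softmax U v u * - m)" using sum_softmax[OF assms(1,2), of v] by (simp add: sum_negf flip: sum_distrib_right)
  also have "\<dots> \<le> \<mu>" unfolding \<mu>_def
    using dm by (intro sum_mono mult_left_mono softmax_nonneg) (smt (verit))
  finally have q: "0 \<le> q" using m by (simp add: q_def)
  have "(\<Sum>u\<in>U. softmax U v u * exp (v' u - v u))
      \<le> (\<Sum>u\<in>U. softmax U v u * (exp (- m) * (1 + (m + (v' u - v u)) / (2 * m) * (exp (2 * m) - 1))))"
    using dm m by (intro sum_mono mult_left_mono softmax_nonneg exp_chord) auto
  also have "\<dots> = exp (- m) * ((\<Sum>u\<in>U. softmax U v u) +
       (m * (\<Sum>u\<in>U. softmax U v u) + \<mu>) / (2 * m) * (exp (2 * m) - 1))"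
    unfolding \<mu>_def by (simp add: sum_distrib_left sum_distrib_right sum_divide_distrib
      add_divide_distrib distrib_left distrib_right sum.distrib mult.assoc mult.left_commute mult.commute)
  also have "\<dots> = exp (- m) * (1 + q * (exp (2 * m) - 1))"
    using sum_softmax[OF assms(1,2), of v] by (simp add: q_def)
  finally have le: "(\<Sum>u\<in>U. softmax U v u * exp (v' u - v u)) \<le> exp (- m) * (1 + q * (exp (2 * m) - 1))" .
  have pos: "0 < 1 + q * (exp (2 * m) - 1)"
    using q m by (intro add_pos_nonneg mult_nonneg_nonneg) auto
  have "log_sum_exp U v' - log_sum_exp U v \<le> ln (exp (- m) * (1 + q * (exp (2 * m) - 1)))"
    using log_sum_exp_diff(1)[OF assms(1,2), of v' v] log_sum_exp_diff(2)[OF assms(1,2), of v v'] le by simp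
  also have "\<dots> = - m + ln (1 + q * (exp (2 * m) - 1))"
    using pos by (simp add: ln_mult)
  also have "\<dots> \<le> - m + (2 * m * q + (2 * m)\<^sup>2 / 8)"
    using Hoeffdings_lemma_aux[of "2 * m" q] m q by simp
  also have "\<dots> = \<mu> + B / 2"
    using m by (simp add: q_def power2_eq_square)
  finally show ?thesis by (simp add: \<mu>_def)
qed

text \<open>Serves integrability: a smoothed component is dominated by its finitely many affine
  pieces.\<close>

lemma log_sum_exp_abs_le:
  assumes "finite U" "U \<noteq> {}"
  shows "\<bar>log_sum_exp U v\<bar> \<le> (\<Sum>u\<in>U. \<bar>v u\<bar>) + ln (card U)"
proof -
  have le: "\<bar>v u\<bar> \<le> (\<Sum>u\<in>U. \<bar>v u\<bar>)" if "u \<in> U" for u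
    using member_le_sum[OF that, of "\<lambda>u. \<bar>v u\<bar>"] assms by simp
  have card: "0 < card U" using assms by (simp add: card_gt_0_iff)
  have "(\<Sum>u\<in>U. exp (v u)) \<le> (\<Sum>u\<in>U. exp (\<Sum>u\<in>U. \<bar>v u\<bar>))"
    using le by (intro sum_mono) (auto simp: abs_le_iff)
  then have "log_sum_exp U v \<le> ln (card U * exp (\<Sum>u\<in>U. \<bar>v u\<bar>))"
    unfolding log_sum_exp_def using sum_exp_pos[OF assms, of v] by simp
  then have up: "log_sum_exp U v \<le> (\<Sum>u\<in>U. \<bar>v u\<bar>) + ln (card U)"
    using card by (simp add: ln_mult)
  obtain u0 where u0: "u0 \<in> U" using assms by blast
  have "exp (- (\<Sum>u\<in>U. \<bar>v u\<bar>)) \<le> exp (v u0)" using le[OF u0] by auto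
  also have "\<dots> \<le> (\<Sum>u\<in>U. exp (v u))" using assms u0 by (intro member_le_sum) auto
  finally have "- (\<Sum>u\<in>U. \<bar>v u\<bar>) \<le> log_sum_exp U v"
    unfolding log_sum_exp_def using sum_exp_pos[OF assms, of v] by (simp add: ln_ge_iff)
  moreover have "0 \<le> ln (real (card U))" using card by simp
  ultimately show ?thesis using up by simp
qed

section \<open>The spectral norm as a supremum over the unit ball\<close>

lemma L2_set_inner_le:
  fixes v :: "'u \<Rightarrow> 'a::real_inner"
  assumes "norm x \<le> 1"
  shows "L2_set (\<lambda>u. v u \<bullet> x) U \<le> L2_set (\<lambda>u. norm (v u)) U"
proof -
  have "\<bar>v u \<bullet> x\<bar> \<le> norm (v u)" for u
    using Cauchy_Schwarz_ineq2[of "v u" x] mult_left_mono[OF assms, of "norm (v u)"] by simp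
  then have "(v u \<bullet> x)\<^sup>2 \<le> (norm (v u))\<^sup>2" for u
    by (simp add: abs_le_square_iff[symmetric])
  then show ?thesis
    unfolding L2_set_def by (intro real_sqrt_le_mono sum_mono)
qed

lemma bdd_above_spectral:
  "bdd_above ((\<lambda>x. L2_set (\<lambda>u. v u \<bullet> x) U) ` {x. norm x \<le> 1})"
  by (rule bdd_aboveI2[where M="L2_set (\<lambda>u. norm (v u)) U"]) (simp add: L2_set_inner_le)

lemma spectral_norm_nonneg: "0 \<le> spectral_norm U v"
  unfolding spectral_norm_def
  by (rule order_trans[OF L2_set_nonneg[of "\<lambda>u. v u \<bullet> 0"] cSUP_upper[OF _ bdd_above_spectral]]) simp

text \<open>The Frobenius norm dominates the spectral norm. Through this estimate the number of
  choices enters the weight bounds of both formulations.\<close>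

lemma spectral_norm_sq_le: "(spectral_norm U v)\<^sup>2 \<le> (\<Sum>u\<in>U. (norm (v u))\<^sup>2)"
proof -
  have "spectral_norm U v \<le> L2_set (\<lambda>u. norm (v u)) U"
    unfolding spectral_norm_def by (rule cSUP_least) (auto intro: L2_set_inner_le exI[of _ 0])
  then have "(spectral_norm U v)\<^sup>2 \<le> (L2_set (\<lambda>u. norm (v u)) U)\<^sup>2"
    by (rule power_mono) (rule spectral_norm_nonneg)
  then show ?thesis by (simp add: L2_set_def sum_nonneg)
qed

lemma inner_le_spectral_norm:
  assumes "finite U" "u \<in> U"
  shows "\<bar>v u \<bullet> x\<bar> \<le> spectral_norm U v * norm x"
proof (cases "x = 0")
  case False
  define y where "y = x /\<^sub>R norm x"
  have y: "norm y \<le> 1" "x = norm x *\<^sub>R y" using False by (auto simp: y_def)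
  have "\<bar>v u \<bullet> y\<bar> \<le> L2_set (\<lambda>u. \<bar>v u \<bullet> y\<bar>) U" using assms by (intro member_le_L2_set) auto
  also have "\<dots> = L2_set (\<lambda>u. v u \<bullet> y) U" by (simp add: L2_set_def)
  also have "\<dots> \<le> spectral_norm U v"
    unfolding spectral_norm_def using y by (intro cSUP_upper bdd_above_spectral) auto
  finally have "norm x * \<bar>v u \<bullet> y\<bar> \<le> norm x * spectral_norm U v" by (simp add: mult_left_mono)
  moreover have "\<bar>v u \<bullet> x\<bar> = norm x * \<bar>v u \<bullet> y\<bar>" by (subst y(2)) (simp add: abs_mult)
  ultimately show ?thesis by (simp add: mult.commute)
qed simp

lemma norm_le_spectral_norm:
  assumes "finite U" "u \<in> U"
  shows "norm (v u) \<le> spectral_norm U v"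
proof (cases "v u = 0")
  case False
  have "norm (v u) * norm (v u) \<le> spectral_norm U v * norm (v u)"
    using inner_le_spectral_norm[OF assms, of v "v u"] by (simp flip: power2_norm_eq_inner add: power2_eq_square)
  then show ?thesis using False by simp
qed (simp add: spectral_norm_nonneg)

text \<open>The supremum runs over an uncountable ball, but its argument is continuous, so a
  countable dense subset gives the same value and measurability survives the supremum.\<close>

lemma borel_measurable_spectral_norm:
  fixes v :: "'w \<Rightarrow> 'u \<Rightarrow> real ^ 'b::finite"
  assumes "finite U" "\<And>u. u \<in> U \<Longrightarrow> (\<lambda>w. v w u) \<in> borel_measurable M"
  shows "(\<lambda>w. spectral_norm U (v w)) \<in> borel_measurable M"
proof -
  obtain T :: "(real ^ 'b) set" where T: "countable T" "T \<subseteq> {x. norm x \<le> 1}" "{x. norm x \<le> 1} \<subseteq> closure T"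
    using separable[of "{x. norm x \<le> 1} :: (real ^ 'b) set"] by blast
  have ne: "T \<noteq> {}" using T(3) by (metis closure_empty empty_iff mem_Collect_eq norm_zero subset_empty zero_le_one)
  have eq: "spectral_norm U (v w) = (SUP x\<in>T. L2_set (\<lambda>u. v w u \<bullet> x) U)" for w
  proof (rule antisym)
    let ?f = "\<lambda>x. L2_set (\<lambda>u. v w u \<bullet> x) U"
    have bdd: "bdd_above (?f ` T)" by (rule bdd_above_mono[OF bdd_above_spectral[of "v w" U]]) (use T(2) in blast)
    have cont: "continuous_on UNIV ?f" unfolding L2_set_def by (intro continuous_intros)
    have "closed {x. ?f x \<le> (SUP x\<in>T. ?f x)}"
      using cont by (intro closed_Collect_le continuous_on_const)
    moreover have "T \<subseteq> {x. ?f x \<le> (SUP x\<in>T. ?f x)}" using cSUP_upper[OF _ bdd] by blast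
    ultimately have "closure T \<subseteq> {x. ?f x \<le> (SUP x\<in>T. ?f x)}" by (simp add: closure_minimal)
    then show "spectral_norm U (v w) \<le> (SUP x\<in>T. ?f x)"
      unfolding spectral_norm_def using T(3) by (intro cSUP_least) (auto intro: exI[of _ 0])
    show "(SUP x\<in>T. ?f x) \<le> spectral_norm U (v w)"
      unfolding spectral_norm_def using T ne by (intro cSUP_subset_mono bdd_above_spectral) auto
  qed
  show ?thesis unfolding eq
  proof (rule borel_measurable_cSUP[OF T(1)])
    show "(\<lambda>w. L2_set (\<lambda>u. v w u \<bullet> x) U) \<in> borel_measurable M" for x
      unfolding L2_set_def using assms(2)[measurable (raw)] by measurable
    show "bdd_above ((\<lambda>x. L2_set (\<lambda>u. v w u \<bullet> x) U) ` T)" for w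
      by (rule bdd_above_mono[OF bdd_above_spectral[of "v w" U]]) (use T(2) in blast)
  qed
qed

section \<open>Gradients of the smoothed components\<close>

text \<open>The outer factor \<open>smoothing Q\<close> of a component cancels against the inner
  division by it, so only the weight remains in front.\<close>

definition comp_grad ::
  "('w, 'u, 'b::finite) smoothed_problem \<Rightarrow> nat \<Rightarrow> nat \<Rightarrow> 'b blocks \<Rightarrow> 'w \<Rightarrow> real ^ 'b" where
  "comp_grad Q j t \<beta> w = weight Q j *\<^sub>R
     (\<Sum>u\<in>choices Q j. softmax (choices Q j) (\<lambda>u. affine_piece Q j \<beta> w u / smoothing Q) u *\<^sub>R slope Q j w u t)"

definition comp_norm :: "('w, 'u, 'b::finite) smoothed_problem \<Rightarrow> nat \<Rightarrow> nat \<Rightarrow> 'w \<Rightarrow> real" where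
  "comp_norm Q j t w = spectral_norm (choices Q j) (\<lambda>u. slope Q j w u t)"

definition mean_grad :: "('w, 'u, 'b::finite) smoothed_problem \<Rightarrow> nat \<Rightarrow> 'b blocks \<Rightarrow> real ^ 'b" where
  "mean_grad Q t \<beta> = (\<integral>w. stoch_grad Q t \<beta> w \<partial>law Q)"

text \<open>A majorant of the block gradient that does not depend on \<open>\<beta>\<close>: one
  integrable function dominates the gradients at all points, including the random iterates.\<close>

definition grad_bound :: "('w, 'u, 'b::finite) smoothed_problem \<Rightarrow> nat \<Rightarrow> 'w \<Rightarrow> real" where
  "grad_bound Q t w = (\<Sum>j | j < comps Q \<and> t \<in> appearing Q j. weight Q j * comp_norm Q j t w)"

lemma affine_piece_update:
  assumes "t < stages Q"
  shows "affine_piece Q j (\<beta>(t := y)) w u = affine_piece Q j \<beta> w u + slope Q j w u t \<bullet> (y - \<beta> t)"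
proof -
  have "(\<Sum>s<stages Q. slope Q j w u s \<bullet> (\<beta>(t := y)) s)
      = (\<Sum>s<stages Q. slope Q j w u s \<bullet> \<beta> s + (if s = t then slope Q j w u t \<bullet> (y - \<beta> t) else 0))"
    by (intro sum.cong) (auto simp: inner_diff_right)
  then show ?thesis using assms by (simp add: affine_piece_def sum.distrib)
qed

lemma affine_piece_diff:
  "affine_piece Q j \<beta>' w u - affine_piece Q j \<beta> w u = (\<Sum>t<stages Q. slope Q j w u t \<bullet> (\<beta>' t - \<beta> t))"
  by (simp add: affine_piece_def inner_diff_right sum_subtractf)

lemma smoothed_comp_eq:
  "smoothed_comp Q j \<beta> w = smoothing Q * weight Q j *
     log_sum_exp (choices Q j) (\<lambda>u. affine_piece Q j \<beta> w u / smoothing Q)"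
  by (simp add: smoothed_comp_def log_sum_exp_def)

lemma GDERIV_unique:
  assumes "GDERIV f x :> D" "GDERIV f x :> D'"
  shows "D = D'"
proof -
  have "(\<lambda>h. h \<bullet> D) = (\<lambda>h. h \<bullet> D')"
    using assms unfolding gderiv_def by (rule has_derivative_unique)
  then have "h \<bullet> D = h \<bullet> D'" for h by meson
  then show ?thesis by (metis inner_commute vector_eq_ldot)
qed

lemma sum_comp_grad_inner:
  "(\<Sum>t<stages Q. comp_grad Q j t \<beta> w \<bullet> d t) = weight Q j *
     (\<Sum>u\<in>choices Q j. softmax (choices Q j) (\<lambda>u. affine_piece Q j \<beta> w u / smoothing Q) u *
        (\<Sum>t<stages Q. slope Q j w u t \<bullet> d t))"
  unfolding comp_grad_def inner_scaleR_left inner_sum_left sum_distrib_left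
  by (rule sum.swap)

lemma (in finite_measure) integrable_of_square:
  fixes f :: "'a \<Rightarrow> real"
  assumes "f \<in> borel_measurable M" "integrable M (\<lambda>x. (f x)\<^sup>2)"
  shows "integrable M f"
proof (rule Bochner_Integration.integrable_bound)
  show "integrable M (\<lambda>x. 1 + (f x)\<^sup>2)" using assms by simp
  have "\<bar>a\<bar> \<le> 1 + a\<^sup>2" for a :: real
  proof -
    have "0 \<le> (1 - \<bar>a\<bar>)\<^sup>2" by simp
    then show ?thesis unfolding power2_diff by simp
  qed
  then show "AE x in M. norm (f x) \<le> norm (1 + (f x)\<^sup>2)" by simp
qed fact

text \<open>Cauchy-Schwarz with the split \<open>c * a = sqrt (c / k) * (sqrt (k * c) * a)\<close>.
  It is meant for \<open>k\<close> equal to the cardinality of \<open>appearing Q j\<close>: the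
  second factor then integrates to \<open>smoothing Q * block_weight Q t\<close>, and the first,
  summed over the stages, stays below the sum of the weights.\<close>

lemma weighted_sum_square_le:
  fixes c k a :: "'i \<Rightarrow> real"
  assumes "\<And>i. i \<in> I \<Longrightarrow> 0 \<le> c i" "\<And>i. i \<in> I \<Longrightarrow> 0 < k i"
  shows "(\<Sum>i\<in>I. c i * a i)\<^sup>2 \<le> (\<Sum>i\<in>I. c i / k i) * (\<Sum>i\<in>I. k i * c i * (a i)\<^sup>2)"
proof -
  have "(\<Sum>i\<in>I. c i * a i) = (\<Sum>i\<in>I. sqrt (c i / k i) * (sqrt (k i * c i) * a i))"
    using assms by (intro sum.cong refl)
      (simp add: real_sqrt_divide real_sqrt_mult less_imp_le dual_order.strict_implies_not_eq)
  then have "(\<Sum>i\<in>I. c i * a i)\<^sup>2 \<le> (\<Sum>i\<in>I. (sqrt (c i / k i))\<^sup>2) * (\<Sum>i\<in>I. (sqrt (k i * c i) * a i)\<^sup>2)"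
    by (metis Cauchy_Schwarz_ineq_sum)
  also have "\<dots> = (\<Sum>i\<in>I. c i / k i) * (\<Sum>i\<in>I. k i * c i * (a i)\<^sup>2)"
    using assms by (intro arg_cong2[where f="(*)"] sum.cong refl)
      (simp_all add: less_imp_le power_mult_distrib)
  finally show ?thesis .
qed

locale smoothed =
  fixes Q :: "('w, 'u, 'b::finite) smoothed_problem"
  assumes wp: "well_posed Q"
begin

sublocale prob_space "law Q"
  using wp by (simp add: well_posed_def)

lemma smoothing: "0 < smoothing Q" "smoothing Q < 1"
  using wp by (auto simp: well_posed_def)

lemma comp_facts:
  assumes "j < comps Q"
  shows weight_pos: "0 < weight Q j" and finite_choices: "finite (choices Q j)"
    and choices_nonempty: "choices Q j \<noteq> {}" and finite_appearing: "finite (appearing Q j)"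
    and integrable_smoothed_comp: "\<And>\<beta>. \<beta> \<in> block_vectors Q \<Longrightarrow> integrable (law Q) (smoothed_comp Q j \<beta>)"
  using wp assms by (auto simp: well_posed_def)

lemma measurable_offset:
  "j < comps Q \<Longrightarrow> u \<in> choices Q j \<Longrightarrow> (\<lambda>w. offset Q j w u) \<in> borel_measurable (law Q)"
  using wp by (auto simp: well_posed_def)

lemma measurable_slope:
  "j < comps Q \<Longrightarrow> u \<in> choices Q j \<Longrightarrow> t < stages Q \<Longrightarrow> (\<lambda>w. slope Q j w u t) \<in> borel_measurable (law Q)"
  using wp by (auto simp: well_posed_def)

lemma slope_not_appearing:
  "j < comps Q \<Longrightarrow> u \<in> choices Q j \<Longrightarrow> t < stages Q \<Longrightarrow> t \<notin> appearing Q j \<Longrightarrow> w \<in> space (law Q) \<Longrightarrow>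
     slope Q j w u t = 0"
  using wp by (auto simp: well_posed_def)

lemma integrable_comp_norm_sq:
  "j < comps Q \<Longrightarrow> t < stages Q \<Longrightarrow> integrable (law Q) (\<lambda>w. (comp_norm Q j t w)\<^sup>2)"
  using wp by (auto simp: well_posed_def comp_norm_def)

lemma comp_norm_nonneg: "0 \<le> comp_norm Q j t w"
  by (simp add: comp_norm_def spectral_norm_nonneg)

lemma measurable_comp_norm:
  "j < comps Q \<Longrightarrow> t < stages Q \<Longrightarrow> comp_norm Q j t \<in> borel_measurable (law Q)"
  unfolding comp_norm_def[abs_def]
  by (intro borel_measurable_spectral_norm finite_choices measurable_slope)

lemma comp_lipschitz_eq:
  "comp_lipschitz Q j t = weight Q j / smoothing Q * (\<integral>w. (comp_norm Q j t w)\<^sup>2 \<partial>law Q)"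
  by (simp add: comp_lipschitz_def comp_norm_def)

lemma comp_lipschitz_nonneg: "j < comps Q \<Longrightarrow> 0 \<le> comp_lipschitz Q j t"
  unfolding comp_lipschitz_eq using weight_pos smoothing by (simp add: less_imp_le)

lemma block_weight_nonneg: "0 \<le> block_weight Q t"
  unfolding block_weight_def by (intro sum_nonneg) (simp add: comp_lipschitz_nonneg)

lemma comp_grad_not_appearing:
  "j < comps Q \<Longrightarrow> t < stages Q \<Longrightarrow> t \<notin> appearing Q j \<Longrightarrow> w \<in> space (law Q) \<Longrightarrow> comp_grad Q j t \<beta> w = 0"
  by (simp add: comp_grad_def slope_not_appearing)

lemma norm_comp_grad_le:
  assumes j: "j < comps Q"
  shows "norm (comp_grad Q j t \<beta> w) \<le> weight Q j * comp_norm Q j t w"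
proof -
  note fin = finite_choices[OF j] and ne = choices_nonempty[OF j]
  let ?p = "softmax (choices Q j) (\<lambda>u. affine_piece Q j \<beta> w u / smoothing Q)"
  have "norm (\<Sum>u\<in>choices Q j. ?p u *\<^sub>R slope Q j w u t) \<le> (\<Sum>u\<in>choices Q j. ?p u * comp_norm Q j t w)"
    unfolding comp_norm_def
    by (intro sum_norm_le)
      (auto simp: softmax_nonneg intro!: mult_left_mono norm_le_spectral_norm[OF fin, of _ "\<lambda>u. slope Q j w u t"])
  also have "\<dots> = comp_norm Q j t w" using sum_softmax[OF fin ne] by (simp flip: sum_distrib_right)
  finally show ?thesis
    using weight_pos[OF j] by (simp add: comp_grad_def)
qed

text \<open>Differentiating the logarithm produces the softmax weights. As \<open>block_grad\<close>
  is a definite description, uniqueness of the gradient enters as well.\<close>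

lemma block_grad_smoothed_comp:
  assumes j: "j < comps Q" and t: "t < stages Q"
  shows "block_grad (\<lambda>\<beta>'. smoothed_comp Q j \<beta>' w) t \<beta> = comp_grad Q j t \<beta> w"
proof -
  let ?U = "choices Q j" and ?\<sigma> = "smoothing Q"
  let ?v = "\<lambda>u. affine_piece Q j \<beta> w u / ?\<sigma>"
  define Z where "Z = (\<Sum>u\<in>?U. exp (?v u))"
  have Z: "0 < Z" unfolding Z_def by (intro sum_exp_pos finite_choices choices_nonempty j)
  let ?e = "\<lambda>u y. exp ((affine_piece Q j \<beta> w u + slope Q j w u t \<bullet> (y - \<beta> t)) / ?\<sigma>)"
  have "((\<lambda>y. \<Sum>u\<in>?U. ?e u y) has_derivative (\<lambda>h. \<Sum>u\<in>?U. exp (?v u) * ((slope Q j w u t \<bullet> h) / ?\<sigma>))) (at (\<beta> t))"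
    using smoothing by (auto intro!: derivative_eq_intros simp: field_simps)
  then have "((\<lambda>y. ln (\<Sum>u\<in>?U. ?e u y)) has_derivative
      (\<lambda>h. (\<Sum>u\<in>?U. exp (?v u) * ((slope Q j w u t \<bullet> h) / ?\<sigma>)) * inverse Z)) (at (\<beta> t))"
    using Z by (auto intro!: derivative_eq_intros simp: Z_def divide_inverse mult_ac)
  then have "((\<lambda>y. ?\<sigma> * weight Q j * ln (\<Sum>u\<in>?U. ?e u y)) has_derivative
      (\<lambda>h. ?\<sigma> * weight Q j * ((\<Sum>u\<in>?U. exp (?v u) * ((slope Q j w u t \<bullet> h) / ?\<sigma>)) * inverse Z))) (at (\<beta> t))"
    by (rule has_derivative_mult_right)
  also have "(\<lambda>h. ?\<sigma> * weight Q j * ((\<Sum>u\<in>?U. exp (?v u) * ((slope Q j w u t \<bullet> h) / ?\<sigma>)) * inverse Z))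
      = (\<lambda>h. h \<bullet> comp_grad Q j t \<beta> w)"
    using smoothing unfolding comp_grad_def softmax_def Z_def[symmetric]
    by (auto simp: fun_eq_iff inner_sum_right sum_distrib_left sum_distrib_right divide_inverse
        inner_commute mult_ac intro!: sum.cong)
  also have "(\<lambda>y. ?\<sigma> * weight Q j * ln (\<Sum>u\<in>?U. ?e u y)) = (\<lambda>y. smoothed_comp Q j (\<beta>(t := y)) w)"
    by (simp add: smoothed_comp_def affine_piece_update[OF t])
  finally have *: "GDERIV (\<lambda>y. smoothed_comp Q j (\<beta>(t := y)) w) (\<beta> t) :> comp_grad Q j t \<beta> w"
    by (simp add: gderiv_def)
  show ?thesis unfolding block_grad_def
    using * by (rule the_equality) (rule GDERIV_unique[OF _ *])
qed

lemma stoch_grad_eq: "t < stages Q \<Longrightarrow> stoch_grad Q t \<beta> w = (\<Sum>j<comps Q. comp_grad Q j t \<beta> w)"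
  unfolding stoch_grad_def by (intro sum.cong refl block_grad_smoothed_comp) auto

lemma stoch_grad_eq_appearing:
  assumes "t < stages Q" "w \<in> space (law Q)"
  shows "stoch_grad Q t \<beta> w = (\<Sum>j | j < comps Q \<and> t \<in> appearing Q j. comp_grad Q j t \<beta> w)"
  unfolding stoch_grad_eq[OF assms(1)]
  by (rule sum.mono_neutral_right) (auto simp: comp_grad_not_appearing assms)

lemma norm_stoch_grad_le:
  assumes "t < stages Q" "w \<in> space (law Q)"
  shows "norm (stoch_grad Q t \<beta> w) \<le> grad_bound Q t w"
  unfolding stoch_grad_eq_appearing[OF assms] grad_bound_def
  by (intro sum_norm_le) (auto intro: norm_comp_grad_le)

section \<open>Convexity and smoothness of a component in a fixed scenario\<close>

lemma sum_comp_grad_inner_diff: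
  "(\<Sum>t<stages Q. comp_grad Q j t \<beta> w \<bullet> (\<beta>' t - \<beta> t)) = smoothing Q * weight Q j *
     (\<Sum>u\<in>choices Q j. softmax (choices Q j) (\<lambda>u. affine_piece Q j \<beta> w u / smoothing Q) u *
        (affine_piece Q j \<beta>' w u / smoothing Q - affine_piece Q j \<beta> w u / smoothing Q))"
proof -
  have *: "smoothing Q * c * (p * (a / smoothing Q - b / smoothing Q)) = c * (p * (a - b))" for c p a b :: real
    using smoothing by (simp add: field_simps)
  show ?thesis
    unfolding sum_comp_grad_inner affine_piece_diff[symmetric] sum_distrib_left * ..
qed

lemma smoothed_comp_lower:
  assumes j: "j < comps Q"
  shows "(\<Sum>t<stages Q. comp_grad Q j t \<beta> w \<bullet> (\<beta>' t - \<beta> t)) \<le> smoothed_comp Q j \<beta>' w - smoothed_comp Q j \<beta> w"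
proof -
  let ?\<sigma> = "smoothing Q" and ?U = "choices Q j"
  let ?v = "\<lambda>\<beta> u. affine_piece Q j \<beta> w u / ?\<sigma>"
  have "(\<Sum>t<stages Q. comp_grad Q j t \<beta> w \<bullet> (\<beta>' t - \<beta> t))
      = ?\<sigma> * weight Q j * (\<Sum>u\<in>?U. softmax ?U (?v \<beta>) u * (?v \<beta>' u - ?v \<beta> u))"
    by (rule sum_comp_grad_inner_diff)
  also have "\<dots> \<le> ?\<sigma> * weight Q j * (log_sum_exp ?U (?v \<beta>') - log_sum_exp ?U (?v \<beta>))"
    using smoothing weight_pos[OF j] finite_choices[OF j] choices_nonempty[OF j]
    by (intro mult_left_mono log_sum_exp_lower) auto
  finally show ?thesis by (simp add: smoothed_comp_eq right_diff_distrib)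
qed

text \<open>For every choice the increment of the affine piece is a sum over the appearing blocks
  only, so Cauchy-Schwarz costs the factor \<open>card (appearing Q j)\<close>, and a single row is
  controlled by the spectral norm. The bound \<open>R\<close> is the same for all choices, as the
  Hoeffding estimate requires; the outer factor \<open>\<sigma>\<close> turns
  \<open>R / \<sigma>^2\<close> into \<open>R / \<sigma>\<close>.\<close>

lemma smoothed_comp_upper:
  assumes j: "j < comps Q" and w: "w \<in> space (law Q)"
  shows "smoothed_comp Q j \<beta>' w - smoothed_comp Q j \<beta> w
    \<le> (\<Sum>t<stages Q. comp_grad Q j t \<beta> w \<bullet> (\<beta>' t - \<beta> t)) +
      (\<Sum>t | t < stages Q \<and> t \<in> appearing Q j. card (appearing Q j) * (weight Q j / smoothing Q) *
         (comp_norm Q j t w)\<^sup>2 * (norm (\<beta>' t - \<beta> t))\<^sup>2) / 2"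
proof -
  let ?\<sigma> = "smoothing Q" and ?U = "choices Q j"
  let ?v = "\<lambda>\<beta> u. affine_piece Q j \<beta> w u / ?\<sigma>"
  let ?I = "{t. t < stages Q \<and> t \<in> appearing Q j}"
  define R where "R = card (appearing Q j) * (\<Sum>t\<in>?I. (comp_norm Q j t w * norm (\<beta>' t - \<beta> t))\<^sup>2)"
  have "(?v \<beta>' u - ?v \<beta> u)\<^sup>2 \<le> R / ?\<sigma>\<^sup>2" if u: "u \<in> ?U" for u
  proof -
    have "(\<Sum>t<stages Q. slope Q j w u t \<bullet> (\<beta>' t - \<beta> t)) = (\<Sum>t\<in>?I. slope Q j w u t \<bullet> (\<beta>' t - \<beta> t))"
      by (rule sum.mono_neutral_right) (auto simp: slope_not_appearing[OF j u _ _ w])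
    also have "\<dots>\<^sup>2 = (\<Sum>t\<in>?I. 1 * (slope Q j w u t \<bullet> (\<beta>' t - \<beta> t)))\<^sup>2" by simp
    also have "\<dots> \<le> (\<Sum>t\<in>?I. 1\<^sup>2) * (\<Sum>t\<in>?I. (slope Q j w u t \<bullet> (\<beta>' t - \<beta> t))\<^sup>2)"
      by (rule Cauchy_Schwarz_ineq_sum)
    also have "\<dots> \<le> card (appearing Q j) * (\<Sum>t\<in>?I. (comp_norm Q j t w * norm (\<beta>' t - \<beta> t))\<^sup>2)"
    proof (rule mult_mono)
      show "(\<Sum>t\<in>?I. 1\<^sup>2) \<le> real (card (appearing Q j))"
        using finite_appearing[OF j] by (auto intro!: card_mono)
      show "(\<Sum>t\<in>?I. (slope Q j w u t \<bullet> (\<beta>' t - \<beta> t))\<^sup>2) \<le> (\<Sum>t\<in>?I. (comp_norm Q j t w * norm (\<beta>' t - \<beta> t))\<^sup>2)"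
        using inner_le_spectral_norm[OF finite_choices[OF j] u, of "\<lambda>u. slope Q j w u _"]
        by (intro sum_mono) (auto simp: comp_norm_def abs_le_square_iff[symmetric] abs_mult spectral_norm_nonneg)
    qed (auto intro: sum_nonneg)
    finally have "(affine_piece Q j \<beta>' w u - affine_piece Q j \<beta> w u)\<^sup>2 \<le> R"
      by (simp add: R_def affine_piece_diff)
    then show ?thesis
      using smoothing by (simp add: power_divide divide_right_mono flip: diff_divide_distrib)
  qed
  then have "log_sum_exp ?U (?v \<beta>') - log_sum_exp ?U (?v \<beta>)
      \<le> (\<Sum>u\<in>?U. softmax ?U (?v \<beta>) u * (?v \<beta>' u - ?v \<beta> u)) + R / ?\<sigma>\<^sup>2 / 2"
    by (intro log_sum_exp_upper finite_choices[OF j] choices_nonempty[OF j])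
  then have "?\<sigma> * weight Q j * (log_sum_exp ?U (?v \<beta>') - log_sum_exp ?U (?v \<beta>))
      \<le> ?\<sigma> * weight Q j * ((\<Sum>u\<in>?U. softmax ?U (?v \<beta>) u * (?v \<beta>' u - ?v \<beta> u)) + R / ?\<sigma>\<^sup>2 / 2)"
    using smoothing weight_pos[OF j] by (intro mult_left_mono) auto
  also have "\<dots> = ?\<sigma> * weight Q j * (\<Sum>u\<in>?U. softmax ?U (?v \<beta>) u * (?v \<beta>' u - ?v \<beta> u)) + weight Q j / ?\<sigma> * R / 2"
    using smoothing by (simp add: field_simps power2_eq_square)
  also have "?\<sigma> * weight Q j * (\<Sum>u\<in>?U. softmax ?U (?v \<beta>) u * (?v \<beta>' u - ?v \<beta> u))
      = (\<Sum>t<stages Q. comp_grad Q j t \<beta> w \<bullet> (\<beta>' t - \<beta> t))"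
    by (rule sum_comp_grad_inner_diff[symmetric])
  also have "weight Q j / ?\<sigma> * R = (\<Sum>t\<in>?I. card (appearing Q j) * (weight Q j / smoothing Q) *
         (comp_norm Q j t w)\<^sup>2 * (norm (\<beta>' t - \<beta> t))\<^sup>2)"
    unfolding R_def sum_distrib_left by (intro sum.cong refl) (simp add: power_mult_distrib)
  finally show ?thesis by (simp add: smoothed_comp_eq right_diff_distrib)
qed

end

section \<open>The expected objective\<close>

lemma space_block_borel: "space (block_borel Q) = block_vectors Q"
  by (simp add: block_borel_def block_vectors_def space_PiM)

lemma measurable_block: "t < stages Q \<Longrightarrow> (\<lambda>\<beta>. \<beta> t) \<in> borel_measurable (block_borel Q)"
  unfolding block_borel_def by (rule measurable_component_singleton) simp

context smoothed
begin

section \<open>Joint measurability in the point and the scenario\<close>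

lemma measurable_affine_piece:
  assumes "j < comps Q" "u \<in> choices Q j"
  shows "(\<lambda>(\<beta>, w). affine_piece Q j \<beta> w u) \<in> borel_measurable (block_borel Q \<Otimes>\<^sub>M law Q)"
proof -
  have "(\<lambda>x. slope Q j (snd x) u t) \<in> borel_measurable (block_borel Q \<Otimes>\<^sub>M law Q)" if "t < stages Q" for t
    using measurable_compose[OF measurable_snd measurable_slope[OF assms that]] .
  moreover have "(\<lambda>x. fst x t) \<in> borel_measurable (block_borel Q \<Otimes>\<^sub>M law Q)" if "t < stages Q" for t
    using measurable_compose[OF measurable_fst measurable_block[OF that]] .
  moreover have "(\<lambda>x. offset Q j (snd x) u) \<in> borel_measurable (block_borel Q \<Otimes>\<^sub>M law Q)"
    using measurable_compose[OF measurable_snd measurable_offset[OF assms]] .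
  ultimately show ?thesis
    unfolding affine_piece_def split_beta'
    by (intro borel_measurable_add borel_measurable_sum borel_measurable_inner) auto
qed

lemma measurable_comp_grad:
  assumes j: "j < comps Q" and t: "t < stages Q"
  shows "(\<lambda>(\<beta>, w). comp_grad Q j t \<beta> w) \<in> borel_measurable (block_borel Q \<Otimes>\<^sub>M law Q)"
proof -
  have [measurable]: "(\<lambda>x. slope Q j (snd x) u t) \<in> borel_measurable (block_borel Q \<Otimes>\<^sub>M law Q)"
    if "u \<in> choices Q j" for u
    using measurable_compose[OF measurable_snd measurable_slope[OF j that t]] .
  have [measurable]: "(\<lambda>x. affine_piece Q j (fst x) (snd x) u) \<in> borel_measurable (block_borel Q \<Otimes>\<^sub>M law Q)"
    if "u \<in> choices Q j" for u
    using measurable_affine_piece[OF j that] by (simp add: split_beta')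
  show ?thesis
    unfolding comp_grad_def split_beta' softmax_def
    by measurable
qed

lemma measurable_smoothed_comp:
  assumes j: "j < comps Q"
  shows "(\<lambda>(\<beta>, w). smoothed_comp Q j \<beta> w) \<in> borel_measurable (block_borel Q \<Otimes>\<^sub>M law Q)"
proof -
  have [measurable]: "(\<lambda>x. affine_piece Q j (fst x) (snd x) u) \<in> borel_measurable (block_borel Q \<Otimes>\<^sub>M law Q)"
    if "u \<in> choices Q j" for u
    using measurable_affine_piece[OF j that] by (simp add: split_beta')
  show ?thesis
    unfolding smoothed_comp_def split_beta' by measurable
qed

lemma measurable_stoch_grad:
  assumes "t < stages Q"
  shows "(\<lambda>(\<beta>, w). stoch_grad Q t \<beta> w) \<in> borel_measurable (block_borel Q \<Otimes>\<^sub>M law Q)"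
  unfolding stoch_grad_eq[OF assms] split_beta'
  by (intro borel_measurable_sum) (use measurable_comp_grad[OF _ assms] in \<open>auto simp: split_beta'\<close>)

lemma measurable_stoch_grad2:
  assumes "t < stages Q" "\<beta> \<in> block_vectors Q"
  shows "stoch_grad Q t \<beta> \<in> borel_measurable (law Q)"
  using measurable_Pair2[OF measurable_stoch_grad[OF assms(1)], of \<beta>] assms(2)
  by (simp add: space_block_borel)

lemma measurable_mean_grad:
  assumes "t < stages Q"
  shows "mean_grad Q t \<in> borel_measurable (block_borel Q)"
  unfolding mean_grad_def[abs_def]
  by (rule borel_measurable_lebesgue_integral[OF measurable_stoch_grad[OF assms]])

lemma measurable_objective: "objective Q \<in> borel_measurable (block_borel Q)"
  unfolding objective_def[abs_def]
proof (rule borel_measurable_lebesgue_integral)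
  show "(\<lambda>(\<beta>, w). \<Sum>j<comps Q. smoothed_comp Q j \<beta> w) \<in> borel_measurable (block_borel Q \<Otimes>\<^sub>M law Q)"
    unfolding split_beta'
    by (intro borel_measurable_sum) (use measurable_smoothed_comp in \<open>auto simp: split_beta'\<close>)
qed

section \<open>Moments of the gradient bound\<close>

lemma integrable_comp_norm:
  assumes "j < comps Q" "t < stages Q"
  shows "integrable (law Q) (comp_norm Q j t)"
  by (rule integrable_of_square) (use assms in \<open>auto intro: measurable_comp_norm integrable_comp_norm_sq\<close>)

lemma grad_bound_nonneg: "0 \<le> grad_bound Q t w"
  unfolding grad_bound_def
  by (intro sum_nonneg mult_nonneg_nonneg) (auto simp: less_imp_le weight_pos comp_norm_nonneg)

lemma integrable_grad_bound: "t < stages Q \<Longrightarrow> integrable (law Q) (grad_bound Q t)"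
  unfolding grad_bound_def[abs_def] by (auto intro!: integrable_comp_norm)

lemma grad_bound_sq_le:
  "(grad_bound Q t w)\<^sup>2 \<le> (\<Sum>j | j < comps Q \<and> t \<in> appearing Q j. weight Q j / card (appearing Q j)) *
     (\<Sum>j | j < comps Q \<and> t \<in> appearing Q j. card (appearing Q j) * weight Q j * (comp_norm Q j t w)\<^sup>2)"
  unfolding grad_bound_def
  by (rule weighted_sum_square_le) (auto simp: less_imp_le weight_pos card_gt_0_iff finite_appearing)

lemma integrable_grad_bound_sq:
  assumes t: "t < stages Q"
  shows "integrable (law Q) (\<lambda>w. (grad_bound Q t w)\<^sup>2)"
proof (rule Bochner_Integration.integrable_bound)
  let ?g = "\<lambda>w. (\<Sum>j | j < comps Q \<and> t \<in> appearing Q j. weight Q j / card (appearing Q j)) *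
     (\<Sum>j | j < comps Q \<and> t \<in> appearing Q j. card (appearing Q j) * weight Q j * (comp_norm Q j t w)\<^sup>2)"
  show "integrable (law Q) ?g"
    using t by (auto intro!: integrable_comp_norm_sq)
  show "(\<lambda>w. (grad_bound Q t w)\<^sup>2) \<in> borel_measurable (law Q)"
    using integrable_grad_bound[OF t] by (auto intro: borel_measurable_power)
  show "AE w in law Q. norm ((grad_bound Q t w)\<^sup>2) \<le> norm (?g w)"
    using grad_bound_sq_le by (intro AE_I2) (auto intro: order_trans[OF _ abs_ge_self])
qed

text \<open>Integration turns \<open>weight Q j * (comp_norm Q j t w)^2\<close> into
  \<open>smoothing Q * comp_lipschitz Q j t\<close>, so the weighted Cauchy-Schwarz bound
  reassembles \<open>block_weight Q t\<close>. In particular a block of weight 0 has second moment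
  0.\<close>

lemma integral_grad_bound_sq_le:
  assumes t: "t < stages Q"
  shows "(\<integral>w. (grad_bound Q t w)\<^sup>2 \<partial>law Q)
    \<le> (\<Sum>j | j < comps Q \<and> t \<in> appearing Q j. weight Q j / card (appearing Q j)) *
       (smoothing Q * block_weight Q t)"
proof -
  have "(\<integral>w. (grad_bound Q t w)\<^sup>2 \<partial>law Q)
    \<le> (\<integral>w. (\<Sum>j | j < comps Q \<and> t \<in> appearing Q j. weight Q j / card (appearing Q j)) *
     (\<Sum>j | j < comps Q \<and> t \<in> appearing Q j. card (appearing Q j) * weight Q j * (comp_norm Q j t w)\<^sup>2) \<partial>law Q)"
    by (intro integral_mono integrable_grad_bound_sq t grad_bound_sq_le integrable_mult_right
        Bochner_Integration.integrable_sum) (auto intro: integrable_comp_norm_sq t)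
  also have "\<dots> = (\<Sum>j | j < comps Q \<and> t \<in> appearing Q j. weight Q j / card (appearing Q j)) *
       (\<Sum>j | j < comps Q \<and> t \<in> appearing Q j. card (appearing Q j) * weight Q j *
          (\<integral>w. (comp_norm Q j t w)\<^sup>2 \<partial>law Q))"
    using t by (simp add: integrable_comp_norm_sq)
  also have "(\<Sum>j | j < comps Q \<and> t \<in> appearing Q j. card (appearing Q j) * weight Q j *
          (\<integral>w. (comp_norm Q j t w)\<^sup>2 \<partial>law Q)) = smoothing Q * block_weight Q t"
    unfolding block_weight_def comp_lipschitz_eq sum_distrib_left
    using smoothing by (intro sum.cong refl) simp
  finally show ?thesis .
qed

lemma integrable_stoch_grad:
  assumes "t < stages Q" "\<beta> \<in> block_vectors Q"
  shows "integrable (law Q) (stoch_grad Q t \<beta>)"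
  using integrable_grad_bound[OF assms(1)]
  by (rule Bochner_Integration.integrable_bound)
    (use norm_stoch_grad_le assms in \<open>auto intro!: measurable_stoch_grad2 AE_I2 intro: order_trans[OF _ abs_ge_self]\<close>)

lemma integrable_stoch_grad_sq:
  assumes "t < stages Q" "\<beta> \<in> block_vectors Q"
  shows "integrable (law Q) (\<lambda>w. (norm (stoch_grad Q t \<beta> w))\<^sup>2)"
  using integrable_grad_bound_sq[OF assms(1)]
  by (rule Bochner_Integration.integrable_bound)
    (use norm_stoch_grad_le assms measurable_stoch_grad2[OF assms] in \<open>auto intro!: AE_I2 power_mono\<close>)

section \<open>Tangent and smoothness inequalities for the expected objective\<close>

lemma objective_lower:
  assumes \<beta>: "\<beta> \<in> block_vectors Q" and \<beta>': "\<beta>' \<in> block_vectors Q"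
  shows "(\<Sum>t<stages Q. mean_grad Q t \<beta> \<bullet> (\<beta>' t - \<beta> t)) \<le> objective Q \<beta>' - objective Q \<beta>"
proof -
  have "(\<Sum>t<stages Q. mean_grad Q t \<beta> \<bullet> (\<beta>' t - \<beta> t))
      = (\<integral>w. (\<Sum>t<stages Q. stoch_grad Q t \<beta> w \<bullet> (\<beta>' t - \<beta> t)) \<partial>law Q)"
    by (simp add: mean_grad_def integrable_stoch_grad \<beta>)
  also have "\<dots> \<le> (\<integral>w. (\<Sum>j<comps Q. smoothed_comp Q j \<beta>' w) - (\<Sum>j<comps Q. smoothed_comp Q j \<beta> w) \<partial>law Q)"
  proof (rule integral_mono)
    fix w
    have "(\<Sum>t<stages Q. stoch_grad Q t \<beta> w \<bullet> (\<beta>' t - \<beta> t))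
        = (\<Sum>j<comps Q. \<Sum>t<stages Q. comp_grad Q j t \<beta> w \<bullet> (\<beta>' t - \<beta> t))"
      by (subst sum.swap) (simp add: stoch_grad_eq inner_sum_left)
    also have "\<dots> \<le> (\<Sum>j<comps Q. smoothed_comp Q j \<beta>' w - smoothed_comp Q j \<beta> w)"
      by (intro sum_mono smoothed_comp_lower) auto
    finally show "(\<Sum>t<stages Q. stoch_grad Q t \<beta> w \<bullet> (\<beta>' t - \<beta> t))
        \<le> (\<Sum>j<comps Q. smoothed_comp Q j \<beta>' w) - (\<Sum>j<comps Q. smoothed_comp Q j \<beta> w)"
      by (simp add: sum_subtractf)
  qed (use \<beta> \<beta>' in \<open>auto intro!: integrable_stoch_grad integrable_smoothed_comp\<close>)
  also have "\<dots> = objective Q \<beta>' - objective Q \<beta>"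
    unfolding objective_def using \<beta> \<beta>'
    by (intro Bochner_Integration.integral_diff Bochner_Integration.integrable_sum) (auto intro: integrable_smoothed_comp)
  finally show ?thesis .
qed

text \<open>Exchanging the sums over components and stages collects
  \<open>card (appearing Q j) * comp_lipschitz Q j t\<close> into \<open>block_weight Q t\<close>.
  The weights are defined exactly so that the smoothness constant becomes 1.\<close>

lemma objective_upper:
  assumes \<beta>: "\<beta> \<in> block_vectors Q" and \<beta>': "\<beta>' \<in> block_vectors Q"
  shows "objective Q \<beta>' - objective Q \<beta> \<le> (\<Sum>t<stages Q. mean_grad Q t \<beta> \<bullet> (\<beta>' t - \<beta> t)) +
    (\<Sum>t<stages Q. block_weight Q t * (norm (\<beta>' t - \<beta> t))\<^sup>2) / 2"
proof -
  let ?q = "\<lambda>j t w. card (appearing Q j) * (weight Q j / smoothing Q) *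
         (comp_norm Q j t w)\<^sup>2 * (norm (\<beta>' t - \<beta> t))\<^sup>2"
  let ?R = "\<lambda>w. \<Sum>j<comps Q. \<Sum>t | t < stages Q \<and> t \<in> appearing Q j. ?q j t w"
  have intq: "integrable (law Q) (?q j t)" if "j < comps Q" "t < stages Q" for j t
    using that by (auto intro!: integrable_comp_norm_sq)
  have intR: "integrable (law Q) ?R"
    by (intro Bochner_Integration.integrable_sum intq) auto
  have "objective Q \<beta>' - objective Q \<beta>
      = (\<integral>w. (\<Sum>j<comps Q. smoothed_comp Q j \<beta>' w) - (\<Sum>j<comps Q. smoothed_comp Q j \<beta> w) \<partial>law Q)"
    unfolding objective_def using \<beta> \<beta>'
    by (intro Bochner_Integration.integral_diff[symmetric] Bochner_Integration.integrable_sum)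
      (auto intro: integrable_smoothed_comp)
  also have "\<dots> \<le> (\<integral>w. (\<Sum>t<stages Q. stoch_grad Q t \<beta> w \<bullet> (\<beta>' t - \<beta> t)) + ?R w / 2 \<partial>law Q)"
  proof (rule integral_mono)
    fix w assume w: "w \<in> space (law Q)"
    have "(\<Sum>j<comps Q. smoothed_comp Q j \<beta>' w) - (\<Sum>j<comps Q. smoothed_comp Q j \<beta> w)
        \<le> (\<Sum>j<comps Q. (\<Sum>t<stages Q. comp_grad Q j t \<beta> w \<bullet> (\<beta>' t - \<beta> t)) +
             (\<Sum>t | t < stages Q \<and> t \<in> appearing Q j. ?q j t w) / 2)"
      unfolding sum_subtractf[symmetric] by (intro sum_mono smoothed_comp_upper w) auto
    also have "\<dots> = (\<Sum>j<comps Q. \<Sum>t<stages Q. comp_grad Q j t \<beta> w \<bullet> (\<beta>' t - \<beta> t)) + ?R w / 2"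
      by (simp add: sum.distrib sum_divide_distrib)
    also have "(\<Sum>j<comps Q. \<Sum>t<stages Q. comp_grad Q j t \<beta> w \<bullet> (\<beta>' t - \<beta> t))
        = (\<Sum>t<stages Q. stoch_grad Q t \<beta> w \<bullet> (\<beta>' t - \<beta> t))"
      by (subst sum.swap) (simp add: stoch_grad_eq inner_sum_left)
    finally show "(\<Sum>j<comps Q. smoothed_comp Q j \<beta>' w) - (\<Sum>j<comps Q. smoothed_comp Q j \<beta> w)
        \<le> (\<Sum>t<stages Q. stoch_grad Q t \<beta> w \<bullet> (\<beta>' t - \<beta> t)) + ?R w / 2" .
  next
    show "integrable (law Q) (\<lambda>w. (\<Sum>t<stages Q. stoch_grad Q t \<beta> w \<bullet> (\<beta>' t - \<beta> t)) + ?R w / 2)"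
      by (intro Bochner_Integration.integrable_add integrable_divide_zero intR)
        (use \<beta> in \<open>auto intro!: integrable_stoch_grad\<close>)
  qed (use \<beta> \<beta>' in \<open>auto intro!: integrable_smoothed_comp\<close>)
  also have "\<dots> = (\<Sum>t<stages Q. mean_grad Q t \<beta> \<bullet> (\<beta>' t - \<beta> t)) + (\<integral>w. ?R w \<partial>law Q) / 2"
  proof -
    have "(\<integral>w. (\<Sum>t<stages Q. stoch_grad Q t \<beta> w \<bullet> (\<beta>' t - \<beta> t)) + ?R w / 2 \<partial>law Q)
      = (\<integral>w. (\<Sum>t<stages Q. stoch_grad Q t \<beta> w \<bullet> (\<beta>' t - \<beta> t)) \<partial>law Q) + (\<integral>w. ?R w / 2 \<partial>law Q)"
      by (rule Bochner_Integration.integral_add) (use \<beta> intR in \<open>auto intro!: integrable_stoch_grad\<close>)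
    also have "(\<integral>w. (\<Sum>t<stages Q. stoch_grad Q t \<beta> w \<bullet> (\<beta>' t - \<beta> t)) \<partial>law Q)
      = (\<Sum>t<stages Q. mean_grad Q t \<beta> \<bullet> (\<beta>' t - \<beta> t))"
      by (simp add: mean_grad_def integrable_stoch_grad \<beta>)
    finally show ?thesis by simp
  qed
  also have "(\<integral>w. ?R w \<partial>law Q) = (\<Sum>j<comps Q. \<Sum>t | t < stages Q \<and> t \<in> appearing Q j. \<integral>w. ?q j t w \<partial>law Q)"
    by (subst Bochner_Integration.integral_sum, fastforce intro!: Bochner_Integration.integrable_sum intq)
      (intro sum.cong refl Bochner_Integration.integral_sum intq, auto)
  also have "\<dots> = (\<Sum>j<comps Q. \<Sum>t | t < stages Q \<and> t \<in> appearing Q j.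
      card (appearing Q j) * comp_lipschitz Q j t * (norm (\<beta>' t - \<beta> t))\<^sup>2)"
    by (intro sum.cong refl) (simp add: comp_lipschitz_eq)
  also have "\<dots> = (\<Sum>t<stages Q. \<Sum>j | j < comps Q \<and> t \<in> appearing Q j.
      card (appearing Q j) * comp_lipschitz Q j t * (norm (\<beta>' t - \<beta> t))\<^sup>2)"
    using sum.swap_restrict[of "{..<comps Q}" "{..<stages Q}" _ "\<lambda>j t. t \<in> appearing Q j"] by simp
  also have "\<dots> = (\<Sum>t<stages Q. block_weight Q t * (norm (\<beta>' t - \<beta> t))\<^sup>2)"
    by (simp add: block_weight_def sum_distrib_right)
  finally show ?thesis .
qed

text \<open>The quantifier over \<open>\<beta>\<close> stands inside the almost-everywhere
  statement: the null set comes from \<open>grad_bound\<close>, which is free of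
  \<open>\<beta>\<close>, so the conclusion can be used at a random iterate.\<close>

lemma AE_stoch_grad_zero:
  assumes t: "t < stages Q" and z: "block_weight Q t = 0"
  shows "AE w in law Q. \<forall>\<beta>. stoch_grad Q t \<beta> w = 0"
proof -
  have "(\<integral>w. (grad_bound Q t w)\<^sup>2 \<partial>law Q) = 0"
    using integral_grad_bound_sq_le[OF t] z
    by (intro antisym integral_nonneg) auto
  then have "AE w in law Q. (grad_bound Q t w)\<^sup>2 = 0"
    using integral_nonneg_eq_0_iff_AE[OF integrable_grad_bound_sq[OF t]] by simp
  then show ?thesis
  proof (rule AE_mp[OF _ AE_I2], safe)
    fix w \<beta> assume "w \<in> space (law Q)" "(grad_bound Q t w)\<^sup>2 = 0"
    then show "stoch_grad Q t \<beta> w = 0" using norm_stoch_grad_le[OF t, of w \<beta>] by simp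
  qed
qed

lemma mean_grad_zero:
  assumes "t < stages Q" "block_weight Q t = 0"
  shows "mean_grad Q t \<beta> = 0"
  unfolding mean_grad_def
  by (rule integral_eq_zero_AE) (use AE_stoch_grad_zero[OF assms] in auto)

text \<open>The variance is the second moment minus the squared norm of the mean; dropping the
  latter leaves a bound uniform in \<open>\<beta>\<close>.\<close>

lemma integral_variance_le:
  assumes "t < stages Q" "\<beta> \<in> block_vectors Q"
  shows "integrable (law Q) (\<lambda>w. (norm (stoch_grad Q t \<beta> w - mean_grad Q t \<beta>))\<^sup>2)"
    and "(\<integral>w. (norm (stoch_grad Q t \<beta> w - mean_grad Q t \<beta>))\<^sup>2 \<partial>law Q) \<le> (\<integral>w. (grad_bound Q t w)\<^sup>2 \<partial>law Q)"
proof -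
  let ?X = "stoch_grad Q t \<beta>" and ?m = "mean_grad Q t \<beta>"
  have eq: "(norm (?X w - ?m))\<^sup>2 = (norm (?X w))\<^sup>2 - 2 * (?X w \<bullet> ?m) + (norm ?m)\<^sup>2" for w
    by (simp add: power2_norm_eq_inner inner_diff_left inner_diff_right inner_commute)
  note int = integrable_stoch_grad_sq[OF assms] integrable_inner_left[OF integrable_stoch_grad[OF assms], of ?m]
  show "integrable (law Q) (\<lambda>w. (norm (?X w - ?m))\<^sup>2)"
    unfolding eq using int by auto
  have "(\<integral>w. (norm (?X w - ?m))\<^sup>2 \<partial>law Q) = (\<integral>w. (norm (?X w))\<^sup>2 \<partial>law Q) - (norm ?m)\<^sup>2"
    unfolding eq using int integrable_stoch_grad[OF assms]
    by (simp add: prob_space power2_norm_eq_inner flip: mean_grad_def)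
  also have "\<dots> \<le> (\<integral>w. (norm (?X w))\<^sup>2 \<partial>law Q)" by simp
  also have "\<dots> \<le> (\<integral>w. (grad_bound Q t w)\<^sup>2 \<partial>law Q)"
    using assms by (intro integral_mono integrable_stoch_grad_sq integrable_grad_bound_sq power_mono norm_stoch_grad_le) auto
  finally show "(\<integral>w. (norm (?X w - ?m))\<^sup>2 \<partial>law Q) \<le> (\<integral>w. (grad_bound Q t w)\<^sup>2 \<partial>law Q)" .
qed

text \<open>Dividing by \<open>block_weight Q t\<close> cancels the only factor that depends on the
  slopes. What remains counts \<open>weight Q j / card (appearing Q j)\<close> once per appearing
  stage, hence at most \<open>card (appearing Q j)\<close> times, and the total does not grow with
  the number of stages per component.\<close>

lemma integral_dual_norm_sq_le:
  assumes "\<beta> \<in> block_vectors Q"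
  shows "integrable (law Q) (\<lambda>w. dual_norm_sq Q (\<lambda>t. stoch_grad Q t \<beta> w - mean_grad Q t \<beta>))"
    and "(\<integral>w. dual_norm_sq Q (\<lambda>t. stoch_grad Q t \<beta> w - mean_grad Q t \<beta>) \<partial>law Q)
      \<le> smoothing Q * (\<Sum>j<comps Q. weight Q j)"
proof -
  note int = integral_variance_le(1)[OF _ assms]
  show "integrable (law Q) (\<lambda>w. dual_norm_sq Q (\<lambda>t. stoch_grad Q t \<beta> w - mean_grad Q t \<beta>))"
    unfolding dual_norm_sq_def using int by auto
  have "(\<integral>w. dual_norm_sq Q (\<lambda>t. stoch_grad Q t \<beta> w - mean_grad Q t \<beta>) \<partial>law Q)
      = (\<Sum>t<stages Q. (\<integral>w. (norm (stoch_grad Q t \<beta> w - mean_grad Q t \<beta>))\<^sup>2 \<partial>law Q) / block_weight Q t)"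
    unfolding dual_norm_sq_def using int by simp
  also have "\<dots> \<le> (\<Sum>t<stages Q. smoothing Q * (\<Sum>j | j < comps Q \<and> t \<in> appearing Q j. weight Q j / card (appearing Q j)))"
  proof (intro sum_mono)
    fix t assume "t \<in> {..<stages Q}"
    then have t: "t < stages Q" by simp
    let ?s = "\<Sum>j | j < comps Q \<and> t \<in> appearing Q j. weight Q j / card (appearing Q j)"
    have s: "0 \<le> ?s" by (intro sum_nonneg) (auto simp: less_imp_le weight_pos)
    have "(\<integral>w. (norm (stoch_grad Q t \<beta> w - mean_grad Q t \<beta>))\<^sup>2 \<partial>law Q) \<le> ?s * (smoothing Q * block_weight Q t)"
      using integral_variance_le(2)[OF t assms] integral_grad_bound_sq_le[OF t] by (rule order_trans)
    then have "(\<integral>w. (norm (stoch_grad Q t \<beta> w - mean_grad Q t \<beta>))\<^sup>2 \<partial>law Q) / block_weight Q t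
        \<le> ?s * (smoothing Q * block_weight Q t) / block_weight Q t"
      by (rule divide_right_mono) (rule block_weight_nonneg)
    \<comment> \<open>Equality for positive weight; for weight 0 the quotient is 0 by convention,
      hence only an inequality.\<close>
    also have "\<dots> \<le> smoothing Q * ?s"
      using s smoothing by (cases "block_weight Q t = 0") auto
    finally show "(\<integral>w. (norm (stoch_grad Q t \<beta> w - mean_grad Q t \<beta>))\<^sup>2 \<partial>law Q) / block_weight Q t
        \<le> smoothing Q * ?s" .
  qed
  also have "\<dots> = smoothing Q * (\<Sum>j<comps Q. \<Sum>t | t < stages Q \<and> t \<in> appearing Q j. weight Q j / card (appearing Q j))"
    unfolding sum_distrib_left[symmetric]
    using sum.swap_restrict[of "{..<stages Q}" "{..<comps Q}"
        "\<lambda>_ j. weight Q j / card (appearing Q j)" "\<lambda>t j. t \<in> appearing Q j"]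
    by (simp del: sum_constant)
  also have "\<dots> \<le> smoothing Q * (\<Sum>j<comps Q. weight Q j)"
  proof (intro mult_left_mono sum_mono)
    fix j assume "j \<in> {..<comps Q}"
    then have j: "j < comps Q" by simp
    let ?I = "{t. t < stages Q \<and> t \<in> appearing Q j}"
    have "card ?I \<le> card (appearing Q j)" using finite_appearing[OF j] by (intro card_mono) auto
    then have "real (card ?I) / card (appearing Q j) \<le> 1" by (auto simp: divide_le_eq_1)
    then have "weight Q j * (card ?I / card (appearing Q j)) \<le> weight Q j * 1"
      using weight_pos[OF j] by (intro mult_left_mono) auto
    then show "(\<Sum>t\<in>?I. weight Q j / card (appearing Q j)) \<le> weight Q j" by (simp add: field_simps)
  qed (use smoothing in auto)
  finally show "(\<integral>w. dual_norm_sq Q (\<lambda>t. stoch_grad Q t \<beta> w - mean_grad Q t \<beta>) \<partial>law Q)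
      \<le> smoothing Q * (\<Sum>j<comps Q. weight Q j)" .
qed

section \<open>Estimates for the block weights\<close>

lemma total_weight_eq:
  "total_weight Q = (\<Sum>j<comps Q. card (appearing Q j) *
     (\<Sum>t | t < stages Q \<and> t \<in> appearing Q j. comp_lipschitz Q j t))"
  unfolding total_weight_def block_weight_def sum_distrib_left
  using sum.swap_restrict[of "{..<stages Q}" "{..<comps Q}" _ "\<lambda>t j. t \<in> appearing Q j"] by simp

lemma comp_lipschitz_le:
  fixes b :: real
  assumes j: "j < comps Q" and t: "t < stages Q"
    and bound: "\<And>w u. w \<in> space (law Q) \<Longrightarrow> u \<in> choices Q j \<Longrightarrow> norm (slope Q j w u t) \<le> b"
  shows "comp_lipschitz Q j t \<le> weight Q j / smoothing Q * (card (choices Q j) * b\<^sup>2)"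
  unfolding comp_lipschitz_eq
proof (rule mult_left_mono)
  have "(comp_norm Q j t w)\<^sup>2 \<le> card (choices Q j) * b\<^sup>2" if "w \<in> space (law Q)" for w
  proof -
    have "(comp_norm Q j t w)\<^sup>2 \<le> (\<Sum>u\<in>choices Q j. (norm (slope Q j w u t))\<^sup>2)"
      unfolding comp_norm_def by (rule spectral_norm_sq_le)
    also have "\<dots> \<le> (\<Sum>u\<in>choices Q j. b\<^sup>2)" using bound[OF that] by (intro sum_mono power_mono) auto
    finally show ?thesis by simp
  qed
  then have "(\<integral>w. (comp_norm Q j t w)\<^sup>2 \<partial>law Q) \<le> (\<integral>w. card (choices Q j) * b\<^sup>2 \<partial>law Q)"
    by (intro integral_mono integrable_comp_norm_sq j t) auto
  then show "(\<integral>w. (comp_norm Q j t w)\<^sup>2 \<partial>law Q) \<le> card (choices Q j) * b\<^sup>2"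
    by (simp add: prob_space)
qed (use weight_pos[OF j] smoothing in auto)

end

section \<open>The iterates of PS-BCD\<close>

definition noise_sq :: "('w, 'u, 'b::finite) smoothed_problem \<Rightarrow> 'b blocks \<Rightarrow> 'w \<Rightarrow> real" where
  "noise_sq Q \<beta> w = dual_norm_sq Q (\<lambda>t. stoch_grad Q t \<beta> w - mean_grad Q t \<beta>)"

definition weighted_dist_sq :: "('w, 'u, 'b::finite) smoothed_problem \<Rightarrow> 'b blocks \<Rightarrow> 'b blocks \<Rightarrow> real" where
  "weighted_dist_sq Q \<beta> \<beta>' = (\<Sum>t<stages Q. block_weight Q t * (norm (\<beta> t - \<beta>' t))\<^sup>2)"

definition noise_inner :: "('w, 'u, 'b::finite) smoothed_problem \<Rightarrow> 'b blocks \<Rightarrow> 'b blocks \<Rightarrow> 'w \<Rightarrow> real" where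
  "noise_inner Q z \<beta> w = (\<Sum>t<stages Q. (mean_grad Q t \<beta> - stoch_grad Q t \<beta> w) \<bullet> (\<beta> t - z t))"

text \<open>With \<open>a = x - z\<close> and \<open>b = y - x\<close>, the projection property
  controls \<open>G \<bullet> (a + b)\<close> and leaves \<open>- \<nu> * (norm b)^2 / 2\<close>
  after the distances to \<open>z\<close> are compared. Half of this pays for the smoothness term,
  thanks to \<open>\<alpha> \<le> 1 / 2\<close>, and the other half for the noise along
  \<open>b\<close>. This balance explains the factor 1/2 in the stepsize.\<close>

lemma projected_step_inequality:
  fixes x y z G m :: "'a::real_inner"
  assumes \<nu>: "0 < \<nu>" and \<alpha>: "0 \<le> \<alpha>" "\<alpha> \<le> 1 / 2"
    and proj: "(x - (\<alpha> / \<nu>) *\<^sub>R G - y) \<bullet> (z - y) \<le> 0"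
  shows "\<alpha> * (m \<bullet> (y - z)) + \<alpha> * (\<nu> * (norm (y - x))\<^sup>2) / 2
    \<le> \<nu> * (norm (x - z))\<^sup>2 / 2 - \<nu> * (norm (y - z))\<^sup>2 / 2 + \<alpha> * ((m - G) \<bullet> (x - z)) +
      \<alpha>\<^sup>2 * ((norm (G - m))\<^sup>2 / \<nu>)"
proof -
  define a b \<delta> where "a = x - z" and "b = y - x" and "\<delta> = m - G"
  have eqs: "y - z = a + b" "x - z = a" "y - x = b" "m = \<delta> + G" "norm (G - m) = norm \<delta>"
    by (simp_all add: a_def b_def \<delta>_def norm_minus_commute)
  have "(x - (\<alpha> / \<nu>) *\<^sub>R G - y) \<bullet> (z - y) = (- b - (\<alpha> / \<nu>) *\<^sub>R G) \<bullet> (- (a + b))"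
    by (rule arg_cong2[where f = inner]) (simp_all add: a_def b_def algebra_simps)
  then have "(b + (\<alpha> / \<nu>) *\<^sub>R G) \<bullet> (a + b) \<le> 0"
    using proj by (simp add: inner_diff_left inner_add_left inner_diff_right inner_add_right)
  then have "\<nu> * ((b + (\<alpha> / \<nu>) *\<^sub>R G) \<bullet> (a + b)) \<le> 0" using \<nu> by (simp add: mult_le_0_iff)
  then have p: "\<alpha> * (G \<bullet> (a + b)) \<le> - \<nu> * (b \<bullet> (a + b))"
    using \<nu> by (simp add: inner_add_left algebra_simps)
  \<comment> \<open>Young's inequality for \<open>\<delta> \<bullet> b\<close>, scaled to spend only
    \<open>\<nu> / 4\<close> times the squared norm of \<open>b\<close>.\<close>
  have "0 \<le> (norm ((\<nu> / 2) *\<^sub>R b - \<alpha> *\<^sub>R \<delta>))\<^sup>2" by simp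
  also have "\<dots> = \<nu>\<^sup>2 / 4 * (norm b)\<^sup>2 - \<nu> * (\<alpha> * (\<delta> \<bullet> b)) + \<alpha>\<^sup>2 * (norm \<delta>)\<^sup>2"
    unfolding power2_norm_eq_inner
    by (simp add: inner_diff_left inner_diff_right inner_commute power2_eq_square algebra_simps)
  also have "\<nu>\<^sup>2 / 4 * (norm b)\<^sup>2 - \<nu> * (\<alpha> * (\<delta> \<bullet> b)) + \<alpha>\<^sup>2 * (norm \<delta>)\<^sup>2
      = \<nu> * (\<nu> / 4 * (norm b)\<^sup>2 + \<alpha>\<^sup>2 * ((norm \<delta>)\<^sup>2 / \<nu>)) - \<nu> * (\<alpha> * (\<delta> \<bullet> b))"
    using \<nu> by (simp add: power2_eq_square distrib_left)
  finally have "\<nu> * (\<alpha> * (\<delta> \<bullet> b)) \<le> \<nu> * (\<nu> / 4 * (norm b)\<^sup>2 + \<alpha>\<^sup>2 * ((norm \<delta>)\<^sup>2 / \<nu>))"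
    by simp
  then have q: "\<alpha> * (\<delta> \<bullet> b) \<le> \<nu> / 4 * (norm b)\<^sup>2 + \<alpha>\<^sup>2 * ((norm \<delta>)\<^sup>2 / \<nu>)"
    using \<nu> by (simp only: mult_le_cancel_left_pos)
  define B C where "B = \<nu> * (norm b)\<^sup>2" and "C = \<nu> * (a \<bullet> b)"
  have "\<alpha> * B \<le> 1 / 2 * B"
    using \<alpha> \<nu> by (intro mult_right_mono) (auto simp: B_def)
  moreover have "\<nu> * (norm (a + b))\<^sup>2 = \<nu> * (norm a)\<^sup>2 + 2 * C + B"
    by (simp add: B_def C_def power2_norm_eq_inner inner_add_left inner_add_right inner_commute algebra_simps)
  moreover have "\<alpha> * (m \<bullet> (a + b)) = \<alpha> * (\<delta> \<bullet> a) + \<alpha> * (\<delta> \<bullet> b) + \<alpha> * (G \<bullet> (a + b))"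
    by (simp add: eqs(4) inner_add_left inner_add_right algebra_simps)
  moreover have "\<alpha> * (G \<bullet> (a + b)) \<le> - C - B"
    using p by (simp add: B_def C_def power2_norm_eq_inner inner_add_right inner_commute algebra_simps)
  moreover have "\<alpha> * (\<delta> \<bullet> b) \<le> B / 4 + \<alpha>\<^sup>2 * ((norm \<delta>)\<^sup>2 / \<nu>)"
    using q by (simp add: B_def)
  ultimately show ?thesis
    unfolding eqs(1-3,5) \<delta>_def[symmetric] B_def[symmetric] by linarith
qed

lemma psbcd_in_block_vectors: "psbcd Q \<Omega> ws k \<in> block_vectors Q"
  by (cases k) (auto simp: block_vectors_def)

lemma psbcd_output_in_block_vectors: "psbcd_output Q \<Omega> ws K \<in> block_vectors Q"
  by (auto simp: block_vectors_def psbcd_output_def)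

text \<open>Adaptedness: the iterate \<open>k\<close> depends on draws with index below
  \<open>k\<close>, so it is independent of draw \<open>k\<close>.\<close>

lemma psbcd_cong:
  "(\<And>i. 1 \<le> i \<Longrightarrow> i < k \<Longrightarrow> ws i = ws' i) \<Longrightarrow> psbcd Q \<Omega> ws k = psbcd Q \<Omega> ws' k"
proof (induction k)
  case (Suc k)
  then have "psbcd Q \<Omega> ws k = psbcd Q \<Omega> ws' k" by simp
  then show ?case using Suc.prems[of k] by auto
qed simp

lemma stepsize_bounds: "0 < stepsize k" "stepsize k \<le> 1 / 2"
  by (auto simp: stepsize_def)

context smoothed
begin

lemma measurable_noise_sq:
  "(\<lambda>(\<beta>, w). noise_sq Q \<beta> w) \<in> borel_measurable (block_borel Q \<Otimes>\<^sub>M law Q)"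
proof -
  have "(\<lambda>x. stoch_grad Q t (fst x) (snd x)) \<in> borel_measurable (block_borel Q \<Otimes>\<^sub>M law Q)" if "t < stages Q" for t
    using measurable_stoch_grad[OF that] by (simp add: split_beta')
  moreover have "(\<lambda>x. mean_grad Q t (fst x)) \<in> borel_measurable (block_borel Q \<Otimes>\<^sub>M law Q)" if "t < stages Q" for t
    using measurable_compose[OF measurable_fst measurable_mean_grad[OF that]] .
  ultimately show ?thesis
    unfolding noise_sq_def dual_norm_sq_def split_beta'
    by (intro borel_measurable_sum borel_measurable_divide borel_measurable_power borel_measurable_norm
        borel_measurable_diff) auto
qed

lemma measurable_noise_inner:
  "(\<lambda>(\<beta>, w). noise_inner Q z \<beta> w) \<in> borel_measurable (block_borel Q \<Otimes>\<^sub>M law Q)"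
proof -
  have "(\<lambda>x. stoch_grad Q t (fst x) (snd x)) \<in> borel_measurable (block_borel Q \<Otimes>\<^sub>M law Q)" if "t < stages Q" for t
    using measurable_stoch_grad[OF that] by (simp add: split_beta')
  moreover have "(\<lambda>x. mean_grad Q t (fst x)) \<in> borel_measurable (block_borel Q \<Otimes>\<^sub>M law Q)" if "t < stages Q" for t
    using measurable_compose[OF measurable_fst measurable_mean_grad[OF that]] .
  moreover have "(\<lambda>x. fst x t) \<in> borel_measurable (block_borel Q \<Otimes>\<^sub>M law Q)" if "t < stages Q" for t
    using measurable_compose[OF measurable_fst measurable_block[OF that]] .
  ultimately show ?thesis
    unfolding noise_inner_def split_beta'
    by (intro borel_measurable_sum borel_measurable_inner borel_measurable_diff) auto
qed

lemma measurable_weighted_dist_sq: "(\<lambda>\<beta>. weighted_dist_sq Q \<beta> z) \<in> borel_measurable (block_borel Q)"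
  unfolding weighted_dist_sq_def
  using measurable_block[measurable] by measurable

lemma noise_sq_nonneg: "0 \<le> noise_sq Q \<beta> w"
  by (simp add: noise_sq_def dual_norm_sq_def sum_nonneg block_weight_nonneg)

lemma weighted_dist_sq_nonneg: "0 \<le> weighted_dist_sq Q \<beta> z"
  by (simp add: weighted_dist_sq_def sum_nonneg block_weight_nonneg)

lemma integral_noise_inner:
  assumes "\<beta> \<in> block_vectors Q"
  shows "(\<integral>w. noise_inner Q z \<beta> w \<partial>law Q) = 0"
  using integrable_stoch_grad[OF _ assms]
  by (simp add: noise_inner_def prob_space flip: mean_grad_def)

lemma norm_mean_grad_le:
  assumes "t < stages Q" "\<beta> \<in> block_vectors Q"
  shows "norm (mean_grad Q t \<beta>) \<le> (\<integral>w. grad_bound Q t w \<partial>law Q)"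
  unfolding mean_grad_def
  by (rule order_trans[OF integral_norm_bound])
    (intro integral_mono integrable_norm integrable_stoch_grad integrable_grad_bound norm_stoch_grad_le assms)

text \<open>Smoothness is used from \<open>\<beta>\<close> to \<open>\<beta>'\<close> and convexity
  from \<open>\<beta>\<close> to \<open>z\<close>; their difference leaves \<open>mean_grad\<close>
  paired with \<open>\<beta>' - z\<close>, which splits into one projected step per block.\<close>

lemma descent_step:
  assumes \<beta>: "\<beta> \<in> block_vectors Q" and \<beta>': "\<beta>' \<in> block_vectors Q" and z: "z \<in> block_vectors Q"
    and \<alpha>: "0 \<le> \<alpha>" "\<alpha> \<le> 1 / 2"
    and proj: "\<And>t. t < stages Q \<Longrightarrow>
      (\<beta> t - (\<alpha> / block_weight Q t) *\<^sub>R stoch_grad Q t \<beta> w - \<beta>' t) \<bullet> (z t - \<beta>' t) \<le> 0"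
    and zero: "\<And>t. t < stages Q \<Longrightarrow> block_weight Q t = 0 \<Longrightarrow> stoch_grad Q t \<beta> w = 0"
  shows "\<alpha> * (objective Q \<beta>' - objective Q z) \<le> weighted_dist_sq Q \<beta> z / 2 - weighted_dist_sq Q \<beta>' z / 2 +
    \<alpha> * noise_inner Q z \<beta> w + \<alpha>\<^sup>2 * noise_sq Q \<beta> w"
proof -
  let ?m = "\<lambda>t. mean_grad Q t \<beta>" and ?G = "\<lambda>t. stoch_grad Q t \<beta> w" and ?\<nu> = "block_weight Q"
  have "objective Q \<beta>' - objective Q z
      \<le> (\<Sum>t<stages Q. ?m t \<bullet> (\<beta>' t - \<beta> t)) + (\<Sum>t<stages Q. ?\<nu> t * (norm (\<beta>' t - \<beta> t))\<^sup>2) / 2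
        - (\<Sum>t<stages Q. ?m t \<bullet> (z t - \<beta> t))"
    using objective_upper[OF \<beta> \<beta>'] objective_lower[OF \<beta> z] by linarith
  also have "\<dots> = (\<Sum>t<stages Q. ?m t \<bullet> (\<beta>' t - z t) + ?\<nu> t * (norm (\<beta>' t - \<beta> t))\<^sup>2 / 2)"
    by (simp add: sum.distrib sum_subtractf sum_divide_distrib inner_diff_right)
  finally have "\<alpha> * (objective Q \<beta>' - objective Q z)
      \<le> \<alpha> * (\<Sum>t<stages Q. ?m t \<bullet> (\<beta>' t - z t) + ?\<nu> t * (norm (\<beta>' t - \<beta> t))\<^sup>2 / 2)"
    using \<alpha> by (intro mult_left_mono)
  also have "\<dots> = (\<Sum>t<stages Q. \<alpha> * (?m t \<bullet> (\<beta>' t - z t)) + \<alpha> * (?\<nu> t * (norm (\<beta>' t - \<beta> t))\<^sup>2) / 2)"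
    by (simp add: sum_distrib_left distrib_left)
  also have "\<dots> \<le> (\<Sum>t<stages Q. ?\<nu> t * (norm (\<beta> t - z t))\<^sup>2 / 2 - ?\<nu> t * (norm (\<beta>' t - z t))\<^sup>2 / 2
      + \<alpha> * ((?m t - ?G t) \<bullet> (\<beta> t - z t)) + \<alpha>\<^sup>2 * ((norm (?G t - ?m t))\<^sup>2 / ?\<nu> t))"
  proof (intro sum_mono)
    fix t assume "t \<in> {..<stages Q}"
    then have t: "t < stages Q" by simp
    show "\<alpha> * (?m t \<bullet> (\<beta>' t - z t)) + \<alpha> * (?\<nu> t * (norm (\<beta>' t - \<beta> t))\<^sup>2) / 2
      \<le> ?\<nu> t * (norm (\<beta> t - z t))\<^sup>2 / 2 - ?\<nu> t * (norm (\<beta>' t - z t))\<^sup>2 / 2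
      + \<alpha> * ((?m t - ?G t) \<bullet> (\<beta> t - z t)) + \<alpha>\<^sup>2 * ((norm (?G t - ?m t))\<^sup>2 / ?\<nu> t)"
    proof (cases "?\<nu> t = 0")
      \<comment> \<open>The weight multiplies every distance and both gradients vanish, so each side
        is 0.\<close>
      case True
      then show ?thesis using zero[OF t] mean_grad_zero[OF t] by simp
    next
      case False
      then have "0 < ?\<nu> t" using block_weight_nonneg[of t] by simp
      then show ?thesis using \<alpha> proj[OF t] by (rule projected_step_inequality)
    qed
  qed
  also have "\<dots> = weighted_dist_sq Q \<beta> z / 2 - weighted_dist_sq Q \<beta>' z / 2 +
      \<alpha> * noise_inner Q z \<beta> w + \<alpha>\<^sup>2 * noise_sq Q \<beta> w"
    by (simp add: weighted_dist_sq_def noise_inner_def noise_sq_def dual_norm_sq_def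
        sum.distrib sum_subtractf sum_distrib_left sum_divide_distrib)
  finally show ?thesis .
qed

text \<open>Jensen's inequality from the tangents at the average \<open>a\<close>: the weighted
  deviations from \<open>a\<close> sum to 0, so the linear terms cancel.\<close>

lemma objective_average_le:
  assumes "finite K" and c: "\<And>k. k \<in> K \<Longrightarrow> 0 \<le> c k" "0 < (\<Sum>k\<in>K. c k)"
    and b: "\<And>k. k \<in> K \<Longrightarrow> b k \<in> block_vectors Q"
    and a: "a \<in> block_vectors Q" "\<And>t. t < stages Q \<Longrightarrow> a t = (\<Sum>k\<in>K. c k *\<^sub>R b k t) /\<^sub>R (\<Sum>k\<in>K. c k)"
  shows "(\<Sum>k\<in>K. c k) * objective Q a \<le> (\<Sum>k\<in>K. c k * objective Q (b k))"
proof -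
  have "(\<Sum>k\<in>K. c k *\<^sub>R (b k t - a t)) = 0" if "t < stages Q" for t
  proof -
    have "(\<Sum>k\<in>K. c k) *\<^sub>R a t = (\<Sum>k\<in>K. c k *\<^sub>R b k t)"
      using a(2)[OF that] c(2) by simp
    then show ?thesis by (simp add: scaleR_diff_right sum_subtractf flip: scaleR_left.sum)
  qed
  then have "0 = (\<Sum>t<stages Q. mean_grad Q t a \<bullet> (\<Sum>k\<in>K. c k *\<^sub>R (b k t - a t)))" by simp
  also have "\<dots> = (\<Sum>k\<in>K. c k * (\<Sum>t<stages Q. mean_grad Q t a \<bullet> (b k t - a t)))"
    by (simp only: inner_sum_right inner_scaleR_right sum_distrib_left) (rule sum.swap)
  also have "\<dots> \<le> (\<Sum>k\<in>K. c k * (objective Q (b k) - objective Q a))"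
    by (intro sum_mono mult_left_mono objective_lower a b c)
  finally show ?thesis by (simp add: right_diff_distrib sum_subtractf sum_distrib_right)
qed

end

section \<open>The random iterates and their joint law with the next draw\<close>

locale psbcd_process = smoothed Q
  for Q :: "('w, 'u, 'b::finite) smoothed_problem" +
  fixes \<Omega> :: "'b blocks set" and \<beta>opt :: "'b blocks" and M :: real and P :: "'p measure"
    and W :: "nat \<Rightarrow> 'p \<Rightarrow> 'w"
  assumes run: "psbcd_run Q \<Omega> \<beta>opt M P W"
begin

abbreviation iterate :: "nat \<Rightarrow> 'p \<Rightarrow> 'b blocks" where
  "iterate k \<omega> \<equiv> psbcd Q \<Omega> (\<lambda>i. W i \<omega>) k"

abbreviation projection :: "nat \<Rightarrow> (real ^ 'b) set" where
  "projection t \<equiv> (\<lambda>\<beta>. \<beta> t) ` \<Omega>"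

sublocale draws: prob_space P
  using run by (simp add: psbcd_run_def iid_draws_def)

lemma feasible_subset: "\<Omega> \<subseteq> block_vectors Q"
  using run compactin_subset_topspace[of "block_topology Q" \<Omega>]
  by (auto simp: psbcd_run_def feasible_region_def block_topology_def block_vectors_def)

lemma opt_in: "\<beta>opt \<in> \<Omega>" "\<beta>opt \<in> block_vectors Q"
  using run interior_of_subset[of "block_topology Q" \<Omega>] feasible_subset
  by (auto simp: psbcd_run_def interior_minimizer_def)

lemma norm_opt_le: "t < stages Q \<Longrightarrow> norm (\<beta>opt t) \<le> M"
  using run by (simp add: psbcd_run_def)

lemma projection_nonempty: "projection t \<noteq> {}"
  using opt_in by blast

lemma compact_projection:
  assumes "t < stages Q"
  shows "compact (projection t)"
proof -
  have "compactin euclidean (projection t)"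
    using run assms
    by (intro image_compactin[where X = "block_topology Q"])
      (auto simp: psbcd_run_def feasible_region_def block_topology_def intro!: continuous_map_product_projection)
  then show ?thesis by simp
qed

lemma convex_projection:
  assumes t: "t < stages Q"
  shows "convex (projection t)"
  unfolding convex_alt
proof (clarify)
  fix b b' and l :: real assume *: "b \<in> \<Omega>" "b' \<in> \<Omega>" "0 \<le> l" "l \<le> 1"
  then have "(\<lambda>t\<in>{..<stages Q}. (1 - l) *\<^sub>R b t + l *\<^sub>R b' t) \<in> \<Omega>"
    using run by (auto simp: psbcd_run_def feasible_region_def)
  then show "(1 - l) *\<^sub>R b t + l *\<^sub>R b' t \<in> projection t"
    by (rule rev_image_eqI) (use t in simp)
qed

lemma iterate_in_projection:
  "1 \<le> k \<Longrightarrow> t < stages Q \<Longrightarrow> psbcd Q \<Omega> ws (Suc k) t \<in> projection t"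
  using closest_point_in_set[OF compact_imp_closed[OF compact_projection] projection_nonempty] by auto

lemma iterates_bounded: "\<exists>R\<ge>0. \<forall>k ws. \<forall>t<stages Q. norm (psbcd Q \<Omega> ws k t) \<le> R"
proof -
  have "\<forall>t\<in>{..<stages Q}. \<exists>r. \<forall>x\<in>projection t. norm x \<le> r"
    using compact_imp_bounded[OF compact_projection] by (auto simp: bounded_iff)
  then obtain r where r: "\<And>t x. t < stages Q \<Longrightarrow> x \<in> projection t \<Longrightarrow> norm x \<le> r t"
    by (metis lessThan_iff)
  define R where "R = (\<Sum>t<stages Q. \<bar>r t\<bar>)"
  have rR: "r t \<le> R" if "t < stages Q" for t
    using member_le_sum[of t "{..<stages Q}" "\<lambda>t. \<bar>r t\<bar>"] that unfolding R_def by simp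
  have R: "0 \<le> R" by (simp add: R_def sum_nonneg)
  have "norm (psbcd Q \<Omega> ws k t) \<le> R" if t: "t < stages Q" for k ws t
  proof (cases "k \<le> 1")
    \<comment> \<open>Iterates with index at most 1 are 0, which may lie outside
      \<open>\<Omega>\<close>; only later ones are known to lie in the projections.\<close>
    case True
    then have "psbcd Q \<Omega> ws k t = 0" using t by (cases k) auto
    then show ?thesis using R by simp
  next
    case False
    then obtain k' where "k = Suc k'" "1 \<le> k'" by (cases k) auto
    then show ?thesis using r[OF t iterate_in_projection[OF _ t]] rR[OF t] order_trans by blast
  qed
  then show ?thesis using R by blast
qed

text \<open>The index set \<open>I\<close> stays fixed through the induction, although the prefix of
  draws shrinks. Projection onto a closed convex set is continuous, and the gradient is jointly
  measurable in point and draw, which carries the induction step.\<close>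

lemma measurable_psbcd:
  "{1..<k} \<subseteq> I \<Longrightarrow> (\<lambda>ws. psbcd Q \<Omega> ws k) \<in> (\<Pi>\<^sub>M i\<in>I. law Q) \<rightarrow>\<^sub>M block_borel Q"
proof (induction k)
  have const: "(\<lambda>t\<in>{..<stages Q}. 0) \<in> space (block_borel Q)"
    using psbcd_in_block_vectors[of Q \<Omega> undefined 0] by (simp only: space_block_borel psbcd.simps)
  case 0
  show ?case unfolding psbcd.simps by (rule measurable_const[OF const])
next
  have const: "(\<lambda>t\<in>{..<stages Q}. 0) \<in> space (block_borel Q)"
    using psbcd_in_block_vectors[of Q \<Omega> undefined 0] by (simp only: space_block_borel psbcd.simps)
  case (Suc k)
  show ?case
  proof (cases "k = 0")
    case True
    show ?thesis unfolding psbcd.simps if_P[OF True] by (rule measurable_const[OF const])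
  next
    case False
    let ?N = "\<Pi>\<^sub>M i\<in>I. law Q"
    have k: "k \<in> I" and "{1..<k} \<subseteq> I"
      using Suc.prems False by auto
    then have IH: "(\<lambda>ws. psbcd Q \<Omega> ws k) \<in> ?N \<rightarrow>\<^sub>M block_borel Q"
      by (intro Suc.IH)
    have "(\<lambda>ws. \<lambda>t\<in>{..<stages Q}. closest_point (projection t)
          (psbcd Q \<Omega> ws k t - (stepsize k / block_weight Q t) *\<^sub>R stoch_grad Q t (psbcd Q \<Omega> ws k) (ws k)))
      \<in> ?N \<rightarrow>\<^sub>M block_borel Q"
      unfolding block_borel_def
    proof (rule measurable_restrict)
      fix t assume "t \<in> {..<stages Q}"
      then have t: "t < stages Q" by simp
      have "continuous_on UNIV (closest_point (projection t))"
        using convex_projection[OF t] compact_projection[OF t] projection_nonempty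
        by (intro continuous_on_closest_point compact_imp_closed)
      moreover have "(\<lambda>ws. stoch_grad Q t (psbcd Q \<Omega> ws k) (ws k)) \<in> borel_measurable ?N"
        using measurable_compose[OF measurable_Pair[OF IH measurable_component_singleton[OF k]]
            measurable_stoch_grad[OF t]] by simp
      moreover have "(\<lambda>ws. psbcd Q \<Omega> ws k t) \<in> borel_measurable ?N"
        using measurable_compose[OF IH measurable_block[OF t]] .
      ultimately show "(\<lambda>ws. closest_point (projection t)
          (psbcd Q \<Omega> ws k t - (stepsize k / block_weight Q t) *\<^sub>R stoch_grad Q t (psbcd Q \<Omega> ws k) (ws k)))
        \<in> borel_measurable ?N"
        by (intro borel_measurable_continuous_on[of "closest_point (projection t)"] borel_measurable_diff
            borel_measurable_scaleR) auto
    qed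
    then show ?thesis unfolding psbcd.simps if_not_P[OF False] .
  qed
qed

lemma measurable_W: "1 \<le> k \<Longrightarrow> W k \<in> P \<rightarrow>\<^sub>M law Q"
  using run unfolding psbcd_run_def iid_draws_def draws.indep_vars_def by auto

lemma distr_W: "1 \<le> k \<Longrightarrow> distr P (law Q) (W k) = law Q"
  using run unfolding psbcd_run_def iid_draws_def by auto

lemma psbcd_restrict: "psbcd Q \<Omega> (\<lambda>i\<in>{Suc 0..<k}. W i \<omega>) k = iterate k \<omega>"
  by (rule psbcd_cong) auto

lemma measurable_iterate [measurable]: "iterate k \<in> P \<rightarrow>\<^sub>M block_borel Q"
proof -
  have "(\<lambda>\<omega>. \<lambda>i\<in>{1..<k}. W i \<omega>) \<in> P \<rightarrow>\<^sub>M (\<Pi>\<^sub>M i\<in>{1..<k}. law Q)"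
    by (intro measurable_restrict measurable_W) auto
  from measurable_compose[OF this measurable_psbcd[OF order_refl]]
  show ?thesis by (simp add: psbcd_restrict)
qed

text \<open>The draws indexed by \<open>{1..<k}\<close> and by \<open>{k}\<close> are independent.
  The iterate is a function of the former, so pushing the product law forward yields a product law
  again.\<close>

lemma joint_law:
  assumes k: "1 \<le> k"
  shows "distr P (block_borel Q \<Otimes>\<^sub>M law Q) (\<lambda>\<omega>. (iterate k \<omega>, W k \<omega>)) = distr P (block_borel Q) (iterate k) \<Otimes>\<^sub>M law Q"
proof -
  let ?R = "\<lambda>\<omega>. \<lambda>i\<in>{1..<k}. W i \<omega>" and ?S = "\<lambda>\<omega>. \<lambda>i\<in>{k}. W i \<omega>"
  let ?A = "\<Pi>\<^sub>M i\<in>{1..<k}. law Q" and ?B = "\<Pi>\<^sub>M i\<in>{k}. law Q"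
  have "draws.indep_vars (\<lambda>_. law Q) W {1..}"
    using run by (simp add: psbcd_run_def iid_draws_def)
  then have "draws.indep_var ?A ?R ?B ?S"
    by (rule draws.indep_var_restrict) (use k in auto)
  then have R: "?R \<in> P \<rightarrow>\<^sub>M ?A" and S: "?S \<in> P \<rightarrow>\<^sub>M ?B"
    and eq: "distr P ?A ?R \<Otimes>\<^sub>M distr P ?B ?S = distr P (?A \<Otimes>\<^sub>M ?B) (\<lambda>\<omega>. (?R \<omega>, ?S \<omega>))"
    unfolding draws.indep_var_distribution_eq by auto
  have psi: "(\<lambda>ws. psbcd Q \<Omega> ws k) \<in> ?A \<rightarrow>\<^sub>M block_borel Q" and ev: "(\<lambda>ws. ws k) \<in> ?B \<rightarrow>\<^sub>M law Q"
    by (auto intro: measurable_psbcd measurable_component_singleton)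
  have dR: "distr (distr P ?A ?R) (block_borel Q) (\<lambda>ws. psbcd Q \<Omega> ws k) = distr P (block_borel Q) (iterate k)"
    using R psi by (simp add: distr_distr comp_def psbcd_restrict)
  have dS: "distr (distr P ?B ?S) (law Q) (\<lambda>ws. ws k) = law Q"
    using S ev distr_W[OF k] by (simp add: distr_distr comp_def)
  have psi': "(\<lambda>ws. psbcd Q \<Omega> ws k) \<in> distr P ?A ?R \<rightarrow>\<^sub>M block_borel Q" and ev': "(\<lambda>ws. ws k) \<in> distr P ?B ?S \<rightarrow>\<^sub>M law Q"
    using psi ev by simp_all
  have "distr P (block_borel Q) (iterate k) \<Otimes>\<^sub>M law Q
      = distr (distr P ?A ?R \<Otimes>\<^sub>M distr P ?B ?S) (block_borel Q \<Otimes>\<^sub>M law Q) (\<lambda>(x, y). (psbcd Q \<Omega> x k, y k))"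
    using pair_measure_distr[OF psi' ev'] unfolding dR dS by (simp add: sigma_finite_measure_axioms)
  also have "\<dots> = distr P (block_borel Q \<Otimes>\<^sub>M law Q) (\<lambda>\<omega>. (iterate k \<omega>, W k \<omega>))"
    unfolding eq
  proof (subst distr_distr)
    show "(\<lambda>\<omega>. (?R \<omega>, ?S \<omega>)) \<in> P \<rightarrow>\<^sub>M ?A \<Otimes>\<^sub>M ?B" using R S by (rule measurable_Pair)
    show "(\<lambda>(x, y). (psbcd Q \<Omega> x k, y k)) \<in> ?A \<Otimes>\<^sub>M ?B \<rightarrow>\<^sub>M block_borel Q \<Otimes>\<^sub>M law Q"
      unfolding split_beta'
      using measurable_compose[OF measurable_fst psi] measurable_compose[OF measurable_snd ev]
      by (rule measurable_Pair)
  qed (simp add: comp_def psbcd_restrict)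
  finally show ?thesis ..
qed

lemma measurable_pair: "1 \<le> k \<Longrightarrow> (\<lambda>\<omega>. (iterate k \<omega>, W k \<omega>)) \<in> P \<rightarrow>\<^sub>M block_borel Q \<Otimes>\<^sub>M law Q"
  by (intro measurable_Pair measurable_iterate measurable_W)

text \<open>The freezing principle: for a product law the fresh draw can be integrated with the
  iterate held fixed. This Tonelli form identifies the conditional variance; the Bochner form below
  treats the signed noise term.\<close>

lemma nn_integral_iterate:
  assumes k: "1 \<le> k" and f: "f \<in> borel_measurable (block_borel Q \<Otimes>\<^sub>M law Q)"
  shows "(\<integral>\<^sup>+\<omega>. f (iterate k \<omega>, W k \<omega>) \<partial>P) = (\<integral>\<^sup>+\<omega>. (\<integral>\<^sup>+w. f (iterate k \<omega>, w) \<partial>law Q) \<partial>P)"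
proof -
  have "(\<integral>\<^sup>+\<omega>. f (iterate k \<omega>, W k \<omega>) \<partial>P) = (\<integral>\<^sup>+x. f x \<partial>(distr P (block_borel Q) (iterate k) \<Otimes>\<^sub>M law Q))"
    unfolding joint_law[OF k, symmetric] using measurable_pair[OF k] f by (simp add: nn_integral_distr)
  also have "\<dots> = (\<integral>\<^sup>+b. (\<integral>\<^sup>+w. f (b, w) \<partial>law Q) \<partial>distr P (block_borel Q) (iterate k))"
    using f by (intro nn_integral_fst[symmetric]) (simp cong: measurable_cong_sets sets_pair_measure_cong)
  also have "\<dots> = (\<integral>\<^sup>+\<omega>. (\<integral>\<^sup>+w. f (iterate k \<omega>, w) \<partial>law Q) \<partial>P)"
    using borel_measurable_nn_integral_fst[OF f] by (intro nn_integral_distr measurable_iterate) simp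
  finally show ?thesis .
qed

lemma integral_iterate:
  fixes f :: "_ \<Rightarrow> real"
  assumes k: "1 \<le> k" and f: "f \<in> borel_measurable (block_borel Q \<Otimes>\<^sub>M law Q)"
    and int: "integrable P (\<lambda>\<omega>. f (iterate k \<omega>, W k \<omega>))"
  shows "(\<integral>\<omega>. f (iterate k \<omega>, W k \<omega>) \<partial>P) = (\<integral>\<omega>. (\<integral>w. f (iterate k \<omega>, w) \<partial>law Q) \<partial>P)"
proof -
  let ?D = "distr P (block_borel Q) (iterate k)"
  interpret D: prob_space ?D by (rule draws.prob_space_distr) (rule measurable_iterate)
  interpret DL: pair_prob_space ?D "law Q" ..
  have "integrable (?D \<Otimes>\<^sub>M law Q) f"
    unfolding joint_law[OF k, symmetric] using int measurable_pair[OF k] f by (simp add: integrable_distr_eq)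
  then have "(\<integral>x. f x \<partial>(?D \<Otimes>\<^sub>M law Q)) = (\<integral>b. (\<integral>w. f (b, w) \<partial>law Q) \<partial>?D)"
    by (simp add: DL.integral_fst')
  also have "\<dots> = (\<integral>\<omega>. (\<integral>w. f (iterate k \<omega>, w) \<partial>law Q) \<partial>P)"
    using f by (intro integral_distr measurable_iterate borel_measurable_lebesgue_integral) simp
  finally show ?thesis
    unfolding joint_law[OF k, symmetric] using measurable_pair[OF k] f by (simp add: integral_distr)
qed

text \<open>Here unbiasedness identifies the gradient of the objective with
  \<open>mean_grad\<close>, so that the variance assumption speaks about the same noise as the
  descent inequality.\<close>

lemma variance_bound_iff:
  "variance_bound Q \<Omega> P W \<chi>2 \<longleftrightarrow> (\<forall>k\<ge>1. AE \<omega> in P.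
     nn_cond_exp P (vimage_algebra (space P) (iterate k) (block_borel Q))
       (\<lambda>\<omega>. ennreal (noise_sq Q (iterate k \<omega>) (W k \<omega>))) \<omega> \<le> ennreal \<chi>2)"
proof -
  have "unbiased Q" using run by (simp add: psbcd_run_def)
  then have "block_grad (objective Q) t \<beta> = mean_grad Q t \<beta>" if "t < stages Q" "\<beta> \<in> block_vectors Q" for t \<beta>
    using that by (simp add: unbiased_def mean_grad_def)
  then have "dual_norm_sq Q (\<lambda>t. stoch_grad Q t (iterate k \<omega>) w - block_grad (objective Q) t (iterate k \<omega>))
      = noise_sq Q (iterate k \<omega>) w" for k \<omega> w
    by (simp add: noise_sq_def dual_norm_sq_def psbcd_in_block_vectors)
  then show ?thesis by (simp add: variance_bound_def Let_def)
qed

lemma finite_subalgebra: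
  "finite_measure_subalgebra P (vimage_algebra (space P) (iterate k) (block_borel Q))"
  by unfold_locales (auto simp: subalgebra_def sets_image_in_sets)

lemma measurable_noise_process:
  "1 \<le> k \<Longrightarrow> (\<lambda>\<omega>. noise_sq Q (iterate k \<omega>) (W k \<omega>)) \<in> borel_measurable P"
  using measurable_compose[OF measurable_pair measurable_noise_sq] by simp

text \<open>The conditional expectation is explicit: it equals \<open>h\<close> at the iterate,
  where \<open>h\<close> averages the noise over a fresh draw. The bound for \<open>h\<close> holds
  at every point of \<open>block_vectors Q\<close>, so it holds along the run.\<close>

lemma variance_boundI:
  assumes "smoothing Q * (\<Sum>j<comps Q. weight Q j) \<le> \<chi>2"
  shows "variance_bound Q \<Omega> P W \<chi>2"
  unfolding variance_bound_iff
proof (intro allI impI)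
  fix k :: nat assume k: "1 \<le> k"
  let ?F = "vimage_algebra (space P) (iterate k) (block_borel Q)"
  interpret F: finite_measure_subalgebra P ?F by (rule finite_subalgebra)
  define h where "h = (\<lambda>\<beta>. \<integral>\<^sup>+w. ennreal (noise_sq Q \<beta> w) \<partial>law Q)"
  have noise: "(\<lambda>x. ennreal (case_prod (noise_sq Q) x)) \<in> borel_measurable (block_borel Q \<Otimes>\<^sub>M law Q)"
    using measurable_noise_sq by simp
  have h: "h \<in> borel_measurable (block_borel Q)"
    unfolding h_def using borel_measurable_nn_integral_fst[OF noise] by simp
  have it: "iterate k \<in> ?F \<rightarrow>\<^sub>M block_borel Q"
    by (rule measurable_vimage_algebra1) (auto simp: space_block_borel psbcd_in_block_vectors)
  have le: "h \<beta> \<le> ennreal \<chi>2" if "\<beta> \<in> block_vectors Q" for \<beta>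
  proof -
    have "h \<beta> = ennreal (\<integral>w. noise_sq Q \<beta> w \<partial>law Q)"
      unfolding h_def using integral_dual_norm_sq_le(1)[OF that]
      by (intro nn_integral_eq_integral) (auto simp: noise_sq_def[symmetric] noise_sq_nonneg)
    also have "\<dots> \<le> ennreal \<chi>2"
      using integral_dual_norm_sq_le(2)[OF that] assms by (intro ennreal_leI) (simp add: noise_sq_def)
    finally show ?thesis .
  qed
  have "AE \<omega> in P. h (iterate k \<omega>) = nn_cond_exp P ?F (\<lambda>\<omega>. ennreal (noise_sq Q (iterate k \<omega>) (W k \<omega>))) \<omega>"
  proof (rule F.nn_cond_exp_charact)
    fix A assume "A \<in> sets ?F"
    \<comment> \<open>An event of the generated sigma-algebra is a preimage under the iterate, so
      its indicator is a function of the iterate and freezing applies to the product.\<close>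
    then obtain B where B: "B \<in> sets (block_borel Q)" and A: "A = iterate k -` B \<inter> space P"
      by (subst (asm) sets_vimage_algebra2) (auto simp: space_block_borel psbcd_in_block_vectors)
    let ?f = "\<lambda>x. ennreal (noise_sq Q (fst x) (snd x)) * indicator B (fst x)"
    have f: "?f \<in> borel_measurable (block_borel Q \<Otimes>\<^sub>M law Q)"
      using noise B measurable_compose[OF measurable_fst borel_measurable_indicator[OF B]]
      by (intro borel_measurable_times_ennreal) (auto simp: split_beta')
    have "(\<integral>\<^sup>+\<omega>\<in>A. ennreal (noise_sq Q (iterate k \<omega>) (W k \<omega>)) \<partial>P) = (\<integral>\<^sup>+\<omega>. ?f (iterate k \<omega>, W k \<omega>) \<partial>P)"
      by (intro nn_integral_cong) (auto simp: A indicator_def)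
    also have "\<dots> = (\<integral>\<^sup>+\<omega>. (\<integral>\<^sup>+w. ?f (iterate k \<omega>, w) \<partial>law Q) \<partial>P)"
      by (rule nn_integral_iterate[OF k f])
    also have "\<dots> = (\<integral>\<^sup>+\<omega>\<in>A. h (iterate k \<omega>) \<partial>P)"
      by (intro nn_integral_cong) (auto simp: A indicator_def h_def)
    finally show "(\<integral>\<^sup>+\<omega>\<in>A. ennreal (noise_sq Q (iterate k \<omega>) (W k \<omega>)) \<partial>P) = (\<integral>\<^sup>+\<omega>\<in>A. h (iterate k \<omega>) \<partial>P)" .
  next
    show "(\<lambda>\<omega>. ennreal (noise_sq Q (iterate k \<omega>) (W k \<omega>))) \<in> borel_measurable P"
      using measurable_noise_process[OF k] by simp
    show "(\<lambda>\<omega>. h (iterate k \<omega>)) \<in> borel_measurable ?F"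
      using measurable_compose[OF it h] .
  qed
  then show "AE \<omega> in P. nn_cond_exp P ?F (\<lambda>\<omega>. ennreal (noise_sq Q (iterate k \<omega>) (W k \<omega>))) \<omega> \<le> ennreal \<chi>2"
  proof (rule AE_mp[OF _ AE_I2], intro impI)
    fix \<omega> assume "h (iterate k \<omega>) = nn_cond_exp P ?F (\<lambda>\<omega>. ennreal (noise_sq Q (iterate k \<omega>) (W k \<omega>))) \<omega>"
    then show "nn_cond_exp P ?F (\<lambda>\<omega>. ennreal (noise_sq Q (iterate k \<omega>) (W k \<omega>))) \<omega> \<le> ennreal \<chi>2"
      using le[OF psbcd_in_block_vectors, of \<Omega> "\<lambda>i. W i \<omega>" k] by simp
  qed
qed

text \<open>Testing the conditional expectation against the constant 1 turns the conditional bound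
  into a bound on the mean. Integrability is a consequence, since everything is computed with
  nonnegative integrals.\<close>

lemma noise_moment:
  assumes var: "variance_bound Q \<Omega> P W \<chi>2" and "0 \<le> \<chi>2" and k: "1 \<le> k"
  shows "integrable P (\<lambda>\<omega>. noise_sq Q (iterate k \<omega>) (W k \<omega>))"
    and "(\<integral>\<omega>. noise_sq Q (iterate k \<omega>) (W k \<omega>) \<partial>P) \<le> \<chi>2"
proof -
  let ?F = "vimage_algebra (space P) (iterate k) (block_borel Q)"
  let ?n = "\<lambda>\<omega>. ennreal (noise_sq Q (iterate k \<omega>) (W k \<omega>))"
  interpret F: finite_measure_subalgebra P ?F by (rule finite_subalgebra)
  have "(\<integral>\<^sup>+\<omega>. 1 * ?n \<omega> \<partial>P) = (\<integral>\<^sup>+\<omega>. 1 * nn_cond_exp P ?F ?n \<omega> \<partial>P)"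
    by (rule F.nn_cond_exp_intg[symmetric]) (use measurable_noise_process[OF k] in auto)
  also have "\<dots> \<le> (\<integral>\<^sup>+\<omega>. ennreal \<chi>2 \<partial>P)"
    using var k unfolding variance_bound_iff by (intro nn_integral_mono_AE) auto
  finally have le: "(\<integral>\<^sup>+\<omega>. ?n \<omega> \<partial>P) \<le> ennreal \<chi>2" by (simp add: draws.emeasure_space_1)
  then have "(\<integral>\<^sup>+\<omega>. ?n \<omega> \<partial>P) < \<infinity>" using ennreal_less_top le_less_trans by fastforce
  then show int: "integrable P (\<lambda>\<omega>. noise_sq Q (iterate k \<omega>) (W k \<omega>))"
    using measurable_noise_process[OF k] by (intro integrableI_nonneg) (auto simp: noise_sq_nonneg)
  then have "(\<integral>\<^sup>+\<omega>. ?n \<omega> \<partial>P) = ennreal (\<integral>\<omega>. noise_sq Q (iterate k \<omega>) (W k \<omega>) \<partial>P)"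
    by (intro nn_integral_eq_integral) (auto simp: noise_sq_nonneg)
  then show "(\<integral>\<omega>. noise_sq Q (iterate k \<omega>) (W k \<omega>) \<partial>P) \<le> \<chi>2"
    using le \<open>0 \<le> \<chi>2\<close> by simp
qed

text \<open>The gradients are dominated by the \<open>\<beta>\<close>-free \<open>grad_bound\<close>
  at the draw and the displacements by the uniform bound on iterates. This integrability licenses
  freezing, after which the inner integral is 0 for each fixed point.\<close>

lemma noise_inner_integral:
  assumes k: "1 \<le> k"
  shows "integrable P (\<lambda>\<omega>. noise_inner Q \<beta>opt (iterate k \<omega>) (W k \<omega>))"
    and "(\<integral>\<omega>. noise_inner Q \<beta>opt (iterate k \<omega>) (W k \<omega>) \<partial>P) = 0"
proof -
  obtain R where R: "0 \<le> R" "\<And>k ws t. t < stages Q \<Longrightarrow> norm (psbcd Q \<Omega> ws k t) \<le> R"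
    using iterates_bounded by blast
  let ?I = "\<lambda>t. \<integral>w. grad_bound Q t w \<partial>law Q"
  let ?b = "\<lambda>\<omega>. \<Sum>t<stages Q. (?I t + grad_bound Q t (W k \<omega>)) * (R + norm (\<beta>opt t))"
  have gb: "integrable P (\<lambda>\<omega>. grad_bound Q t (W k \<omega>))" if "t < stages Q" for t
    using integrable_grad_bound[OF that] distr_W[OF k]
      integrable_distr[OF measurable_W[OF k], of "grad_bound Q t"] by simp
  show int: "integrable P (\<lambda>\<omega>. noise_inner Q \<beta>opt (iterate k \<omega>) (W k \<omega>))"
  proof (rule Bochner_Integration.integrable_bound)
    show "integrable P ?b" using gb by auto
    show "(\<lambda>\<omega>. noise_inner Q \<beta>opt (iterate k \<omega>) (W k \<omega>)) \<in> borel_measurable P"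
      using measurable_compose[OF measurable_pair[OF k] measurable_noise_inner] by simp
    have "\<bar>noise_inner Q \<beta>opt (iterate k \<omega>) (W k \<omega>)\<bar> \<le> ?b \<omega>" if "\<omega> \<in> space P" for \<omega>
      unfolding noise_inner_def
    proof (rule sum_norm_le[where 'a = real, unfolded real_norm_def])
      fix t assume "t \<in> {..<stages Q}"
      then have t: "t < stages Q" by simp
      have "W k \<omega> \<in> space (law Q)" using measurable_space[OF measurable_W[OF k] that] .
      then have "norm (mean_grad Q t (iterate k \<omega>) - stoch_grad Q t (iterate k \<omega>) (W k \<omega>))
          \<le> ?I t + grad_bound Q t (W k \<omega>)"
        by (intro order_trans[OF norm_triangle_ineq4] add_mono norm_mean_grad_le norm_stoch_grad_le t
            psbcd_in_block_vectors)
      moreover have "norm (iterate k \<omega> t - \<beta>opt t) \<le> R + norm (\<beta>opt t)"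
        using R(2)[OF t] by (intro order_trans[OF norm_triangle_ineq4]) simp
      moreover have "0 \<le> ?I t + grad_bound Q t (W k \<omega>)"
        by (intro add_nonneg_nonneg Bochner_Integration.integral_nonneg grad_bound_nonneg)
      ultimately show "\<bar>(mean_grad Q t (iterate k \<omega>) - stoch_grad Q t (iterate k \<omega>) (W k \<omega>)) \<bullet>
          (iterate k \<omega> t - \<beta>opt t)\<bar> \<le> (?I t + grad_bound Q t (W k \<omega>)) * (R + norm (\<beta>opt t))"
        by (intro order_trans[OF Cauchy_Schwarz_ineq2] mult_mono) auto
    qed
    then show "AE \<omega> in P. norm (noise_inner Q \<beta>opt (iterate k \<omega>) (W k \<omega>)) \<le> norm (?b \<omega>)"
      by (intro AE_I2) (auto intro: order_trans[OF _ abs_ge_self])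
  qed
  show "(\<integral>\<omega>. noise_inner Q \<beta>opt (iterate k \<omega>) (W k \<omega>) \<partial>P) = 0"
    using integral_iterate[OF k measurable_noise_inner[of \<beta>opt]] int
    by (simp add: integral_noise_inner psbcd_in_block_vectors)
qed

lemma integrable_weighted_dist_sq: "integrable P (\<lambda>\<omega>. weighted_dist_sq Q (iterate k \<omega>) \<beta>opt)"
proof -
  obtain R where R: "0 \<le> R" "\<And>k ws t. t < stages Q \<Longrightarrow> norm (psbcd Q \<Omega> ws k t) \<le> R"
    using iterates_bounded by blast
  have "weighted_dist_sq Q (iterate k \<omega>) \<beta>opt \<le> (\<Sum>t<stages Q. block_weight Q t * (R + norm (\<beta>opt t))\<^sup>2)" for \<omega>
    unfolding weighted_dist_sq_def
    by (intro sum_mono mult_left_mono power_mono block_weight_nonneg)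
      (auto intro!: order_trans[OF norm_triangle_ineq4] R)
  then show ?thesis
    using measurable_compose[OF measurable_iterate measurable_weighted_dist_sq]
    by (intro draws.integrable_const_bound) (auto simp: weighted_dist_sq_nonneg)
qed

text \<open>The tangent and smoothness inequalities at 0 squeeze the objective between an affine and
  a quadratic function, so it is bounded on bounded sets.\<close>

lemma integrable_objective:
  assumes X: "X \<in> P \<rightarrow>\<^sub>M block_borel Q" and R: "\<And>\<omega> t. t < stages Q \<Longrightarrow> norm (X \<omega> t) \<le> R"
  shows "integrable P (\<lambda>\<omega>. objective Q (X \<omega>))"
proof -
  define o0 :: "'b blocks" where "o0 = (\<lambda>t\<in>{..<stages Q}. 0)"
  have o0: "o0 \<in> block_vectors Q" "\<And>t. t < stages Q \<Longrightarrow> o0 t = 0" by (auto simp: o0_def block_vectors_def)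
  let ?L = "\<Sum>t<stages Q. norm (mean_grad Q t o0) * R" and ?U = "\<Sum>t<stages Q. block_weight Q t * R\<^sup>2"
  have "\<bar>objective Q (X \<omega>)\<bar> \<le> \<bar>objective Q o0\<bar> + ?L + ?U / 2" if "\<omega> \<in> space P" for \<omega>
  proof -
    have X': "X \<omega> \<in> block_vectors Q" using measurable_space[OF X that] by (simp add: space_block_borel)
    have "\<bar>\<Sum>t<stages Q. mean_grad Q t o0 \<bullet> X \<omega> t\<bar> \<le> ?L"
      by (rule sum_norm_le[where 'a = real, unfolded real_norm_def])
        (auto intro!: order_trans[OF Cauchy_Schwarz_ineq2] mult_left_mono R)
    moreover have "(\<Sum>t<stages Q. block_weight Q t * (norm (X \<omega> t))\<^sup>2) \<le> ?U"
      by (intro sum_mono mult_left_mono power_mono block_weight_nonneg R) auto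
    moreover have "0 \<le> (\<Sum>t<stages Q. block_weight Q t * (norm (X \<omega> t))\<^sup>2)"
      by (intro sum_nonneg mult_nonneg_nonneg block_weight_nonneg) simp
    ultimately show ?thesis
      using objective_lower[OF o0(1) X'] objective_upper[OF o0(1) X'] by (simp add: o0)
  qed
  then show ?thesis
    using measurable_compose[OF X measurable_objective] by (intro draws.integrable_const_bound AE_I2) auto
qed

lemma integrable_objective_iterate: "integrable P (\<lambda>\<omega>. objective Q (iterate k \<omega>))"
  using iterates_bounded integrable_objective[OF measurable_iterate] by blast

text \<open>The null set on which a block of weight 0 has a nonzero gradient lives in the scenario
  space; as \<open>W k\<close> has law \<open>law Q\<close>, it pulls back to a null event of the
  run.\<close>

lemma iterate_descent:
  assumes k: "1 \<le> k"
  shows "AE \<omega> in P. stepsize k * (objective Q (iterate (Suc k) \<omega>) - objective Q \<beta>opt)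
    \<le> weighted_dist_sq Q (iterate k \<omega>) \<beta>opt / 2 - weighted_dist_sq Q (iterate (Suc k) \<omega>) \<beta>opt / 2 +
      stepsize k * noise_inner Q \<beta>opt (iterate k \<omega>) (W k \<omega>) +
      (stepsize k)\<^sup>2 * noise_sq Q (iterate k \<omega>) (W k \<omega>)"
proof -
  have "AE w in law Q. \<forall>t\<in>{t\<in>{..<stages Q}. block_weight Q t = 0}. \<forall>\<beta>. stoch_grad Q t \<beta> w = 0"
    by (rule AE_finite_allI) (auto intro: AE_stoch_grad_zero)
  then have "AE w in distr P (law Q) (W k). \<forall>t\<in>{t\<in>{..<stages Q}. block_weight Q t = 0}. \<forall>\<beta>. stoch_grad Q t \<beta> w = 0"
    by (subst distr_W[OF k])
  then have "AE \<omega> in P. \<forall>t\<in>{t\<in>{..<stages Q}. block_weight Q t = 0}. \<forall>\<beta>. stoch_grad Q t \<beta> (W k \<omega>) = 0"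
    by (rule AE_distrD[OF measurable_W[OF k]])
  then show ?thesis
  proof (rule AE_mp[OF _ AE_I2], intro impI descent_step)
    fix \<omega> t assume t: "t < stages Q"
    have "iterate (Suc k) \<omega> t = closest_point (projection t)
        (iterate k \<omega> t - (stepsize k / block_weight Q t) *\<^sub>R stoch_grad Q t (iterate k \<omega>) (W k \<omega>))"
      using k t by simp
    then show "(iterate k \<omega> t - (stepsize k / block_weight Q t) *\<^sub>R stoch_grad Q t (iterate k \<omega>) (W k \<omega>)
        - iterate (Suc k) \<omega> t) \<bullet> (\<beta>opt t - iterate (Suc k) \<omega> t) \<le> 0"
      using closest_point_dot[OF convex_projection[OF t] compact_imp_closed[OF compact_projection[OF t]], of "\<beta>opt t"]
        opt_in(1) by simp
  qed (use stepsize_bounds(1)[of k] stepsize_bounds(2)[of k] in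
      \<open>auto simp: opt_in psbcd_in_block_vectors simp del: psbcd.simps\<close>)
qed

lemma expected_descent:
  assumes var: "variance_bound Q \<Omega> P W \<chi>2" "0 \<le> \<chi>2" and k: "1 \<le> k"
  shows "stepsize k * ((\<integral>\<omega>. objective Q (iterate (Suc k) \<omega>) \<partial>P) - objective Q \<beta>opt)
    \<le> (\<integral>\<omega>. weighted_dist_sq Q (iterate k \<omega>) \<beta>opt \<partial>P) / 2 -
      (\<integral>\<omega>. weighted_dist_sq Q (iterate (Suc k) \<omega>) \<beta>opt \<partial>P) / 2 + (stepsize k)\<^sup>2 * \<chi>2"
proof -
  note int = integrable_objective_iterate[of "Suc k"] integrable_weighted_dist_sq[of k]
    integrable_weighted_dist_sq[of "Suc k"] noise_inner_integral[OF k] noise_moment[OF var k]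
  have "stepsize k * ((\<integral>\<omega>. objective Q (iterate (Suc k) \<omega>) \<partial>P) - objective Q \<beta>opt)
      = (\<integral>\<omega>. stepsize k * (objective Q (iterate (Suc k) \<omega>) - objective Q \<beta>opt) \<partial>P)"
    using int(1) by (simp add: draws.prob_space del: psbcd.simps)
  also have "\<dots> \<le> (\<integral>\<omega>. weighted_dist_sq Q (iterate k \<omega>) \<beta>opt / 2 - weighted_dist_sq Q (iterate (Suc k) \<omega>) \<beta>opt / 2 +
      stepsize k * noise_inner Q \<beta>opt (iterate k \<omega>) (W k \<omega>) +
      (stepsize k)\<^sup>2 * noise_sq Q (iterate k \<omega>) (W k \<omega>) \<partial>P)"
    by (rule integral_mono_AE[OF _ _ iterate_descent[OF k]])
      (use int in \<open>auto simp del: psbcd.simps\<close>)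
  also have "\<dots> = (\<integral>\<omega>. weighted_dist_sq Q (iterate k \<omega>) \<beta>opt \<partial>P) / 2 -
      (\<integral>\<omega>. weighted_dist_sq Q (iterate (Suc k) \<omega>) \<beta>opt \<partial>P) / 2 +
      (stepsize k)\<^sup>2 * (\<integral>\<omega>. noise_sq Q (iterate k \<omega>) (W k \<omega>) \<partial>P)"
    using int by (simp del: psbcd.simps)
  also have "\<dots> \<le> (\<integral>\<omega>. weighted_dist_sq Q (iterate k \<omega>) \<beta>opt \<partial>P) / 2 -
      (\<integral>\<omega>. weighted_dist_sq Q (iterate (Suc k) \<omega>) \<beta>opt \<partial>P) / 2 + (stepsize k)\<^sup>2 * \<chi>2"
    using int by (intro add_left_mono mult_left_mono) auto
  finally show ?thesis .
qed

lemma sum_expected_descent: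
  assumes var: "variance_bound Q \<Omega> P W \<chi>2" "0 \<le> \<chi>2"
  shows "(\<Sum>k=1..n. stepsize k * ((\<integral>\<omega>. objective Q (iterate (Suc k) \<omega>) \<partial>P) - objective Q \<beta>opt))
    \<le> M\<^sup>2 / 2 * total_weight Q + \<chi>2 * (\<Sum>k=1..n. (stepsize k)\<^sup>2)"
proof -
  let ?D = "\<lambda>k. \<integral>\<omega>. weighted_dist_sq Q (iterate k \<omega>) \<beta>opt \<partial>P"
  have "(\<Sum>k=1..n. stepsize k * ((\<integral>\<omega>. objective Q (iterate (Suc k) \<omega>) \<partial>P) - objective Q \<beta>opt))
      \<le> (\<Sum>k=1..n. (?D k / 2 - ?D (Suc k) / 2) + (stepsize k)\<^sup>2 * \<chi>2)"
    by (rule sum_mono) (rule expected_descent[OF var], simp)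
  also have "\<dots> = (\<Sum>k=1..n. ?D k / 2 - ?D (Suc k) / 2) + \<chi>2 * (\<Sum>k=1..n. (stepsize k)\<^sup>2)"
    by (simp add: sum.distrib sum_distrib_left mult.commute del: psbcd.simps)
  also have "(\<Sum>k=1..n. ?D k / 2 - ?D (Suc k) / 2) = ?D 1 / 2 - ?D (Suc n) / 2"
    by (induction n) (simp_all del: psbcd.simps)
  also have "\<dots> \<le> ?D 1 / 2" by (simp add: Bochner_Integration.integral_nonneg weighted_dist_sq_nonneg del: psbcd.simps)
  \<comment> \<open>The first iterate is 0, so its distance to \<open>\<beta>opt\<close> in block
    \<open>t\<close> is the norm of \<open>\<beta>opt t\<close>, at most \<open>M\<close>.\<close>
  also have "?D 1 \<le> M\<^sup>2 * total_weight Q"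
  proof -
    have "weighted_dist_sq Q (iterate 1 \<omega>) \<beta>opt \<le> M\<^sup>2 * total_weight Q" for \<omega>
    proof -
      have "weighted_dist_sq Q (iterate 1 \<omega>) \<beta>opt \<le> (\<Sum>t<stages Q. block_weight Q t * M\<^sup>2)"
        unfolding weighted_dist_sq_def
        by (intro sum_mono mult_left_mono block_weight_nonneg) (auto intro!: power_mono norm_opt_le)
      then show ?thesis by (simp only: total_weight_def sum_distrib_right[symmetric] mult.commute)
    qed
    then have "?D 1 \<le> (\<integral>\<omega>. M\<^sup>2 * total_weight Q \<partial>P)"
      by (intro integral_mono integrable_weighted_dist_sq) auto
    then show ?thesis by (simp add: draws.prob_space)
  qed
  finally show ?thesis by (simp del: psbcd.simps)
qed

lemma expected_output_bound:
  assumes var: "variance_bound Q \<Omega> P W \<chi>2" "0 \<le> \<chi>2" and K: "2 \<le> K"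
  shows "(\<Sum>k=1..K-1. stepsize k) *
      ((\<integral>\<omega>. objective Q (psbcd_output Q \<Omega> (\<lambda>i. W i \<omega>) K) \<partial>P) - objective Q \<beta>opt)
    \<le> M\<^sup>2 / 2 * total_weight Q + \<chi>2 * (\<Sum>k=1..K-1. (stepsize k)\<^sup>2)"
proof -
  define A where "A = (\<Sum>k=1..K-1. stepsize k)"
  let ?out = "\<lambda>\<omega>. psbcd_output Q \<Omega> (\<lambda>i. W i \<omega>) K"
  have A: "0 < A" unfolding A_def using K by (intro sum_pos) (auto simp: stepsize_bounds)
  \<comment> \<open>The output averages indices \<open>2..K\<close> with the stepsize of the
    preceding index. Shifted, iterate \<open>Suc k\<close> carries \<open>stepsize k\<close>, the
    factor it has in the descent inequality.\<close>
  have shift: "(\<Sum>k=2..K. g (k - 1) k) = (\<Sum>k=1..K-1. g k (Suc k))" for g :: "nat \<Rightarrow> nat \<Rightarrow> 'z::comm_monoid_add"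
    using K by (intro sum.reindex_bij_witness[of _ Suc "\<lambda>k. k - 1"]) auto
  have out: "?out \<omega> t = (\<Sum>k=1..K-1. stepsize k *\<^sub>R iterate (Suc k) \<omega> t) /\<^sub>R A" if "t < stages Q" for \<omega> t
    using that shift[of "\<lambda>k l. stepsize k *\<^sub>R iterate l \<omega> t"] unfolding psbcd_output_def A_def
    by (simp del: psbcd.simps)
  obtain R where R: "0 \<le> R" "\<And>k ws t. t < stages Q \<Longrightarrow> norm (psbcd Q \<Omega> ws k t) \<le> R"
    using iterates_bounded by blast
  have "norm (?out \<omega> t) \<le> R" if t: "t < stages Q" for \<omega> t
  proof -
    have "norm (\<Sum>k=1..K-1. stepsize k *\<^sub>R iterate (Suc k) \<omega> t) \<le> (\<Sum>k=1..K-1. stepsize k * R)"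
      using stepsize_bounds(1) by (intro sum_norm_le) (auto intro!: mult_mono R t simp: less_imp_le simp del: psbcd.simps)
    also have "\<dots> = A * R" by (simp add: A_def sum_distrib_right)
    finally show ?thesis using A by (simp add: out[OF t] field_simps del: psbcd.simps)
  qed
  moreover have "?out \<in> P \<rightarrow>\<^sub>M block_borel Q"
    unfolding block_borel_def psbcd_output_def
  proof (rule measurable_restrict)
    fix t assume "t \<in> {..<stages Q}"
    then have [measurable]: "(\<lambda>\<omega>. iterate k \<omega> t) \<in> borel_measurable P" for k
      using measurable_compose[OF measurable_iterate measurable_block] by simp
    show "(\<lambda>\<omega>. (\<Sum>k=2..K. stepsize (k - 1) *\<^sub>R iterate k \<omega> t) /\<^sub>R (\<Sum>k=1..K-1. stepsize k)) \<in> borel_measurable P"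
      by measurable
  qed
  ultimately have int: "integrable P (\<lambda>\<omega>. objective Q (?out \<omega>))"
    by (intro integrable_objective)
  have "A * (\<integral>\<omega>. objective Q (?out \<omega>) \<partial>P) = (\<integral>\<omega>. A * objective Q (?out \<omega>) \<partial>P)"
    using int by simp
  also have "\<dots> \<le> (\<integral>\<omega>. (\<Sum>k=1..K-1. stepsize k * objective Q (iterate (Suc k) \<omega>)) \<partial>P)"
  proof (rule integral_mono)
    fix \<omega>
    show "A * objective Q (?out \<omega>) \<le> (\<Sum>k=1..K-1. stepsize k * objective Q (iterate (Suc k) \<omega>))"
      unfolding A_def
      by (rule objective_average_le)
        (use A stepsize_bounds(1) out in \<open>auto simp: A_def less_imp_le psbcd_in_block_vectors
          psbcd_output_in_block_vectors simp del: psbcd.simps\<close>)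
  qed (use int integrable_objective_iterate in \<open>auto simp del: psbcd.simps\<close>)
  also have "\<dots> = (\<Sum>k=1..K-1. stepsize k * (\<integral>\<omega>. objective Q (iterate (Suc k) \<omega>) \<partial>P))"
    using integrable_objective_iterate by (simp del: psbcd.simps)
  finally have "A * ((\<integral>\<omega>. objective Q (?out \<omega>) \<partial>P) - objective Q \<beta>opt)
      \<le> (\<Sum>k=1..K-1. stepsize k * ((\<integral>\<omega>. objective Q (iterate (Suc k) \<omega>) \<partial>P) - objective Q \<beta>opt))"
    by (simp add: A_def right_diff_distrib sum_subtractf sum_distrib_right del: psbcd.simps)
  also have "\<dots> \<le> M\<^sup>2 / 2 * total_weight Q + \<chi>2 * (\<Sum>k=1..K-1. (stepsize k)\<^sup>2)"
    by (rule sum_expected_descent[OF var])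
  finally show ?thesis by (simp add: A_def)
qed

end

section \<open>Convergence rate\<close>

lemma sum_stepsize_lower:
  assumes "2 \<le> K"
  shows "sqrt (real K) / 4 \<le> (\<Sum>k=1..K-1. stepsize k)"
proof -
  have "real (K - 1) * (1 / (2 * sqrt (real K))) = (\<Sum>k=1..K-1. 1 / (2 * sqrt (real K)))" by simp
  also have "\<dots> \<le> (\<Sum>k=1..K-1. stepsize k)"
    unfolding stepsize_def using assms by (intro sum_mono divide_left_mono mult_left_mono real_sqrt_le_mono) auto
  finally have "real (K - 1) * (1 / (2 * sqrt (real K))) \<le> (\<Sum>k=1..K-1. stepsize k)" .
  \<comment> \<open>From \<open>2 \<le> K\<close> one has \<open>K / 2 \<le> K - 1\<close>, which
    makes the lower bound a clean multiple of \<open>sqrt K\<close>.\<close>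
  moreover have "real K / 2 * (1 / (2 * sqrt (real K))) \<le> real (K - 1) * (1 / (2 * sqrt (real K)))"
    using assms by (intro mult_right_mono) (auto simp: of_nat_diff)
  moreover have "real K / 2 * (1 / (2 * sqrt (real K))) = sqrt (real K) / 4"
    using real_div_sqrt[of "real K"] by simp
  ultimately show ?thesis by linarith
qed

text \<open>The squared stepsize is \<open>1 / (4 * (k + 1))\<close>, and \<open>1 / (K + 1)\<close>
  is at most \<open>ln (K + 1) - ln K\<close>, which telescopes.\<close>

lemma sum_stepsize_sq_upper:
  assumes "1 \<le> K"
  shows "(\<Sum>k=1..K-1. (stepsize k)\<^sup>2) \<le> ln (real K) / 4"
  using assms
proof (induction K rule: nat_induct_at_least)
  case (Suc K)
  have K: "0 < real K" using Suc by simp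
  define r where "r = 1 / (real K + 1)"
  have "r \<le> ln (real K + 1) - ln (real K)"
  proof -
    have "ln (real K / (real K + 1)) \<le> real K / (real K + 1) - 1"
      using K by (intro ln_le_minus_one) auto
    also have "real K / (real K + 1) - 1 = - (1 / (real K + 1))" using K by (simp add: field_simps)
    finally show ?thesis using K by (simp add: ln_div r_def)
  qed
  moreover have "(\<Sum>k=1..Suc K - 1. (stepsize k)\<^sup>2) = (\<Sum>k=1..K-1. (stepsize k)\<^sup>2) + (stepsize K)\<^sup>2"
    using Suc by (cases K) auto
  moreover have "(stepsize K)\<^sup>2 = r / 4"
    by (simp add: r_def stepsize_def power_divide power_mult_distrib)
  moreover have "real (Suc K) = real K + 1" by simp
  ultimately show ?case using Suc.IH by (simp only:)
qed simp

text \<open>If \<open>ln K\<close> is not dominated by \<open>ln (e + g)\<close>, then \<open>g\<close> is at most \<open>K powr (1/3)\<close> and there is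
  polynomial room to absorb the logarithm.\<close>

lemma soft_bound_sqrt:
  fixes a g :: real
  assumes a: "1 \<le> a" and g: "0 \<le> g" and K: "2 \<le> K"
    and C: "(a * (36 * a + 4))\<^sup>2 \<le> C" and le: "soft_bound C 2 g \<le> real K"
  shows "a * (1 + ln (real K)) * sqrt g \<le> sqrt (real K)"
proof -
  define L y where "L = ln (exp 1 + g)" and "y = ln (real K)"
  \<comment> \<open>The constant serves the second case below. There \<open>y\<close> exceeds
    \<open>36 * a + 3\<close>, hence \<open>a * (1 + y) \<le> 2 * a * y \<le> y^2 / 18\<close>,
    which is the quadratic Taylor term of \<open>exp (y / 3)\<close>; \<open>B \<ge> 40\<close> also
    yields \<open>3 * L + 1 \<le> B * L\<close>.\<close>
  define B where "B = 36 * a + 4"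
  have eg: "0 < exp 1 + g" using g by (intro add_pos_nonneg) auto
  have L: "1 \<le> L" using g unfolding L_def by (subst ln_ge_iff[OF eg]) simp
  have y: "0 \<le> y" using K by (simp add: y_def)
  have B: "40 \<le> B" using a by (simp add: B_def)
  show ?thesis
  \<comment> \<open>In the first case the logarithm of \<open>K\<close> is replaced by that of
    \<open>g\<close>, and squaring gives \<open>(a * B)^2 * g * L^2\<close>, which is where
    \<open>C\<close> and the exponent 2 come from. In the second, \<open>exp (y / 3)\<close> absorbs
    the logarithm and \<open>exp (y / 6)\<close> bounds \<open>sqrt g\<close>; together they give
    \<open>exp (y / 2) = sqrt K\<close>.\<close>
  proof (cases "1 + y \<le> B * L")
    case True
    have "a * (1 + y) * sqrt g \<le> a * (B * L) * sqrt g"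
      using True a g by (intro mult_left_mono mult_right_mono) auto
    also have "\<dots> = sqrt ((a * B)\<^sup>2 * g * L\<^sup>2)"
      using a B L by (simp add: real_sqrt_mult)
    also have "\<dots> \<le> sqrt (real K)"
    proof (rule real_sqrt_le_mono)
      have "(a * B)\<^sup>2 * g * L\<^sup>2 \<le> C * g * L\<^sup>2"
        using C g by (intro mult_right_mono) (auto simp: B_def)
      also have "\<dots> \<le> real K" using le by (simp add: soft_bound_def L_def)
      finally show "(a * B)\<^sup>2 * g * L\<^sup>2 \<le> real K" .
    qed
    finally show ?thesis by (simp add: y_def)
  next
    case False
    have "B * 1 \<le> B * L" using L B by (intro mult_left_mono) auto
    then have y36: "36 * a + 3 \<le> y" using False by (simp add: B_def)
    have "3 * L + 1 \<le> B * L"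
    proof -
      have "3 * L + 1 \<le> 40 * L" using L by simp
      also have "\<dots> \<le> B * L" using B L by (intro mult_right_mono) auto
      finally show ?thesis .
    qed
    then have "L \<le> y / 3" using False by simp
    then have "exp L \<le> exp (y / 3)" by simp
    then have "g \<le> exp (y / 3)" using eg by (simp add: L_def) (smt (verit) exp_gt_zero)
    then have "sqrt g \<le> sqrt (exp (y / 3))" by simp
    also have "\<dots> = exp (y / 6)"
      by (rule real_sqrt_unique) (simp_all add: power2_eq_square flip: exp_add)
    finally have sg: "sqrt g \<le> exp (y / 6)" .
    have "36 * a * y \<le> y * y" using y36 y a by (intro mult_right_mono) auto
    moreover have "a * (1 + y) \<le> a * (2 * y)" using y36 a by (intro mult_left_mono) auto
    ultimately have "a * (1 + y) \<le> y\<^sup>2 / 18" by (simp add: power2_eq_square)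
    also have "\<dots> = (y / 3)\<^sup>2 / 2" by (simp add: power_divide)
    also have "\<dots> \<le> exp (y / 3)"
      using exp_lower_Taylor_quadratic[of "y / 3"] y by simp
    finally have "a * (1 + y) * sqrt g \<le> exp (y / 3) * exp (y / 6)"
      using sg g by (intro mult_mono) auto
    also have "\<dots> = exp (y / 2)" by (simp flip: exp_add)
    also have "\<dots> = sqrt (real K)"
    proof (rule real_sqrt_unique[symmetric])
      have "(exp (y / 2))\<^sup>2 = exp y" by (simp add: power2_eq_square flip: exp_add)
      then show "(exp (y / 2))\<^sup>2 = real K" using K by (simp add: y_def)
    qed simp
    finally show ?thesis by (simp add: y_def)
  qed
qed

context psbcd_process
begin

lemma expected_output_rate:
  assumes var: "variance_bound Q \<Omega> P W \<chi>2" "0 \<le> \<chi>2" and K: "2 \<le> K"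
  shows "((\<integral>\<omega>. objective Q (psbcd_output Q \<Omega> (\<lambda>i. W i \<omega>) K) \<partial>P) - objective Q \<beta>opt) * sqrt (real K)
    \<le> (2 * M\<^sup>2 * total_weight Q + \<chi>2) * (1 + ln (real K))"
proof -
  let ?A = "\<Sum>k=1..K-1. stepsize k"
  let ?gap = "(\<integral>\<omega>. objective Q (psbcd_output Q \<Omega> (\<lambda>i. W i \<omega>) K) \<partial>P) - objective Q \<beta>opt"
  have tw: "0 \<le> total_weight Q" by (simp add: total_weight_def sum_nonneg block_weight_nonneg)
  have ln: "0 \<le> ln (real K)" using K by simp
  have "?A * ?gap \<le> M\<^sup>2 / 2 * total_weight Q + \<chi>2 * (\<Sum>k=1..K-1. (stepsize k)\<^sup>2)"
    by (rule expected_output_bound[OF var K])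
  also have "\<dots> \<le> M\<^sup>2 / 2 * total_weight Q + \<chi>2 * (ln (real K) / 4)"
    using var(2) K by (intro add_left_mono mult_left_mono sum_stepsize_sq_upper) auto
  finally have *: "4 * (?A * ?gap) \<le> 2 * M\<^sup>2 * total_weight Q + \<chi>2 * ln (real K)" by simp
  also have "\<dots> \<le> (2 * M\<^sup>2 * total_weight Q + \<chi>2) * (1 + ln (real K))"
    using tw ln var(2) by (simp add: algebra_simps)
  finally have le: "4 * ?A * ?gap \<le> (2 * M\<^sup>2 * total_weight Q + \<chi>2) * (1 + ln (real K))" by simp
  show ?thesis
  \<comment> \<open>Replacing the stepsize sum by its lower bound requires a nonnegative gap; a
    negative gap satisfies the claim at once.\<close>
  proof (cases "0 \<le> ?gap")
    case True
    have "?gap * sqrt (real K) \<le> ?gap * (4 * ?A)"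
      using sum_stepsize_lower[OF K] True by (intro mult_left_mono) auto
    then show ?thesis using le by (simp add: mult.commute)
  next
    case False
    then have "?gap * sqrt (real K) \<le> 0" by (simp add: mult_le_0_iff)
    also have "0 \<le> (2 * M\<^sup>2 * total_weight Q + \<chi>2) * (1 + ln (real K))"
      using tw ln var(2) by simp
    finally show ?thesis .
  qed
qed

text \<open>Common core of the three complexity claims, which differ in the choice of
  \<open>g\<close>: each makes \<open>\<epsilon> * sqrt g\<close> a scale that dominates the
  numerator of the rate up to the factor \<open>a\<close>.\<close>

lemma achieves_withinI:
  assumes var: "variance_bound Q \<Omega> P W \<chi>2" "0 \<le> \<chi>2" and \<epsilon>: "0 < \<epsilon>" and g: "0 \<le> g" and a: "1 \<le> a"
    and le: "2 * M\<^sup>2 * total_weight Q + \<chi>2 \<le> a * (\<epsilon> * sqrt g)" and C: "(a * (36 * a + 4))\<^sup>2 \<le> C"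
  shows "achieves_within Q \<Omega> \<beta>opt P W \<epsilon> (soft_bound C 2 g)"
  unfolding achieves_within_def
proof (intro allI impI)
  fix K :: nat assume K: "2 \<le> K" and "soft_bound C 2 g \<le> real K"
  then have *: "a * (1 + ln (real K)) * sqrt g \<le> sqrt (real K)"
    using a g C by (intro soft_bound_sqrt)
  let ?gap = "(\<integral>\<omega>. objective Q (psbcd_output Q \<Omega> (\<lambda>i. W i \<omega>) K) \<partial>P) - objective Q \<beta>opt"
  have "?gap * sqrt (real K) \<le> (2 * M\<^sup>2 * total_weight Q + \<chi>2) * (1 + ln (real K))"
    by (rule expected_output_rate[OF var K])
  also have "\<dots> \<le> a * (\<epsilon> * sqrt g) * (1 + ln (real K))"
    using le K by (intro mult_right_mono) auto
  also have "\<dots> = \<epsilon> * (a * (1 + ln (real K)) * sqrt g)" by simp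
  also have "\<dots> \<le> \<epsilon> * sqrt (real K)" using * \<epsilon> by (intro mult_left_mono) auto
  finally show "?gap \<le> \<epsilon>" using K by simp
qed

end

lemma psbcd_iteration_complexity:
  fixes M \<chi>2 \<nu>min :: real
  assumes "0 \<le> \<chi>2" "0 < \<nu>min"
  shows "\<exists>C p. \<forall>(Q :: ('w, 'u, 'b::finite) smoothed_problem) \<Omega> \<beta>opt (P :: 'p measure) W \<epsilon>.
          well_posed Q \<and> \<nu>min \<le> total_weight Q \<and> psbcd_run Q \<Omega> \<beta>opt M P W \<and>
          variance_bound Q \<Omega> P W \<chi>2 \<and> 0 < \<epsilon> \<longrightarrow>
            achieves_within Q \<Omega> \<beta>opt P W \<epsilon> (soft_bound C p (1 / \<epsilon>\<^sup>2 * (total_weight Q)\<^sup>2))"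
proof -
  \<comment> \<open>The last summand uses \<open>\<nu>min \<le> total_weight Q\<close> to turn the
    additive \<open>\<chi>2\<close> into a multiple of the total weight; the leading 1 secures
    \<open>1 \<le> a\<close>.\<close>
  define a where "a = 1 + 2 * M\<^sup>2 + \<chi>2 / \<nu>min"
  have a: "1 \<le> a" using assms by (simp add: a_def)
  show ?thesis
  proof (rule exI[of _ "(a * (36 * a + 4))\<^sup>2"], rule exI[of _ 2], intro allI impI, elim conjE)
    fix Q :: "('w, 'u, 'b) smoothed_problem" and \<Omega> \<beta>opt and P :: "'p measure" and W \<epsilon>
    assume wp: "well_posed Q" and tw: "\<nu>min \<le> total_weight Q" and run: "psbcd_run Q \<Omega> \<beta>opt M P W"
      and var: "variance_bound Q \<Omega> P W \<chi>2" and \<epsilon>: "(0::real) < \<epsilon>"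
    interpret psbcd_process Q \<Omega> \<beta>opt M P W by unfold_locales (fact wp run)+
    have "\<epsilon> * sqrt (1 / \<epsilon>\<^sup>2 * (total_weight Q)\<^sup>2) = total_weight Q"
      using \<epsilon> tw assms by (simp add: real_sqrt_mult real_sqrt_divide)
    moreover have "2 * M\<^sup>2 * total_weight Q + \<chi>2 \<le> a * total_weight Q"
    proof -
      have "\<chi>2 = \<chi>2 / \<nu>min * \<nu>min" using assms by simp
      also have "\<dots> \<le> \<chi>2 / \<nu>min * total_weight Q" using tw assms by (intro mult_left_mono) auto
      finally show ?thesis using tw assms by (simp add: a_def distrib_right)
    qed
    ultimately show "achieves_within Q \<Omega> \<beta>opt P W \<epsilon>
        (soft_bound ((a * (36 * a + 4))\<^sup>2) 2 (1 / \<epsilon>\<^sup>2 * (total_weight Q)\<^sup>2))"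
      using var assms \<epsilon> a by (intro achieves_withinI[of \<chi>2 _ _ a]) auto
  qed
qed

section \<open>The two formulations of the decision process\<close>

text \<open>Uniformly bounded slopes and integrable offsets suffice: the Frobenius bound controls
  the spectral norms, and a smoothed component is dominated by its affine pieces.\<close>

lemma well_posedI:
  fixes Q :: "('w, 'u, 'b::finite) smoothed_problem" and b :: real
  assumes prob: "prob_space (law Q)" and \<sigma>: "0 < smoothing Q" "smoothing Q < 1"
    and comp: "\<And>j. j < comps Q \<Longrightarrow> 0 < weight Q j \<and> finite (choices Q j) \<and> choices Q j \<noteq> {} \<and> finite (appearing Q j)"
    and offset: "\<And>j u. j < comps Q \<Longrightarrow> u \<in> choices Q j \<Longrightarrow> integrable (law Q) (\<lambda>w. offset Q j w u)"
    and slope: "\<And>j u t. j < comps Q \<Longrightarrow> u \<in> choices Q j \<Longrightarrow> t < stages Q \<Longrightarrow>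
      (\<lambda>w. slope Q j w u t) \<in> borel_measurable (law Q)"
    and bound: "\<And>j u t w. j < comps Q \<Longrightarrow> u \<in> choices Q j \<Longrightarrow> t < stages Q \<Longrightarrow> w \<in> space (law Q) \<Longrightarrow>
      norm (slope Q j w u t) \<le> b"
    and zero: "\<And>j u t w. j < comps Q \<Longrightarrow> u \<in> choices Q j \<Longrightarrow> t < stages Q \<Longrightarrow> t \<notin> appearing Q j \<Longrightarrow>
      w \<in> space (law Q) \<Longrightarrow> slope Q j w u t = 0"
  shows "well_posed Q"
proof -
  interpret prob_space "law Q" by fact
  have spectral: "integrable (law Q) (\<lambda>w. (spectral_norm (choices Q j) (\<lambda>u. slope Q j w u t))\<^sup>2)"
    if j: "j < comps Q" and t: "t < stages Q" for j t
  proof (rule integrable_const_bound)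
    have "(spectral_norm (choices Q j) (\<lambda>u. slope Q j w u t))\<^sup>2 \<le> (\<Sum>u\<in>choices Q j. b\<^sup>2)"
      if "w \<in> space (law Q)" for w
      by (rule order_trans[OF spectral_norm_sq_le]) (intro sum_mono power_mono bound j t that norm_ge_zero)
    then show "AE w in law Q. norm ((spectral_norm (choices Q j) (\<lambda>u. slope Q j w u t))\<^sup>2) \<le> (\<Sum>u\<in>choices Q j. b\<^sup>2)"
      by (intro AE_I2) simp
    show "(\<lambda>w. (spectral_norm (choices Q j) (\<lambda>u. slope Q j w u t))\<^sup>2) \<in> borel_measurable (law Q)"
      using comp[OF j] by (intro borel_measurable_power borel_measurable_spectral_norm slope j t) auto
  qed
  have sc: "integrable (law Q) (smoothed_comp Q j \<beta>)" if j: "j < comps Q" for j \<beta>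
  proof -
    have aff: "integrable (law Q) (\<lambda>w. affine_piece Q j \<beta> w u)" if u: "u \<in> choices Q j" for u
      unfolding affine_piece_def
    proof (intro Bochner_Integration.integrable_add Bochner_Integration.integrable_sum offset j u integrable_inner_left)
      fix t assume "t \<in> {..<stages Q}"
      then show "integrable (law Q) (\<lambda>w. slope Q j w u t)"
        using slope[OF j u] bound[OF j u] by (intro integrable_const_bound[of _ b] AE_I2) auto
    qed
    let ?v = "\<lambda>w u. affine_piece Q j \<beta> w u / smoothing Q"
    let ?g = "\<lambda>w. smoothing Q * weight Q j * ((\<Sum>u\<in>choices Q j. \<bar>?v w u\<bar>) + ln (card (choices Q j)))"
    show ?thesis
    proof (rule Bochner_Integration.integrable_bound)
      show "integrable (law Q) ?g" using aff by auto
      have [measurable]: "(\<lambda>w. affine_piece Q j \<beta> w u) \<in> borel_measurable (law Q)" if "u \<in> choices Q j" for u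
        using aff[OF that] by auto
      show "smoothed_comp Q j \<beta> \<in> borel_measurable (law Q)"
        unfolding smoothed_comp_def[abs_def] by measurable
      have "\<bar>smoothed_comp Q j \<beta> w\<bar> \<le> ?g w" for w
        using comp[OF j] \<sigma> log_sum_exp_abs_le[of "choices Q j" "?v w"]
        unfolding smoothed_comp_eq by (simp add: abs_mult)
      then show "AE w in law Q. norm (smoothed_comp Q j \<beta> w) \<le> norm (?g w)"
        by (intro AE_I2) (auto intro: order_trans[OF _ abs_ge_self])
    qed
  qed
  show ?thesis
    unfolding well_posed_def using prob \<sigma> comp offset slope zero spectral sc by auto
qed

lemma sum_power_le:
  fixes \<gamma> :: real
  assumes "0 < \<gamma>" "\<gamma> < 1"
  shows "(\<Sum>t<n. \<gamma> ^ t) \<le> 1 / (1 - \<gamma>)"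
  using assms by (simp add: sum_gp_strict divide_right_mono)

lemma wtca_simps [simp]:
  "stages (wtca D \<sigma>) = horizon D" "comps (wtca D \<sigma>) = horizon D" "weight (wtca D \<sigma>) j = discount D ^ j"
  "appearing (wtca D \<sigma>) j = {j, Suc j}" "law (wtca D \<sigma>) = exo_law D" "smoothing (wtca D \<sigma>) = \<sigma>"
  by (simp_all add: wtca_def)

lemma po_simps [simp]:
  "stages (po D \<sigma>) = horizon D" "comps (po D \<sigma>) = 1" "weight (po D \<sigma>) j = 1"
  "choices (po D \<sigma>) j = policies D" "appearing (po D \<sigma>) j = {..<horizon D}"
  "offset (po D \<sigma>) j w u = (\<Sum>t<horizon D. discount D ^ t * reward D t (induced_state D u t, w t) (u t))"
  "law (po D \<sigma>) = exo_law D" "smoothing (po D \<sigma>) = \<sigma>"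
  by (simp_all add: po_def)

locale mdp_formulations =
  fixes S :: nat and D :: "('x, 'a, 'v, 'd::finite) mdp" and \<sigma> :: real
  assumes valid: "valid_mdp S D" and \<sigma>: "0 < \<sigma>" "\<sigma> < 1"
begin

abbreviation "T \<equiv> horizon D"
abbreviation "\<gamma> \<equiv> discount D"

lemma horizon: "1 \<le> T" and discount: "0 < \<gamma>" "\<gamma> < 1"
  using valid by (auto simp: valid_mdp_def)

lemma markov: "markov_exo_law D"
  using valid by (simp add: valid_mdp_def)

sublocale exo: prob_space "exo_law D"
  using markov by (simp add: markov_exo_law_def)

lemma stage_facts:
  assumes "t < T"
  shows finite_endo: "finite (endo D t)" and finite_actions: "finite (actions D t)"
    and actions_nonempty: "actions D t \<noteq> {}" and card_le: "card (endo D t) * card (actions D t) \<le> S"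
    and measurable_basis: "\<And>x. x \<in> endo D t \<Longrightarrow> (\<lambda>v. basis D t (x, v)) \<in> borel_measurable (exo D t)"
    and norm_basis_le: "\<And>x v. x \<in> endo D t \<Longrightarrow> v \<in> space (exo D t) \<Longrightarrow> norm (basis D t (x, v)) \<le> 1"
    and integrable_reward: "\<And>x a. x \<in> endo D t \<Longrightarrow> a \<in> actions D t \<Longrightarrow>
      integrable (exo_law D) (\<lambda>w. reward D t (x, w t) a)"
  using valid assms by (auto simp: valid_mdp_def)

lemma trans_in: "Suc t < T \<Longrightarrow> x \<in> endo D t \<Longrightarrow> a \<in> actions D t \<Longrightarrow> trans D x a \<in> endo D (Suc t)"
  using valid by (auto simp: valid_mdp_def)

lemma endo0_in: "endo0 D \<in> endo D 0"
  using valid by (simp add: valid_mdp_def)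

lemma endo_nonempty: "t < T \<Longrightarrow> endo D t \<noteq> {}"
proof (induction t)
  case 0
  then show ?case using endo0_in by auto
next
  case (Suc t)
  then obtain x a where "x \<in> endo D t" "a \<in> actions D t" using actions_nonempty[of t] by auto
  then show ?case using trans_in[OF Suc.prems] by blast
qed

lemma exo_coordinate:
  assumes "t < T"
  shows measurable_exo: "(\<lambda>w. w t) \<in> exo_law D \<rightarrow>\<^sub>M exo D t"
    and space_exo: "w \<in> space (exo_law D) \<Longrightarrow> w t \<in> space (exo D t)"
proof -
  have "sets (exo_law D) = sets (\<Pi>\<^sub>M t\<in>{..<T}. exo D t)"
    using markov by (simp add: markov_exo_law_def)
  then show meas: "(\<lambda>w. w t) \<in> exo_law D \<rightarrow>\<^sub>M exo D t"
    using assms measurable_component_singleton[of t "{..<T}" "exo D"] by (simp cong: measurable_cong_sets)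
  show "w \<in> space (exo_law D) \<Longrightarrow> w t \<in> space (exo D t)"
    by (rule measurable_space[OF meas])
qed

lemma exo0_in: "exo0 D \<in> space (exo D 0)"
  using markov by (simp add: markov_exo_law_def)

lemma kernel: "Suc t < T \<Longrightarrow> kernel D t \<in> exo D t \<rightarrow>\<^sub>M prob_algebra (exo D (Suc t))"
  using markov by (simp add: markov_exo_law_def)

lemma measurable_next_basis:
  assumes "Suc t < T" "x \<in> endo D (Suc t)"
  shows "next_basis D t x \<in> borel_measurable (exo D t)"
  unfolding next_basis_def[abs_def]
  using measurable_compose[OF measurable_prob_algebraD[OF kernel[OF assms(1)]]
      integral_measurable_subprob_algebra[OF measurable_basis[OF assms]]] .

lemma norm_next_basis_le:
  assumes t: "Suc t < T" and x: "x \<in> endo D (Suc t)" and v: "v \<in> space (exo D t)"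
  shows "norm (next_basis D t x v) \<le> 1"
proof -
  have "kernel D t v \<in> space (prob_algebra (exo D (Suc t)))"
    using kernel[OF t] v by (rule measurable_space)
  then have sets: "sets (kernel D t v) = sets (exo D (Suc t))" and "prob_space (kernel D t v)"
    by (auto simp: space_prob_algebra)
  then interpret K: prob_space "kernel D t v" by simp
  have bound: "norm (basis D (Suc t) (x, v')) \<le> 1" if "v' \<in> space (kernel D t v)" for v'
    using norm_basis_le[OF t x] that sets_eq_imp_space_eq[OF sets] by simp
  have "(\<lambda>v'. basis D (Suc t) (x, v')) \<in> borel_measurable (kernel D t v)"
    using measurable_basis[OF t x] sets by (simp cong: measurable_cong_sets)
  then have int: "integrable (kernel D t v) (\<lambda>v'. basis D (Suc t) (x, v'))"
    using bound by (intro K.integrable_const_bound[of _ 1] AE_I2)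
  have "norm (next_basis D t x v) \<le> (\<integral>v'. norm (basis D (Suc t) (x, v')) \<partial>kernel D t v)"
    unfolding next_basis_def by (rule integral_norm_bound)
  also have "\<dots> \<le> (\<integral>v'. 1 \<partial>kernel D t v)"
    using int bound by (intro integral_mono) auto
  finally show ?thesis by (simp add: K.prob_space)
qed

section \<open>The WTCA formulation\<close>

lemma wtca_choice:
  assumes "j < T" "(x, a) \<in> choices (wtca D \<sigma>) j"
  shows "x \<in> endo D j" "a \<in> actions D j"
  using assms endo0_in by (auto simp: wtca_def split: if_splits)

lemma wtca_slope:
  assumes j: "j < T" and u: "u \<in> choices (wtca D \<sigma>) j" and t: "t < T"
  shows "(\<lambda>w. slope (wtca D \<sigma>) j w u t) \<in> borel_measurable (exo_law D)"
    and "w \<in> space (exo_law D) \<Longrightarrow> norm (slope (wtca D \<sigma>) j w u t) \<le> 1"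
proof -
  obtain x a where ua: "u = (x, a)" by fastforce
  note xa = wtca_choice[OF j u[unfolded ua]]
  consider "t = Suc j" | "t = j" "t \<noteq> 0" | "t \<noteq> Suc j" "\<not> (t = j \<and> t \<noteq> 0)" by blast
  then have "(\<lambda>w. slope (wtca D \<sigma>) j w u t) \<in> borel_measurable (exo_law D) \<and>
    (w \<in> space (exo_law D) \<longrightarrow> norm (slope (wtca D \<sigma>) j w u t) \<le> 1)"
  proof cases
    case 1
    then have sj: "Suc j < T" using t by simp
    note tr = trans_in[OF sj xa]
    have "(\<lambda>w. next_basis D j (trans D x a) (if j = 0 then exo0 D else w j)) \<in> borel_measurable (exo_law D)"
      using measurable_compose[OF measurable_exo[OF j] measurable_next_basis[OF sj tr]] by (cases "j = 0") auto
    moreover have "norm (\<gamma> *\<^sub>R next_basis D j (trans D x a) (if j = 0 then exo0 D else w j)) \<le> 1"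
      if "w \<in> space (exo_law D)"
    proof -
      have "norm (next_basis D j (trans D x a) (if j = 0 then exo0 D else w j)) \<le> 1"
        using exo0_in space_exo[OF j that] by (intro norm_next_basis_le sj tr) auto
      then show ?thesis using discount by (simp add: mult_le_one)
    qed
    ultimately show ?thesis using 1 by (simp add: wtca_def ua)
  next
    case 2
    have "(\<lambda>w. basis D t (x, w t)) \<in> borel_measurable (exo_law D)"
      using measurable_compose[OF measurable_exo[OF t] measurable_basis[OF t]] xa 2 by simp
    moreover have "norm (basis D t (x, w t)) \<le> 1" if "w \<in> space (exo_law D)"
      using norm_basis_le[OF t _ space_exo[OF t that]] xa 2 by simp
    ultimately show ?thesis using 2 by (simp add: wtca_def ua)
  next
    case 3
    then show ?thesis by (auto simp: wtca_def ua)
  qed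
  then show "(\<lambda>w. slope (wtca D \<sigma>) j w u t) \<in> borel_measurable (exo_law D)"
    and "w \<in> space (exo_law D) \<Longrightarrow> norm (slope (wtca D \<sigma>) j w u t) \<le> 1" by auto
qed

lemma wtca_choices_facts:
  assumes "j < T"
  shows "finite (choices (wtca D \<sigma>) j)" "choices (wtca D \<sigma>) j \<noteq> {}" "card (choices (wtca D \<sigma>) j) \<le> S"
proof -
  note fin = finite_endo[OF assms] finite_actions[OF assms]
  show "finite (choices (wtca D \<sigma>) j)" "choices (wtca D \<sigma>) j \<noteq> {}"
    using fin endo_nonempty[OF assms] actions_nonempty[OF assms] by (auto simp: wtca_def)
  have "choices (wtca D \<sigma>) j \<subseteq> endo D j \<times> actions D j"
    using wtca_choice[OF assms] by auto
  then have "card (choices (wtca D \<sigma>) j) \<le> card (endo D j \<times> actions D j)"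
    using fin by (intro card_mono) auto
  then show "card (choices (wtca D \<sigma>) j) \<le> S"
    using card_le[OF assms] by (simp add: card_cartesian_product)
qed

lemma well_posed_wtca: "well_posed (wtca D \<sigma>)"
proof (rule well_posedI[where b = 1])
  show "prob_space (law (wtca D \<sigma>))" using exo.prob_space_axioms by simp
  show "0 < smoothing (wtca D \<sigma>)" "smoothing (wtca D \<sigma>) < 1" using \<sigma> by simp_all
next
  fix j assume "j < comps (wtca D \<sigma>)"
  then show "0 < weight (wtca D \<sigma>) j \<and> finite (choices (wtca D \<sigma>) j) \<and> choices (wtca D \<sigma>) j \<noteq> {} \<and>
      finite (appearing (wtca D \<sigma>) j)"
    using wtca_choices_facts[of j] discount by simp
next
  fix j u assume "j < comps (wtca D \<sigma>)" and u: "u \<in> choices (wtca D \<sigma>) j"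
  then have j: "j < T" by simp
  obtain x a where ua: "u = (x, a)" by fastforce
  note xa = wtca_choice[OF j u[unfolded ua]]
  show "integrable (law (wtca D \<sigma>)) (\<lambda>w. offset (wtca D \<sigma>) j w u)"
    using integrable_reward[OF j xa] by (cases "j = 0") (simp_all add: wtca_def ua)
next
  fix j u t w
  assume "t \<notin> appearing (wtca D \<sigma>) j"
  then show "slope (wtca D \<sigma>) j w u t = 0" by (cases u) (auto simp: wtca_def)
qed (use wtca_slope in simp_all)

text \<open>A component touches at most two stages and \<open>appearing\<close> has two elements,
  which gives the 4. The Frobenius bound with slopes of norm at most 1 contributes \<open>S\<close>,
  and the weights \<open>\<gamma> ^ j\<close> sum to at most
  \<open>1 / (1 - \<gamma>)\<close>.\<close>

lemma total_weight_wtca_le: "total_weight (wtca D \<sigma>) \<le> 4 * real S / (\<sigma> * (1 - \<gamma>))"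
proof -
  interpret smoothed "wtca D \<sigma>" by unfold_locales (rule well_posed_wtca)
  have cl: "comp_lipschitz (wtca D \<sigma>) j t \<le> \<gamma> ^ j / \<sigma> * real S" if j: "j < T" and t: "t < T" for j t
  proof -
    have "comp_lipschitz (wtca D \<sigma>) j t \<le> weight (wtca D \<sigma>) j / smoothing (wtca D \<sigma>) *
        (real (card (choices (wtca D \<sigma>) j)) * 1\<^sup>2)"
      using j t wtca_slope(2)[OF j _ t] by (intro comp_lipschitz_le) auto
    also have "\<dots> = \<gamma> ^ j / \<sigma> * card (choices (wtca D \<sigma>) j)" by simp
    also have "\<dots> \<le> \<gamma> ^ j / \<sigma> * real S"
      using wtca_choices_facts(3)[OF j] discount \<sigma> by (intro mult_left_mono) auto
    finally show ?thesis .
  qed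
  have "total_weight (wtca D \<sigma>) = (\<Sum>j<T. 2 * (\<Sum>t | t < T \<and> t \<in> {j, Suc j}. comp_lipschitz (wtca D \<sigma>) j t))"
    unfolding total_weight_eq by simp
  also have "\<dots> \<le> (\<Sum>j<T. 2 * (2 * (\<gamma> ^ j / \<sigma> * real S)))"
  proof (intro sum_mono mult_left_mono)
    fix j assume "j \<in> {..<T}"
    then have j: "j < T" by simp
    let ?I = "{t. t < T \<and> t \<in> {j, Suc j}}"
    have "(\<Sum>t\<in>?I. comp_lipschitz (wtca D \<sigma>) j t) \<le> (\<Sum>t\<in>?I. \<gamma> ^ j / \<sigma> * real S)"
      using j by (intro sum_mono cl) auto
    also have "\<dots> = real (card ?I) * (\<gamma> ^ j / \<sigma> * real S)" by simp
    also have "\<dots> \<le> 2 * (\<gamma> ^ j / \<sigma> * real S)"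
    proof (rule mult_right_mono)
      have "card ?I \<le> card {j, Suc j}" by (intro card_mono) auto
      then show "real (card ?I) \<le> 2" by simp
    qed (use discount \<sigma> in auto)
    finally show "(\<Sum>t\<in>?I. comp_lipschitz (wtca D \<sigma>) j t) \<le> 2 * (\<gamma> ^ j / \<sigma> * real S)" .
  qed simp
  also have "\<dots> = 4 * real S / \<sigma> * (\<Sum>j<T. \<gamma> ^ j)"
    unfolding sum_distrib_left by (intro sum.cong refl) simp
  also have "\<dots> \<le> 4 * real S / \<sigma> * (1 / (1 - \<gamma>))"
    using \<sigma> discount by (intro mult_left_mono sum_power_le) auto
  finally show ?thesis by simp
qed

section \<open>The PO formulation\<close>

lemma induced_state_in:
  assumes u: "u \<in> policies D"
  shows "t < T \<Longrightarrow> induced_state D u t \<in> endo D t"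
proof (induction t)
  case (Suc t)
  have "u t \<in> actions D t" using PiE_mem[OF u[unfolded policies_def], of t] Suc.prems by simp
  then show ?case using trans_in[OF Suc.prems Suc.IH] Suc.prems by simp
qed (simp add: endo0_in)

lemma finite_policies: "finite (policies D)"
  unfolding policies_def by (rule finite_PiE) (simp_all add: finite_actions)

lemma policies_nonempty: "policies D \<noteq> {}"
  by (simp add: policies_def PiE_eq_empty_iff actions_nonempty)

lemma po_slope:
  assumes u: "u \<in> policies D" and t: "t < T"
  shows "(\<lambda>w. slope (po D \<sigma>) j w u t) \<in> borel_measurable (exo_law D)"
    and "w \<in> space (exo_law D) \<Longrightarrow> norm (slope (po D \<sigma>) j w u t) \<le> 2 * \<gamma> ^ t"
proof -
  have "(\<lambda>w. slope (po D \<sigma>) j w u t) \<in> borel_measurable (exo_law D) \<and>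
    (w \<in> space (exo_law D) \<longrightarrow> norm (slope (po D \<sigma>) j w u t) \<le> 2 * \<gamma> ^ t)"
  proof (cases t)
    case 0
    then show ?thesis using discount by (simp add: po_def)
  next
    case (Suc s)
    then have s: "s < T" "Suc s < T" using t by auto
    define x where "x = induced_state D u (Suc s)"
    have x: "x \<in> endo D (Suc s)" unfolding x_def by (rule induced_state_in[OF u s(2)])
    have eq: "slope (po D \<sigma>) j w u t = \<gamma> ^ t *\<^sub>R (next_basis D s x (w s) - basis D (Suc s) (x, w (Suc s)))" for w
      unfolding po_def x_def Suc by simp
    have "(\<lambda>w. slope (po D \<sigma>) j w u t) \<in> borel_measurable (exo_law D)"
      unfolding eq
      using measurable_compose[OF measurable_exo[OF s(2)] measurable_basis[OF s(2) x]]
        measurable_compose[OF measurable_exo[OF s(1)] measurable_next_basis[OF s(2) x]]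
      by (intro borel_measurable_scaleR borel_measurable_diff borel_measurable_const)
    moreover have "norm (slope (po D \<sigma>) j w u t) \<le> 2 * \<gamma> ^ t" if w: "w \<in> space (exo_law D)"
    proof -
      have "norm (next_basis D s x (w s) - basis D (Suc s) (x, w (Suc s))) \<le> 2"
        using norm_basis_le[OF s(2) x space_exo[OF s(2) w]] norm_next_basis_le[OF s(2) x space_exo[OF s(1) w]]
          norm_triangle_ineq4[of "next_basis D s x (w s)" "basis D (Suc s) (x, w (Suc s))"] by linarith
      then have "\<gamma> ^ t * norm (next_basis D s x (w s) - basis D (Suc s) (x, w (Suc s))) \<le> \<gamma> ^ t * 2"
        using discount by (intro mult_left_mono) auto
      then show ?thesis using discount unfolding eq norm_scaleR by (simp add: mult.commute)
    qed
    ultimately show ?thesis by blast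
  qed
  then show "(\<lambda>w. slope (po D \<sigma>) j w u t) \<in> borel_measurable (exo_law D)"
    and "w \<in> space (exo_law D) \<Longrightarrow> norm (slope (po D \<sigma>) j w u t) \<le> 2 * \<gamma> ^ t" by auto
qed

lemma well_posed_po: "well_posed (po D \<sigma>)"
proof (rule well_posedI[where b = 2])
  show "prob_space (law (po D \<sigma>))" using exo.prob_space_axioms by simp
  show "0 < smoothing (po D \<sigma>)" "smoothing (po D \<sigma>) < 1" using \<sigma> by simp_all
next
  fix j
  show "0 < weight (po D \<sigma>) j \<and> finite (choices (po D \<sigma>) j) \<and> choices (po D \<sigma>) j \<noteq> {} \<and>
      finite (appearing (po D \<sigma>) j)"
    using finite_policies policies_nonempty by simp
next
  fix j u assume "u \<in> choices (po D \<sigma>) j"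
  then have u: "u \<in> policies D" by simp
  have "integrable (exo_law D) (\<lambda>w. reward D t (induced_state D u t, w t) (u t))" if "t < T" for t
    using integrable_reward[OF that induced_state_in[OF u that]] PiE_mem[OF u[unfolded policies_def]] that by simp
  then show "integrable (law (po D \<sigma>)) (\<lambda>w. offset (po D \<sigma>) j w u)"
    unfolding po_simps by (intro Bochner_Integration.integrable_sum integrable_mult_right) simp
next
  fix j u t assume *: "u \<in> choices (po D \<sigma>) j" "t < stages (po D \<sigma>)"
  then show "(\<lambda>w. slope (po D \<sigma>) j w u t) \<in> borel_measurable (law (po D \<sigma>))"
    using po_slope(1)[of u t j] by simp
  fix w assume "w \<in> space (law (po D \<sigma>))"
  then have "norm (slope (po D \<sigma>) j w u t) \<le> 2 * \<gamma> ^ t" using * po_slope(2)[of u t w j] by simp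
  also have "\<dots> \<le> 2" using discount by (simp add: power_le_one)
  finally show "norm (slope (po D \<sigma>) j w u t) \<le> 2" .
next
  fix j t assume "t < stages (po D \<sigma>)" "t \<notin> appearing (po D \<sigma>) j"
  then show "slope (po D \<sigma>) j w u t = 0" for w u by simp
qed

text \<open>The 4 is the square of the slope factor 2, and the horizon is the number of appearing
  blocks. The slopes give \<open>\<gamma> ^ (2 * t)\<close>, relaxed to \<open>\<gamma> ^ t\<close>
  so that the geometric series has the stated denominator.\<close>

lemma total_weight_po_le:
  "total_weight (po D \<sigma>) \<le> 4 * (real (card (policies D)) * real T / (\<sigma> * (1 - \<gamma>)))"
proof -
  interpret smoothed "po D \<sigma>" by unfold_locales (rule well_posed_po)
  let ?A = "real (card (policies D))"
  have cl: "comp_lipschitz (po D \<sigma>) 0 t \<le> 4 * ?A / \<sigma> * \<gamma> ^ t" if t: "t < T" for t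
  proof -
    have "comp_lipschitz (po D \<sigma>) 0 t \<le> weight (po D \<sigma>) 0 / smoothing (po D \<sigma>) *
        (card (choices (po D \<sigma>) 0) * (2 * \<gamma> ^ t)\<^sup>2)"
      using t po_slope(2)[OF _ t] by (intro comp_lipschitz_le) auto
    also have "\<dots> = 4 * ?A / \<sigma> * (\<gamma> ^ t * \<gamma> ^ t)" by (simp add: power2_eq_square)
    also have "\<dots> \<le> 4 * ?A / \<sigma> * (\<gamma> ^ t * 1)"
      using discount \<sigma> by (intro mult_left_mono) (auto simp: power_le_one)
    finally show ?thesis by simp
  qed
  have "total_weight (po D \<sigma>) = T * (\<Sum>t<T. comp_lipschitz (po D \<sigma>) 0 t)"
    unfolding total_weight_eq by (simp add: lessThan_def)
  also have "\<dots> \<le> T * (\<Sum>t<T. 4 * ?A / \<sigma> * \<gamma> ^ t)"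
    by (intro mult_left_mono sum_mono cl) auto
  also have "\<dots> = 4 * ?A * T / \<sigma> * (\<Sum>t<T. \<gamma> ^ t)"
    unfolding sum_distrib_left by (intro sum.cong refl) simp
  also have "\<dots> \<le> 4 * ?A * T / \<sigma> * (1 / (1 - \<gamma>))"
    using \<sigma> discount by (intro mult_left_mono sum_power_le) auto
  finally show ?thesis by simp
qed

end

section \<open>Iteration complexity of the two formulations\<close>

lemma wtca_iteration_complexity:
  fixes M :: real and S :: nat
  shows "\<exists>C p. \<exists>\<chi>2 :: real \<Rightarrow> real. \<forall>(D :: ('x, 'a, 'v, 'd::finite) mdp) \<sigma> \<Omega> \<beta>opt
          (P :: 'q measure) W \<epsilon>.
        valid_mdp S D \<and> 0 < \<sigma> \<and> \<sigma> < 1 \<and> psbcd_run (wtca D \<sigma>) \<Omega> \<beta>opt M P W \<and> 0 < \<epsilon> \<longrightarrow>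
          variance_bound (wtca D \<sigma>) \<Omega> P W (\<chi>2 (discount D)) \<and>
          1 / \<epsilon>\<^sup>2 * (total_weight (wtca D \<sigma>))\<^sup>2 \<le> C * (1 / (\<sigma> * (1 - discount D) * \<epsilon>)\<^sup>2) \<and>
          achieves_within (wtca D \<sigma>) \<Omega> \<beta>opt P W \<epsilon>
            (soft_bound C p (1 / (\<sigma> * (1 - discount D) * \<epsilon>)\<^sup>2))"
proof -
  \<comment> \<open>The weight bound \<open>4 * S * X\<close> times \<open>2 * M^2\<close> gives the
    second summand. The 1 absorbs the variance constant \<open>1 / (1 - \<gamma>)\<close>, which is
    at most \<open>X\<close> because \<open>\<sigma> < 1\<close>.\<close>
  define a where "a = 1 + 8 * M\<^sup>2 * real S"
  \<comment> \<open>One constant serves two claims: the first summand the iteration count, the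
    second the comparison of squared weights.\<close>
  define C where "C = (a * (36 * a + 4))\<^sup>2 + 16 * (real S)\<^sup>2"
  have a: "1 \<le> a" by (simp add: a_def)
  show ?thesis
  \<comment> \<open>The variance is at most \<open>\<sigma>\<close> times the sum of the weights
    \<open>\<gamma> ^ j\<close>; with \<open>\<sigma> < 1\<close> the geometric series gives this
    witness, free of the horizon.\<close>
  proof (rule exI[of _ C], rule exI[of _ 2], rule exI[of _ "\<lambda>\<gamma>. 1 / (1 - \<gamma>)"], intro allI impI, elim conjE)
    fix D :: "('x, 'a, 'v, 'd) mdp" and \<sigma> \<Omega> \<beta>opt and P :: "'q measure" and W and \<epsilon> :: real
    assume valid: "valid_mdp S D" and \<sigma>: "0 < \<sigma>" "\<sigma> < 1" and run: "psbcd_run (wtca D \<sigma>) \<Omega> \<beta>opt M P W" and \<epsilon>: "0 < \<epsilon>"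
    interpret m: mdp_formulations S D \<sigma> by unfold_locales (fact valid \<sigma>)+
    interpret psbcd_process "wtca D \<sigma>" \<Omega> \<beta>opt M P W by unfold_locales (fact m.well_posed_wtca run)+
    define X where "X = 1 / (\<sigma> * (1 - discount D))"
    have X: "0 < X" using \<sigma> m.discount by (simp add: X_def)
    have geq: "1 / (\<sigma> * (1 - discount D) * \<epsilon>)\<^sup>2 = X\<^sup>2 / \<epsilon>\<^sup>2"
      by (simp add: X_def power_mult_distrib power_divide)
    have tw: "total_weight (wtca D \<sigma>) \<le> 4 * real S * X"
      using m.total_weight_wtca_le by (simp add: X_def)
    have tw0: "0 \<le> total_weight (wtca D \<sigma>)" by (simp add: total_weight_def sum_nonneg block_weight_nonneg)
    have \<chi>0: "0 \<le> 1 / (1 - discount D)" using m.discount by simp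
    have \<chi>X: "1 / (1 - discount D) \<le> X"
      unfolding X_def using \<sigma> m.discount by (intro divide_left_mono) (auto simp: mult_le_one mult_left_le_one_le)
    have "smoothing (wtca D \<sigma>) * (\<Sum>j<comps (wtca D \<sigma>). weight (wtca D \<sigma>) j) \<le> 1 * (1 / (1 - discount D))"
      using \<sigma> m.discount sum_power_le[OF m.discount, of "horizon D"]
      by (intro mult_mono) (auto simp: sum_nonneg)
    then have var: "variance_bound (wtca D \<sigma>) \<Omega> P W (1 / (1 - discount D))"
      by (intro variance_boundI) simp
    have "(total_weight (wtca D \<sigma>))\<^sup>2 \<le> (4 * real S * X)\<^sup>2" using tw tw0 by (rule power_mono)
    also have "\<dots> = 16 * (real S)\<^sup>2 * X\<^sup>2" by (simp add: power_mult_distrib)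
    also have "\<dots> \<le> C * X\<^sup>2" by (intro mult_right_mono) (auto simp: C_def)
    finally have weight: "1 / \<epsilon>\<^sup>2 * (total_weight (wtca D \<sigma>))\<^sup>2 \<le> C * (1 / (\<sigma> * (1 - discount D) * \<epsilon>)\<^sup>2)"
      unfolding geq using \<epsilon> by (simp add: divide_right_mono)
    have "2 * M\<^sup>2 * total_weight (wtca D \<sigma>) \<le> 2 * M\<^sup>2 * (4 * real S * X)"
      using tw by (intro mult_left_mono) auto
    then have "2 * M\<^sup>2 * total_weight (wtca D \<sigma>) + 1 / (1 - discount D) \<le> 2 * M\<^sup>2 * (4 * real S * X) + X"
      using \<chi>X by (rule add_mono)
    also have "\<dots> = a * X" by (simp add: a_def distrib_right)
    finally have "2 * M\<^sup>2 * total_weight (wtca D \<sigma>) + 1 / (1 - discount D) \<le> a * X" .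
    moreover have "\<epsilon> * sqrt (1 / (\<sigma> * (1 - discount D) * \<epsilon>)\<^sup>2) = X"
      unfolding geq using \<epsilon> X by (simp add: real_sqrt_divide)
    ultimately have "achieves_within (wtca D \<sigma>) \<Omega> \<beta>opt P W \<epsilon> (soft_bound C 2 (1 / (\<sigma> * (1 - discount D) * \<epsilon>)\<^sup>2))"
      by (intro achieves_withinI[OF var \<chi>0 \<epsilon> _ a]) (auto simp: C_def)
    with var weight show "variance_bound (wtca D \<sigma>) \<Omega> P W (1 / (1 - discount D)) \<and>
          1 / \<epsilon>\<^sup>2 * (total_weight (wtca D \<sigma>))\<^sup>2 \<le> C * (1 / (\<sigma> * (1 - discount D) * \<epsilon>)\<^sup>2) \<and>
          achieves_within (wtca D \<sigma>) \<Omega> \<beta>opt P W \<epsilon> (soft_bound C 2 (1 / (\<sigma> * (1 - discount D) * \<epsilon>)\<^sup>2))"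
      by blast
  qed
qed

lemma po_iteration_complexity:
  fixes M :: real and S :: nat
  shows "\<exists>C p. \<exists>\<chi>2 :: real \<Rightarrow> real. \<forall>(D :: ('x, 'a, 'v, 'd::finite) mdp) \<sigma> \<Omega> \<beta>opt
          (P :: 'q measure) W \<epsilon>.
        valid_mdp S D \<and> 0 < \<sigma> \<and> \<sigma> < 1 \<and> psbcd_run (po D \<sigma>) \<Omega> \<beta>opt M P W \<and> 0 < \<epsilon> \<longrightarrow>
          variance_bound (po D \<sigma>) \<Omega> P W (\<chi>2 (discount D)) \<and>
          1 / \<epsilon>\<^sup>2 * (total_weight (po D \<sigma>))\<^sup>2
            \<le> C * ((real (card (policies D)))\<^sup>2 * (real (horizon D))\<^sup>2
                     / (\<sigma> * (1 - discount D) * \<epsilon>)\<^sup>2) \<and>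
          achieves_within (po D \<sigma>) \<Omega> \<beta>opt P W \<epsilon>
            (soft_bound C p ((real (card (policies D)))\<^sup>2 * (real (horizon D))\<^sup>2
                               / (\<sigma> * (1 - discount D) * \<epsilon>)\<^sup>2))"
proof -
  define a where "a = 1 + 8 * M\<^sup>2"
  define C where "C = (a * (36 * a + 4))\<^sup>2 + 16"
  have a: "1 \<le> a" by (simp add: a_def)
  show ?thesis
  \<comment> \<open>PO has a single component of weight 1, so the variance is at most
    \<open>\<sigma> < 1\<close>.\<close>
  proof (rule exI[of _ C], rule exI[of _ 2], rule exI[of _ "\<lambda>_. 1"], intro allI impI, elim conjE)
    fix D :: "('x, 'a, 'v, 'd) mdp" and \<sigma> \<Omega> \<beta>opt and P :: "'q measure" and W and \<epsilon> :: real
    assume valid: "valid_mdp S D" and \<sigma>: "0 < \<sigma>" "\<sigma> < 1" and run: "psbcd_run (po D \<sigma>) \<Omega> \<beta>opt M P W" and \<epsilon>: "0 < \<epsilon>"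
    interpret m: mdp_formulations S D \<sigma> by unfold_locales (fact valid \<sigma>)+
    interpret psbcd_process "po D \<sigma>" \<Omega> \<beta>opt M P W by unfold_locales (fact m.well_posed_po run)+
    let ?A = "real (card (policies D))" and ?T = "real (horizon D)"
    let ?g = "?A\<^sup>2 * ?T\<^sup>2 / (\<sigma> * (1 - discount D) * \<epsilon>)\<^sup>2"
    define X where "X = ?A * ?T / (\<sigma> * (1 - discount D))"
    \<comment> \<open>With at least one policy and one stage the scale \<open>X\<close> is at least
      1, so it absorbs the variance constant.\<close>
    have A: "1 \<le> ?A" using m.finite_policies m.policies_nonempty by (simp add: Suc_leI card_gt_0_iff)
    have "1 * 1 \<le> ?A * ?T" using A m.horizon by (intro mult_mono) auto
    moreover have "\<sigma> * (1 - discount D) \<le> 1 * 1" using \<sigma> m.discount by (intro mult_mono) auto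
    ultimately have X1: "1 \<le> X" using \<sigma> m.discount by (simp add: X_def le_divide_eq)
    have geq: "?g = X\<^sup>2 / \<epsilon>\<^sup>2"
      by (simp add: X_def power_mult_distrib power_divide)
    have tw: "total_weight (po D \<sigma>) \<le> 4 * X"
      using m.total_weight_po_le by (simp add: X_def)
    have tw0: "0 \<le> total_weight (po D \<sigma>)" by (simp add: total_weight_def sum_nonneg block_weight_nonneg)
    have var: "variance_bound (po D \<sigma>) \<Omega> P W 1"
      using \<sigma> by (intro variance_boundI) simp
    have "(total_weight (po D \<sigma>))\<^sup>2 \<le> (4 * X)\<^sup>2" using tw tw0 by (rule power_mono)
    also have "\<dots> = 16 * X\<^sup>2" by (simp add: power_mult_distrib)
    also have "\<dots> \<le> C * X\<^sup>2" by (intro mult_right_mono) (auto simp: C_def)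
    finally have weight: "1 / \<epsilon>\<^sup>2 * (total_weight (po D \<sigma>))\<^sup>2 \<le> C * ?g"
      unfolding geq using \<epsilon> by (simp add: divide_right_mono)
    have "2 * M\<^sup>2 * total_weight (po D \<sigma>) \<le> 2 * M\<^sup>2 * (4 * X)"
      using tw by (intro mult_left_mono) auto
    then have "2 * M\<^sup>2 * total_weight (po D \<sigma>) + 1 \<le> 2 * M\<^sup>2 * (4 * X) + X"
      using X1 by (rule add_mono)
    also have "\<dots> = a * X" by (simp add: a_def distrib_right)
    finally have "2 * M\<^sup>2 * total_weight (po D \<sigma>) + 1 \<le> a * X" .
    moreover have "\<epsilon> * sqrt ?g = X"
      unfolding geq using \<epsilon> X1 by (simp add: real_sqrt_divide)
    ultimately have "achieves_within (po D \<sigma>) \<Omega> \<beta>opt P W \<epsilon> (soft_bound C 2 ?g)"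
      by (intro achieves_withinI[OF var _ \<epsilon> _ a]) (auto simp: C_def)
    with var weight show "variance_bound (po D \<sigma>) \<Omega> P W 1 \<and>
          1 / \<epsilon>\<^sup>2 * (total_weight (po D \<sigma>))\<^sup>2 \<le> C * ?g \<and>
          achieves_within (po D \<sigma>) \<Omega> \<beta>opt P W \<epsilon> (soft_bound C 2 ?g)"
      by blast
  qed
qed

theorem corollary1:
  shows
    "(\<forall>M \<chi>2 \<nu>min. 0 \<le> \<chi>2 \<and> 0 < \<nu>min \<longrightarrow>
       (\<exists>C p. \<forall>(Q :: ('w, 'u, 'b::finite) smoothed_problem) \<Omega> \<beta>opt (P :: 'p measure) W \<epsilon>.
          well_posed Q \<and> \<nu>min \<le> total_weight Q \<and> psbcd_run Q \<Omega> \<beta>opt M P W \<and>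
          variance_bound Q \<Omega> P W \<chi>2 \<and> 0 < \<epsilon> \<longrightarrow>
            achieves_within Q \<Omega> \<beta>opt P W \<epsilon>
              (soft_bound C p (1 / \<epsilon>\<^sup>2 * (total_weight Q)\<^sup>2))))
     \<and>
     (\<forall>M S. \<exists>C p. \<exists>\<chi>2 :: real \<Rightarrow> real. \<forall>(D :: ('x, 'a, 'v, 'd::finite) mdp) \<sigma> \<Omega> \<beta>opt
          (P :: 'q measure) W \<epsilon>.
        valid_mdp S D \<and> 0 < \<sigma> \<and> \<sigma> < 1 \<and> psbcd_run (wtca D \<sigma>) \<Omega> \<beta>opt M P W \<and> 0 < \<epsilon> \<longrightarrow>
          variance_bound (wtca D \<sigma>) \<Omega> P W (\<chi>2 (discount D)) \<and>
          1 / \<epsilon>\<^sup>2 * (total_weight (wtca D \<sigma>))\<^sup>2 \<le> C * (1 / (\<sigma> * (1 - discount D) * \<epsilon>)\<^sup>2) \<and>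
          achieves_within (wtca D \<sigma>) \<Omega> \<beta>opt P W \<epsilon>
            (soft_bound C p (1 / (\<sigma> * (1 - discount D) * \<epsilon>)\<^sup>2)))
     \<and>
     (\<forall>M S. \<exists>C p. \<exists>\<chi>2 :: real \<Rightarrow> real. \<forall>(D :: ('x, 'a, 'v, 'd::finite) mdp) \<sigma> \<Omega> \<beta>opt
          (P :: 'q measure) W \<epsilon>.
        valid_mdp S D \<and> 0 < \<sigma> \<and> \<sigma> < 1 \<and> psbcd_run (po D \<sigma>) \<Omega> \<beta>opt M P W \<and> 0 < \<epsilon> \<longrightarrow>
          variance_bound (po D \<sigma>) \<Omega> P W (\<chi>2 (discount D)) \<and>
          1 / \<epsilon>\<^sup>2 * (total_weight (po D \<sigma>))\<^sup>2
            \<le> C * ((real (card (policies D)))\<^sup>2 * (real (horizon D))\<^sup>2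
                     / (\<sigma> * (1 - discount D) * \<epsilon>)\<^sup>2) \<and>
          achieves_within (po D \<sigma>) \<Omega> \<beta>opt P W \<epsilon>
            (soft_bound C p ((real (card (policies D)))\<^sup>2 * (real (horizon D))\<^sup>2
                               / (\<sigma> * (1 - discount D) * \<epsilon>)\<^sup>2)))"
  by (intro conjI allI impI wtca_iteration_complexity po_iteration_complexity psbcd_iteration_complexity) auto

end
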